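(* Let $CD\Gamma(N)=(\chi_{bc}^a,A_{jc}^i,H_{jk}^i,C_{j(c)}^{i(k)})$ be an $h$-normal $N$-linear connection of Cartan type on $E^*=J^{1*}(\mathcal T,M)$. Then the following thirty local Bianchi identities hold ($\sum$ denotes a cyclic sum and $\mathcal A$ an alternate sum over the displayed indices). First set: 1. $\sum_{\{a,b,c\}}\chi_{abc}^d=0$. 2. $\mathcal A_{\{a,b\}}\{T_{ar}^lT_{bk}^r-T_{ak/b}^l\}=R_{kab}^l-C_{k(f)}^{l(r)}R_{(r)ab}^{(f)}$. 3. $\mathcal A_{\{j,k\}}\{C_{k(f)}^{l(r)}R_{(r)aj}^{(f)}+R_{jak}^l+T_{aj|k}^l\}=0$. 4. $\sum_{\{i,j,k\}}\{C_{k(f)}^{l(r)}R_{(r)ij}^{(f)}-R_{ijk}^l\}=0$. Second set: 5. $\sum_{\{a,b,c\}}\{R_{(l)ab/c}^{(d)}+P_{(l)c(f)}^{(d)\ (r)}R_{(r)ab}^{(f)}\}=0$. 6. $\mathcal A_{\{a,b\}}\{R_{(l)ak/b}^{(d)}+P_{(l)b(f)}^{(d)\ (r)}R_{(r)ak}^{(f)}+R_{(l)br}^{(d)}T_{ak}^r\}=R_{(l)ab|k}^{(d)}+P_{(l)k(f)}^{(d)\ (r)}R_{(r)ab}^{(f)}$. 7. $\mathcal A_{\{j,k\}}\{R_{(l)aj|k}^{(d)}+P_{(l)k(f)}^{(d)\ (r)}R_{(r)aj}^{(f)}+R_{(l)kr}^{(d)}T_{aj}^r\}=-R_{(l)jk/a}^{(d)}-P_{(l)a(f)}^{(d)\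 (r)}R_{(r)jk}^{(f)}$. 8. $\sum_{\{i,j,k\}}\{R_{(l)ij|k}^{(d)}+P_{(l)k(f)}^{(d)\ (r)}R_{(r)ij}^{(f)}\}=0$. Third set: 9. $T_{ak}^l|_{(e)}^{(p)}-C_{r(e)}^{l(p)}T_{ak}^r+P_{ka(e)}^{l\ (p)}+C_{k(e)/a}^{l(p)}-C_{k(f)}^{l(r)}P_{(r)a(e)}^{(f)\ (p)}+C_{k(e)}^{r(p)}T_{ar}^l=0$. 10. $\mathcal A_{\{j,k\}}\{C_{j(e)|k}^{l(p)}+C_{k(f)}^{l(r)}P_{(r)j(e)}^{(f)\ (p)}+P_{jk(e)}^{l\ (p)}\}=0$. Fourth set: 11. $\mathcal A_{\{a,b\}}\{P_{(l)a(e)/b}^{(d)\ (p)}+P_{(l)b(f)}^{(d)\ (r)}P_{(r)a(e)}^{(f)\ (p)}\}=R_{(l)ab}^{(d)}|_{(e)}^{(p)}+R_{(l)(e)ab}^{(d)(p)}+S_{(l)(e)(f)}^{(d)(p)(r)}R_{(r)ab}^{(f)}$. 12. $\mathcal A_{\{a,k\}}\{P_{(l)a(e)|k}^{(d)\ (p)}+P_{(l)k(f)}^{(d)\ (r)}P_{(r)a(e)}^{(f)\ (p)}\}=R_{(l)ak}^{(d)}|_{(e)}^{(p)}+R_{(l)(e)ak}^{(d)(p)}+S_{(l)(e)(f)}^{(d)(p)(r)}R_{(r)ak}^{(f)}+R_{(l)ar}^{(d)}C_{k(e)}^{r(p)}-T_{ak}^rP_{(l)r(e)}^{(d)\ (p)}$.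 13. $\mathcal A_{\{j,k\}}\{P_{(l)j(e)|k}^{(d)\ (p)}+P_{(l)k(f)}^{(d)\ (r)}P_{(r)j(e)}^{(f)\ (p)}+R_{(l)kr}^{(d)}C_{j(e)}^{r(p)}\}=R_{(l)jk}^{(d)}|_{(e)}^{(p)}+R_{(l)(e)jk}^{(d)(p)}+S_{(l)(e)(f)}^{(d)(p)(r)}R_{(r)jk}^{(f)}$. Fifth set: 14. $\mathcal A_{\{{}_{(b)}^{(j)},{}_{(c)}^{(k)}\}}\{C_{i(b)}^{l(j)}|_{(c)}^{(k)}+C_{i(c)}^{r(k)}C_{r(b)}^{l(j)}\}=S_{i(b)(c)}^{l(j)(k)}-C_{i(f)}^{l(r)}S_{(r)(b)(c)}^{(f)(j)(k)}$. Sixth set: 15. $\mathcal A_{\{{}_{(b)}^{(j)},{}_{(c)}^{(k)}\}}\{P_{(l)a(b)}^{(d)\ (j)}|_{(c)}^{(k)}+P_{(r)a(b)}^{(f)\ (j)}S_{(l)(c)(f)}^{(d)(k)(r)}-P_{(l)(b)a(c)}^{(d)(j)\ (k)}\}=-S_{(l)(b)(c)/a}^{(d)(j)(k)}-S_{(r)(b)(c)}^{(f)(j)(k)}P_{(l)a(f)}^{(d)\ (r)}$. 16. $\mathcal A_{\{{}_{(b)}^{(j)},{}_{(c)}^{(k)}\}}\{P_{(l)i(b)}^{(d)\ (j)}|_{(c)}^{(k)}+P_{(r)i(b)}^{(f)\ (j)}S_{(l)(c)(f)}^{(d)(k)(r)}-P_{(l)(b)i(c)}^{(d)(j)\ (k)}-C_{i(b)}^{r(j)}P_{(l)r(c)}^{(d)\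 (k)}\}=-S_{(l)(b)(c)|i}^{(d)(j)(k)}-S_{(r)(b)(c)}^{(f)(j)(k)}P_{(l)i(f)}^{(d)\ (r)}$. Seventh set: 17. $\sum_{\{{}_{(a)}^{(i)},{}_{(b)}^{(j)},{}_{(c)}^{(k)}\}}\{S_{(l)(a)(b)}^{(d)(i)(j)}|_{(c)}^{(k)}+S_{(r)(a)(b)}^{(f)(i)(j)}S_{(l)(c)(f)}^{(d)(k)(r)}+S_{(l)(a)(b)(c)}^{(d)(i)(j)(k)}\}=0$. Eighth set: 18. $\sum_{\{a,b,c\}}\chi_{eab/c}^d=0$. 19. $\chi_{eab|k}^d=0$. 20. $\chi_{eab}^d|_{(c)}^{(k)}=0$. 21. $\sum_{\{a,b,c\}}\{R_{pab/c}^l+R_{(r)ab}^{(f)}P_{pc(f)}^{l\ (r)}\}=0$. 22. $\mathcal A_{\{a,b\}}\{R_{pak/b}^l+R_{(r)ak}^{(f)}P_{pb(f)}^{l\ (r)}+T_{ak}^rR_{pbr}^l\}=R_{pab|k}^l+R_{(r)ab}^{(f)}P_{pk(f)}^{l\ (r)}$. 23. $\mathcal A_{\{j,k\}}\{R_{paj|k}^l+R_{(r)aj}^{(f)}P_{pk(f)}^{l\ (r)}+T_{aj}^rR_{pkr}^l\}=-R_{pjk/a}^l-R_{(r)jk}^{(f)}P_{pa(f)}^{l\ (r)}$. 24. $\sum_{\{i,j,k\}}\{R_{pij|k}^l+R_{(r)ij}^{(f)}P_{pk(f)}^{l\ (r)}\}=0$. Ninth set: 25. $\mathcal A_{\{a,b\}}\{P_{ia(e)/b}^{l\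 (p)}+P_{(r)a(e)}^{(f)\ (p)}P_{ib(f)}^{l\ (r)}\}=R_{iab}^l|_{(e)}^{(p)}+R_{(r)ab}^{(f)}S_{i(e)(f)}^{l(p)(r)}$. 26. $\mathcal A_{\{a,k\}}\{P_{ia(e)|k}^{l\ (p)}+P_{(r)a(e)}^{(f)\ (p)}P_{ik(f)}^{l\ (r)}\}=R_{iak}^l|_{(e)}^{(p)}+R_{(r)ak}^{(f)}S_{i(e)(f)}^{l(p)(r)}+C_{k(e)}^{r(p)}R_{iar}^l-T_{ak}^rP_{ir(e)}^{l\ (p)}$. 27. $\mathcal A_{\{j,k\}}\{P_{ij(e)|k}^{l\ (p)}+P_{(r)j(e)}^{(f)\ (p)}P_{ik(f)}^{l\ (r)}+C_{j(e)}^{r(p)}R_{ikr}^l\}=R_{ijk}^l|_{(e)}^{(p)}+R_{(r)jk}^{(f)}S_{i(e)(f)}^{l(p)(r)}$. Tenth set: 28. $\mathcal A_{\{{}_{(b)}^{(j)},{}_{(c)}^{(k)}\}}\{P_{pa(b)}^{l\ (j)}|_{(c)}^{(k)}+P_{(r)a(b)}^{(f)\ (j)}S_{p(c)(f)}^{l(k)(r)}\}=-S_{p(b)(c)/a}^{l(j)(k)}-S_{(r)(b)(c)}^{(f)(j)(k)}P_{pa(f)}^{l\ (r)}$. 29. $\mathcal A_{\{{}_{(b)}^{(j)},{}_{(c)}^{(k)}\}}\{P_{pi(b)}^{l\ (j)}|_{(c)}^{(k)}+P_{(r)i(b)}^{(f)\ (j)}S_{p(c)(f)}^{l(k)(r)}-C_{i(b)}^{r(j)}P_{pr(c)}^{l\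 (k)}\}=-S_{p(b)(c)|i}^{l(j)(k)}-S_{(r)(b)(c)}^{(f)(j)(k)}P_{pi(f)}^{l\ (r)}$. Eleventh set: 30. $\sum_{\{{}_{(a)}^{(i)},{}_{(b)}^{(j)},{}_{(c)}^{(k)}\}}\{S_{p(a)(b)}^{l(i)(j)}|_{(c)}^{(k)}+S_{(r)(a)(b)}^{(f)(i)(j)}S_{p(c)(f)}^{l(k)(r)}\}=0$.
   Context: Setting. $\mathcal{T}$ and $M$ are smooth real manifolds of dimensions $m$ and $n$ with local coordinates $(t^a)$, $(x^i)$; indices $a,b,c,d,e,f,g$ run over $1,\dots,m$ and $i,j,k,l,p,r,s$ over $1,\dots,n$; the Einstein summation convention is used. $E^{*}=J^{1*}(\mathcal{T},M)$ is the dual 1-jet bundle with induced coordinates $(t^a,x^i,p_i^a)$, transforming by $\tilde t^a=\tilde t^a(t^b)$, $\tilde x^i=\tilde x^i(x^j)$, $\tilde p_i^a=\frac{\partial x^j}{\partial\tilde x^i}\frac{\partial\tilde t^a}{\partial t^b}p_j^b$. Nonlinear connection. $N=(\underset{1}{N}{}_{(i)b}^{(a)},\underset{2}{N}{}_{(i)j}^{(a)})$ is a fixed nonlinear connection on $E^*$, i.e. a collection of local functions with transformation rules $\underset{1}{\tilde N}{}_{(j)c}^{(b)}\frac{\partial\tilde t^c}{\partial t^a}=\underset{1}{N}{}_{(k)a}^{(c)}\frac{\partial\tilde t^b}{\partial t^c}\frac{\partial x^k}{\partial\tilde x^j}-\frac{\partial\tilde p_j^b}{\partial t^a}$ and $\underset{2}{\tilde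 N}{}_{(j)k}^{(b)}\frac{\partial\tilde x^k}{\partial x^i}=\underset{2}{N}{}_{(k)i}^{(c)}\frac{\partial\tilde t^b}{\partial t^c}\frac{\partial x^k}{\partial\tilde x^j}-\frac{\partial\tilde p_j^b}{\partial x^i}$. The adapted basis is $\frac{\delta}{\delta t^a}=\frac{\partial}{\partial t^a}-\underset{1}{N}{}_{(j)a}^{(b)}\frac{\partial}{\partial p_j^b}$, $\frac{\delta}{\delta x^i}=\frac{\partial}{\partial x^i}-\underset{2}{N}{}_{(j)i}^{(b)}\frac{\partial}{\partial p_j^b}$, $\frac{\partial}{\partial p_i^a}$, with dual basis $dt^a$, $dx^i$, $\delta p_i^a=dp_i^a+\underset{1}{N}{}_{(i)b}^{(a)}dt^b+\underset{2}{N}{}_{(i)j}^{(a)}dx^j$. Let $h_{\mathcal T},h_M,v$ be the projections of vector fields onto the spans of $\{\delta/\delta t^a\}$, $\{\delta/\delta x^i\}$, $\{\partial/\partial p_i^a\}$. $N$-linear connection. A linear connection $D$ on $E^*$ with $Dh_{\mathcal T}=0$, $Dh_M=0$, $Dv=0$. Its nine adapted components are defined by $D_{\delta/\delta t^c}\frac{\delta}{\delta t^b}=A_{bc}^a\frac{\delta}{\delta t^a}$, $D_{\delta/\delta t^c}\frac{\delta}{\delta x^j}=A_{jc}^i\frac{\delta}{\delta x^i}$, $D_{\delta/\delta t^c}\frac{\partial}{\partial p_j^b}=-A_{(i)(b)c}^{(a)(j)}\frac{\partial}{\partial p_i^a}$; $D_{\delta/\delta x^k}\frac{\delta}{\delta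 t^b}=H_{bk}^a\frac{\delta}{\delta t^a}$, $D_{\delta/\delta x^k}\frac{\delta}{\delta x^j}=H_{jk}^i\frac{\delta}{\delta x^i}$, $D_{\delta/\delta x^k}\frac{\partial}{\partial p_j^b}=-H_{(i)(b)k}^{(a)(j)}\frac{\partial}{\partial p_i^a}$; $D_{\partial/\partial p_k^c}\frac{\delta}{\delta t^b}=C_{b(c)}^{a(k)}\frac{\delta}{\delta t^a}$, $D_{\partial/\partial p_k^c}\frac{\delta}{\delta x^j}=C_{j(c)}^{i(k)}\frac{\delta}{\delta x^i}$, $D_{\partial/\partial p_k^c}\frac{\partial}{\partial p_j^b}=-C_{(i)(b)(c)}^{(a)(j)(k)}\frac{\partial}{\partial p_i^a}$. $h$-normal. Fix a semi-Riemannian metric $h_{ab}(t)$ on $\mathcal T$ with Christoffel symbols $\chi_{bc}^a(t)$, and let $\mathbb J=h_{ab}\delta_j^i\,\delta p_i^a\otimes dt^b\otimes dx^j$. An $N$-linear connection is $h$-normal if $A_{bc}^a=\chi_{bc}^a$, $H_{bi}^a=0$, $C_{b(c)}^{a(i)}=0$ and $D\mathbb J=0$. For such a connection $A_{(i)(b)c}^{(a)(j)}=\delta_b^aA_{ic}^j-\delta_i^j\chi_{bc}^a$, $H_{(i)(b)k}^{(a)(j)}=\delta_b^aH_{ik}^j$, $C_{(i)(b)(c)}^{(a)(j)(k)}=\delta_b^aC_{i(c)}^{j(k)}$, so it is determined by $(\chi_{bc}^a,A_{jc}^i,H_{jk}^i,C_{j(c)}^{i(k)})$. It is of Cartan type if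 moreover $H_{jk}^i=H_{kj}^i$ and $C_{j(c)}^{i(k)}=C_{j(c)}^{k(i)}$. Covariant derivatives of d-tensor components. "$_{/g}$", "$_{|s}$", "$|_{(g)}^{(s)}$" denote the adapted components of the covariant derivatives along $\delta/\delta t^g$, $\delta/\delta x^s$, $\partial/\partial p_s^g$. E.g. for components $T_{cj(b)(l)}^{ai(k)(d)}$ of $\frac{\delta}{\delta t^a}\otimes\frac{\delta}{\delta x^i}\otimes\frac{\partial}{\partial p_l^d}\otimes dt^c\otimes dx^j\otimes\delta p_k^b$, $$T_{cj(b)(l)/g}^{ai(k)(d)}=\tfrac{\delta}{\delta t^g}T_{cj(b)(l)}^{ai(k)(d)}+T_{cj(b)(l)}^{fi(k)(d)}A_{fg}^a+T_{cj(b)(l)}^{ar(k)(d)}A_{rg}^i+T_{cj(f)(l)}^{ai(r)(d)}A_{(r)(b)g}^{(f)(k)}-T_{fj(b)(l)}^{ai(k)(d)}A_{cg}^f-T_{cr(b)(l)}^{ai(k)(d)}A_{jg}^r-T_{cj(b)(r)}^{ai(k)(f)}A_{(l)(f)g}^{(d)(r)},$$ and similarly for any number of indices; "$_{|s}$" is the same with $\delta/\delta x^s$ and the $H$-components $H_{fs}^a,H_{rs}^i,H_{(r)(b)s}^{(f)(k)}$, and "$|_{(g)}^{(s)}$" is the same with $\partial/\partial p_s^g$ and the $C$-components $C_{f(g)}^{a(s)},C_{r(g)}^{i(s)},C_{(r)(b)(g)}^{(f)(k)(s)}$. In the d-tensors below, a pair ${}_{(l)}^{(d)}$ in first position is a $\partial/\partial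 p_l^d$ index, and the other bracketed pairs such as ${}_{(e)}^{(p)}$ are $\delta p_p^e$ indices. Torsion d-tensors: $T_{aj}^r=-A_{ja}^r$; $R_{(r)ab}^{(f)}=\frac{\delta \underset{1}{N}{}_{(r)a}^{(f)}}{\delta t^b}-\frac{\delta \underset{1}{N}{}_{(r)b}^{(f)}}{\delta t^a}$; $R_{(r)aj}^{(f)}=\frac{\delta \underset{1}{N}{}_{(r)a}^{(f)}}{\delta x^j}-\frac{\delta \underset{2}{N}{}_{(r)j}^{(f)}}{\delta t^a}$; $R_{(r)ij}^{(f)}=\frac{\delta \underset{2}{N}{}_{(r)i}^{(f)}}{\delta x^j}-\frac{\delta \underset{2}{N}{}_{(r)j}^{(f)}}{\delta x^i}$; $P_{(r)a(b)}^{(f)\ (j)}=\frac{\partial \underset{1}{N}{}_{(r)a}^{(f)}}{\partial p_j^b}+\delta_b^fA_{ra}^j-\delta_r^j\chi_{ba}^f$; $P_{(r)i(b)}^{(f)\ (j)}=\frac{\partial \underset{2}{N}{}_{(r)i}^{(f)}}{\partial p_j^b}+\delta_b^fH_{ri}^j$; $S_{(r)(a)(b)}^{(f)(i)(j)}=-(\delta_a^fC_{r(b)}^{i(j)}-\delta_b^fC_{r(a)}^{j(i)})$. Curvature d-tensors: $\chi_{abc}^d=\frac{\delta\chi_{ab}^d}{\delta t^c}-\frac{\delta\chi_{ac}^d}{\delta t^b}+\chi_{ab}^f\chi_{fc}^d-\chi_{ac}^f\chi_{fb}^d$; $R_{ibc}^l=\frac{\delta A_{ib}^l}{\delta t^c}-\frac{\delta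 A_{ic}^l}{\delta t^b}+A_{ib}^rA_{rc}^l-A_{ic}^rA_{rb}^l+C_{i(f)}^{l(r)}R_{(r)bc}^{(f)}$; $R_{ibk}^l=\frac{\delta A_{ib}^l}{\delta x^k}-\frac{\delta H_{ik}^l}{\delta t^b}+A_{ib}^rH_{rk}^l-H_{ik}^rA_{rb}^l+C_{i(f)}^{l(r)}R_{(r)bk}^{(f)}$; $P_{ib(c)}^{l\ (k)}=\frac{\partial A_{ib}^l}{\partial p_k^c}-C_{i(c)/b}^{l(k)}+C_{i(f)}^{l(r)}P_{(r)b(c)}^{(f)\ (k)}$; $R_{ijk}^l=\frac{\delta H_{ij}^l}{\delta x^k}-\frac{\delta H_{ik}^l}{\delta x^j}+H_{ij}^rH_{rk}^l-H_{ik}^rH_{rj}^l+C_{i(f)}^{l(r)}R_{(r)jk}^{(f)}$; $P_{ij(c)}^{l\ (k)}=\frac{\partial H_{ij}^l}{\partial p_k^c}-C_{i(c)|j}^{l(k)}+C_{i(f)}^{l(r)}P_{(r)j(c)}^{(f)\ (k)}$; $S_{i(b)(c)}^{l(j)(k)}=\frac{\partial C_{i(b)}^{l(j)}}{\partial p_k^c}-\frac{\partial C_{i(c)}^{l(k)}}{\partial p_j^b}+C_{i(b)}^{r(j)}C_{r(c)}^{l(k)}-C_{i(c)}^{r(k)}C_{r(b)}^{l(j)}$; and the vertical ones $R_{(l)(a)bc}^{(d)(i)}=\delta_a^dR_{lbc}^i-\delta_l^i\chi_{abc}^d$, $R_{(l)(a)bk}^{(d)(i)}=\delta_a^dR_{lbk}^i$,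 $R_{(l)(a)jk}^{(d)(i)}=\delta_a^dR_{ljk}^i$, $P_{(l)(a)b(c)}^{(d)(i)\ (k)}=\delta_a^dP_{lb(c)}^{i\ (k)}$, $P_{(l)(a)j(c)}^{(d)(i)\ (k)}=\delta_a^dP_{lj(c)}^{i\ (k)}$, $S_{(l)(a)(b)(c)}^{(d)(i)(j)(k)}=\delta_a^dS_{l(b)(c)}^{i(j)(k)}$. Summation symbols. $\sum_{\{A,B,C\}}$ is the sum over the three cyclic permutations of $(A,B,C)$. $\mathcal A_{\{A,B\}}\{E_{AB}\}=E_{AB}-E_{BA}$, where a bracketed pair such as ${}_{(b)}^{(j)}$ is moved as a single index. In $\mathcal A_{\{a,k\}}$ (one temporal and one spatial index) the interchange turns the derivative $_{|k}$ into $_{/a}$ and each d-tensor into the one of the corresponding type; e.g. the left side of identity 12 is $P_{(l)a(e)|k}^{(d)\ (p)}+P_{(l)k(f)}^{(d)\ (r)}P_{(r)a(e)}^{(f)\ (p)}-P_{(l)k(e)/a}^{(d)\ (p)}-P_{(l)a(f)}^{(d)\ (r)}P_{(r)k(e)}^{(f)\ (p)}$, and the left side of identity 26 is $P_{ia(e)|k}^{l\ (p)}+P_{(r)a(e)}^{(f)\ (p)}P_{ik(f)}^{l\ (r)}-P_{ik(e)/a}^{l\ (p)}-P_{(r)k(e)}^{(f)\ (p)}P_{ia(f)}^{l\ (r)}$. *)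

theory Defs
  imports "HOL-Analysis.Analysis"
begin

section \<open>Smooth functions and smooth manifolds\<close>

text \<open>Meant for open \<open>S\<close>: all iterated directional derivatives up to order \<open>k\<close> exist and are continuous.\<close>

primrec Ck_on :: "nat \<Rightarrow> 'a::euclidean_space set \<Rightarrow> ('a \<Rightarrow> 'b::real_normed_vector) \<Rightarrow> bool" where
  "Ck_on 0 S f \<longleftrightarrow> continuous_on S f"
| "Ck_on (Suc k) S f \<longleftrightarrow>
     (\<forall>x\<in>S. f differentiable (at x)) \<and> (\<forall>v. Ck_on k S (\<lambda>x. frechet_derivative f (at x) v))"

definition smooth_on :: "'a::euclidean_space set \<Rightarrow> ('a \<Rightarrow> 'b::real_normed_vector) \<Rightarrow> bool" where
  "smooth_on S f \<longleftrightarrow> (\<forall>k. Ck_on k S f)"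

type_synonym ('q, 'k) chart = "'q set \<times> ('q \<Rightarrow> real ^ 'k)"

definition chart_image :: "('q, 'k::finite) chart \<Rightarrow> (real ^ 'k) set" where
  "chart_image \<phi> = snd \<phi> ` fst \<phi>"

definition overlap :: "('q, 'k::finite) chart \<Rightarrow> ('q, 'k) chart \<Rightarrow> (real ^ 'k) set" where
  "overlap \<phi> \<phi>' = snd \<phi> ` (fst \<phi> \<inter> fst \<phi>')"

definition coord_change :: "('q, 'k::finite) chart \<Rightarrow> ('q, 'k) chart \<Rightarrow> real ^ 'k \<Rightarrow> real ^ 'k" where
  "coord_change \<phi> \<phi>' u = snd \<phi>' (inv_into (fst \<phi>) (snd \<phi>) u)"

text \<open>\<open>jac \<phi> \<phi>' u a b\<close> is \<open>\<partial>\<tilde>u\<^sup>a / \<partial>u\<^sup>b\<close> at the point with \<open>\<phi>\<close>-coordinates \<open>u\<close>, where \<open>\<tilde>u\<close>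
  are the \<open>\<phi>'\<close>-coordinates.\<close>

definition jac :: "('q, 'k::finite) chart \<Rightarrow> ('q, 'k) chart \<Rightarrow> real ^ 'k \<Rightarrow> 'k \<Rightarrow> 'k \<Rightarrow> real" where
  "jac \<phi> \<phi>' u a b = frechet_derivative (coord_change \<phi> \<phi>') (at u) (axis b 1) $ a"

text \<open>A smooth manifold is a Hausdorff second countable space (the whole type) with a smooth atlas.\<close>

definition smooth_manifold ::
    "('q::{t2_space, second_countable_topology}, 'k::finite) chart set \<Rightarrow> bool" where
  "smooth_manifold \<A> \<longleftrightarrow>
     (\<forall>\<phi>\<in>\<A>. open (fst \<phi>) \<and> open (chart_image \<phi>) \<and>
        homeomorphism (fst \<phi>) (chart_image \<phi>) (snd \<phi>) (inv_into (fst \<phi>) (snd \<phi>))) \<and>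
     (\<Union>\<phi>\<in>\<A>. fst \<phi>) = UNIV \<and>
     (\<forall>\<phi>\<in>\<A>. \<forall>\<phi>'\<in>\<A>. smooth_on (overlap \<phi> \<phi>') (coord_change \<phi> \<phi>'))"


section \<open>The dual 1-jet bundle\<close>

text \<open>
  The manifold \<open>E\<^sup>* = J\<^sup>1\<^sup>*(\<T>, M)\<close> is given by its induced atlas. A pair \<open>\<kappa> = (\<phi>, \<psi>)\<close> of charts of
  \<open>\<T>\<close> and \<open>M\<close> induces coordinates \<open>(t, x, p)\<close> ranging over \<^term>\<open>jet_domain\<close>, with \<open>p $ i $ a\<close> the
  coordinate \<open>p\<^sub>i\<^sup>a\<close>, and \<^term>\<open>jet_change\<close> is the coordinate transformation. Geometric objects on
  \<open>E\<^sup>*\<close> are families of local objects, one for each \<open>\<kappa>\<close>, that are related on overlaps.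
\<close>

type_synonym ('m, 'n) jet = "(real ^ 'm) \<times> (real ^ 'n) \<times> (real ^ 'm ^ 'n)"
type_synonym ('m, 'n) scalar = "('m, 'n) jet \<Rightarrow> real"
type_synonym ('m, 'n) vfield = "('m, 'n) jet \<Rightarrow> ('m, 'n) jet"
type_synonym ('s, 'm, 'q, 'n) jet_chart = "('s, 'm) chart \<times> ('q, 'n) chart"

definition jet_domain :: "('s, 'm::finite, 'q, 'n::finite) jet_chart \<Rightarrow> ('m, 'n) jet set" where
  "jet_domain \<kappa> = chart_image (fst \<kappa>) \<times> chart_image (snd \<kappa>) \<times> UNIV"

definition jet_overlap ::
    "('s, 'm::finite, 'q, 'n::finite) jet_chart \<Rightarrow> ('s, 'm, 'q, 'n) jet_chart \<Rightarrow> ('m, 'n) jet set" where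
  "jet_overlap \<kappa> \<kappa>' = overlap (fst \<kappa>) (fst \<kappa>') \<times> overlap (snd \<kappa>) (snd \<kappa>') \<times> UNIV"

definition jet_change ::
    "('s, 'm::finite, 'q, 'n::finite) jet_chart \<Rightarrow> ('s, 'm, 'q, 'n) jet_chart \<Rightarrow> ('m, 'n) jet \<Rightarrow> ('m, 'n) jet"
  where
  "jet_change \<kappa> \<kappa>' = (\<lambda>(t, x, p).
     let x' = coord_change (snd \<kappa>) (snd \<kappa>') x
     in (coord_change (fst \<kappa>) (fst \<kappa>') t, x',
         \<chi> i a. \<Sum>j\<in>UNIV. \<Sum>b\<in>UNIV.
           jac (snd \<kappa>') (snd \<kappa>) x' j i * jac (fst \<kappa>) (fst \<kappa>') t a b * p $ j $ b))"


section \<open>Nonlinear connections\<close>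

text \<open>\<open>N1 \<kappa> a i b\<close> and \<open>N2 \<kappa> a i j\<close> are the components of the nonlinear connection with fibre index
  pair \<open>(a)\<close> above \<open>(i)\<close> and last lower index \<open>b\<close>, respectively \<open>j\<close>.\<close>

definition nonlinear_connection ::
    "('s, 'm::finite) chart set \<Rightarrow> ('q, 'n::finite) chart set \<Rightarrow>
     (('s, 'm, 'q, 'n) jet_chart \<Rightarrow> 'm \<Rightarrow> 'n \<Rightarrow> 'm \<Rightarrow> ('m, 'n) scalar) \<Rightarrow>
     (('s, 'm, 'q, 'n) jet_chart \<Rightarrow> 'm \<Rightarrow> 'n \<Rightarrow> 'n \<Rightarrow> ('m, 'n) scalar) \<Rightarrow> bool" where
  "nonlinear_connection \<T> \<M> N1 N2 \<longleftrightarrow>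
     (\<forall>\<kappa>\<in>\<T> \<times> \<M>. (\<forall>a i b. smooth_on (jet_domain \<kappa>) (N1 \<kappa> a i b)) \<and>
                  (\<forall>a i j. smooth_on (jet_domain \<kappa>) (N2 \<kappa> a i j))) \<and>
     (\<forall>\<kappa>\<in>\<T> \<times> \<M>. \<forall>\<kappa>'\<in>\<T> \<times> \<M>. \<forall>z\<in>jet_overlap \<kappa> \<kappa>'.
        let z' = jet_change \<kappa> \<kappa>' z;
            T = jac (fst \<kappa>) (fst \<kappa>') (fst z);
            X = jac (snd \<kappa>) (snd \<kappa>') (fst (snd z));
            X' = jac (snd \<kappa>') (snd \<kappa>) (fst (snd z'));
            dp = (\<lambda>j b v. snd (snd (frechet_derivative (jet_change \<kappa> \<kappa>') (at z) v)) $ j $ b)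
        in (\<forall>b j a. (\<Sum>c\<in>UNIV. N1 \<kappa>' b j c z' * T c a) =
              (\<Sum>k\<in>UNIV. \<Sum>c\<in>UNIV. N1 \<kappa> c k a z * T b c * X' k j) - dp j b (axis a 1, 0, 0)) \<and>
           (\<forall>b j i. (\<Sum>k\<in>UNIV. N2 \<kappa>' b j k z' * X k i) =
              (\<Sum>k\<in>UNIV. \<Sum>c\<in>UNIV. N2 \<kappa> c k i z * T b c * X' k j) - dp j b (0, axis i 1, 0)))"


section \<open>Semi-Riemannian metrics on the temporal manifold\<close>

definition metric_index :: "real ^ 'm ^ 'm \<Rightarrow> nat" where
  "metric_index Q = Max {dim S | S. subspace S \<and> (\<forall>v\<in>S. v \<noteq> 0 \<longrightarrow> v \<bullet> (Q *v v) < 0)}"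

definition semi_riemannian_metric ::
    "('s, 'm::finite) chart set \<Rightarrow> (('s, 'm) chart \<Rightarrow> real ^ 'm \<Rightarrow> real ^ 'm ^ 'm) \<Rightarrow> bool" where
  "semi_riemannian_metric \<T> h \<longleftrightarrow>
     (\<forall>\<phi>\<in>\<T>. smooth_on (chart_image \<phi>) (h \<phi>) \<and>
        (\<forall>t\<in>chart_image \<phi>. transpose (h \<phi> t) = h \<phi> t \<and> invertible (h \<phi> t))) \<and>
     (\<exists>\<nu>. \<forall>\<phi>\<in>\<T>. \<forall>t\<in>chart_image \<phi>. metric_index (h \<phi> t) = \<nu>) \<and>
     (\<forall>\<phi>\<in>\<T>. \<forall>\<phi>'\<in>\<T>. \<forall>t\<in>overlap \<phi> \<phi>'. \<forall>a b.
        h \<phi> t $ a $ b = (\<Sum>c\<in>UNIV. \<Sum>d\<in>UNIV.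
          jac \<phi> \<phi>' t c a * jac \<phi> \<phi>' t d b * h \<phi>' (coord_change \<phi> \<phi>' t) $ c $ d))"

text \<open>\<open>christoffel h a b c\<close> is \<open>\<chi>\<close> with upper index \<open>a\<close> and lower indices \<open>b c\<close>.\<close>

definition christoffel ::
    "(real ^ 'm \<Rightarrow> real ^ 'm ^ 'm) \<Rightarrow> 'm \<Rightarrow> 'm \<Rightarrow> 'm \<Rightarrow> real ^ 'm \<Rightarrow> real" where
  "christoffel h a b c t =
     (let dh = (\<lambda>g d e. frechet_derivative (\<lambda>u. h u $ d $ e) (at t) (axis g 1))
      in \<Sum>d\<in>UNIV. matrix_inv (h t) $ a $ d * (dh b d c + dh c d b - dh d b c) / 2)"


section \<open>Linear connections\<close>

definition vf_apply :: "('m::finite, 'n::finite) vfield \<Rightarrow> ('m, 'n) scalar \<Rightarrow> ('m, 'n) scalar" where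
  "vf_apply X f z = frechet_derivative f (at z) (X z)"

definition linear_connection_on ::
    "('m::finite, 'n::finite) jet set \<Rightarrow>
     (('m, 'n) vfield \<Rightarrow> ('m, 'n) vfield \<Rightarrow> ('m, 'n) vfield) \<Rightarrow> bool" where
  "linear_connection_on W D \<longleftrightarrow>
     (\<forall>X Y. smooth_on W X \<longrightarrow> smooth_on W Y \<longrightarrow> smooth_on W (D X Y)) \<and>
     (\<forall>X X' Y. smooth_on W X \<longrightarrow> smooth_on W X' \<longrightarrow> smooth_on W Y \<longrightarrow>
        (\<forall>z\<in>W. D (\<lambda>z. X z + X' z) Y z = D X Y z + D X' Y z)) \<and>
     (\<forall>X Y Y'. smooth_on W X \<longrightarrow> smooth_on W Y \<longrightarrow> smooth_on W Y' \<longrightarrow>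
        (\<forall>z\<in>W. D X (\<lambda>z. Y z + Y' z) z = D X Y z + D X Y' z)) \<and>
     (\<forall>f X Y. smooth_on W f \<longrightarrow> smooth_on W X \<longrightarrow> smooth_on W Y \<longrightarrow>
        (\<forall>z\<in>W. D (\<lambda>z. f z *\<^sub>R X z) Y z = f z *\<^sub>R D X Y z)) \<and>
     (\<forall>f X Y. smooth_on W f \<longrightarrow> smooth_on W X \<longrightarrow> smooth_on W Y \<longrightarrow>
        (\<forall>z\<in>W. D X (\<lambda>z. f z *\<^sub>R Y z) z = vf_apply X f z *\<^sub>R Y z + f z *\<^sub>R D X Y z))"

definition vf_related ::
    "('s, 'm::finite, 'q, 'n::finite) jet_chart \<Rightarrow> ('s, 'm, 'q, 'n) jet_chart \<Rightarrow>
     ('m, 'n) vfield \<Rightarrow> ('m, 'n) vfield \<Rightarrow> bool" where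
  "vf_related \<kappa> \<kappa>' X X' \<longleftrightarrow>
     (\<forall>z\<in>jet_overlap \<kappa> \<kappa>'.
        X' (jet_change \<kappa> \<kappa>' z) = frechet_derivative (jet_change \<kappa> \<kappa>') (at z) (X z))"

text \<open>\<open>D \<kappa>\<close> is the restriction of the connection on \<open>E\<^sup>*\<close> to the coordinate neighbourhood of \<open>\<kappa>\<close>,
  so the restrictions agree on overlaps.\<close>

definition linear_connection ::
    "('s, 'm::finite) chart set \<Rightarrow> ('q, 'n::finite) chart set \<Rightarrow>
     (('s, 'm, 'q, 'n) jet_chart \<Rightarrow> ('m, 'n) vfield \<Rightarrow> ('m, 'n) vfield \<Rightarrow> ('m, 'n) vfield) \<Rightarrow> bool" where
  "linear_connection \<T> \<M> D \<longleftrightarrow>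
     (\<forall>\<kappa>\<in>\<T> \<times> \<M>. linear_connection_on (jet_domain \<kappa>) (D \<kappa>)) \<and>
     (\<forall>\<kappa>\<in>\<T> \<times> \<M>. \<forall>\<kappa>'\<in>\<T> \<times> \<M>. \<forall>X Y X' Y'.
        smooth_on (jet_domain \<kappa>) X \<longrightarrow> smooth_on (jet_domain \<kappa>) Y \<longrightarrow>
        smooth_on (jet_domain \<kappa>') X' \<longrightarrow> smooth_on (jet_domain \<kappa>') Y' \<longrightarrow>
        vf_related \<kappa> \<kappa>' X X' \<longrightarrow> vf_related \<kappa> \<kappa>' Y Y' \<longrightarrow>
        vf_related \<kappa> \<kappa>' (D \<kappa> X Y) (D \<kappa>' X' Y'))"


section \<open>Adapted bases and adapted components\<close>

record ('m, 'n) jet_geometry =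
  nlc1 :: "'m \<Rightarrow> 'n \<Rightarrow> 'm \<Rightarrow> ('m, 'n) scalar"
  nlc2 :: "'m \<Rightarrow> 'n \<Rightarrow> 'n \<Rightarrow> ('m, 'n) scalar"
  met :: "real ^ 'm \<Rightarrow> real ^ 'm ^ 'm"
  con :: "('m, 'n) vfield \<Rightarrow> ('m, 'n) vfield \<Rightarrow> ('m, 'n) vfield"

text \<open>
  Adapted indices: \<open>Tm a\<close> is a temporal index, \<open>Sp i\<close> a spatial index, and \<open>Mo i a\<close> a bracketed pair,
  with spatial entry \<open>i\<close> and temporal entry \<open>a\<close>. As an upper index, \<open>Mo i a\<close> belongs to
  \<open>\<partial>/\<partial>p\<^sub>i\<^sup>a\<close>; as a lower index, to \<open>\<delta>p\<^sub>i\<^sup>a\<close>.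
\<close>

datatype ('m, 'n) adx = Tm 'm | Sp 'n | Mo 'n 'm

fun frame :: "('m::finite, 'n::finite) jet_geometry \<Rightarrow> ('m, 'n) adx \<Rightarrow> ('m, 'n) vfield" where
  "frame G (Tm a) z = (axis a 1, 0, \<chi> j b. - nlc1 G b j a z)"
| "frame G (Sp i) z = (0, axis i 1, \<chi> j b. - nlc2 G b j i z)"
| "frame G (Mo i a) z = (0, 0, axis i (axis a 1))"

fun coframe :: "('m::finite, 'n::finite) jet_geometry \<Rightarrow> ('m, 'n) adx \<Rightarrow> ('m, 'n) vfield \<Rightarrow> ('m, 'n) scalar"
  where
  "coframe G (Tm a) X z = fst (X z) $ a"
| "coframe G (Sp i) X z = fst (snd (X z)) $ i"
| "coframe G (Mo i a) X z = snd (snd (X z)) $ i $ a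
     + (\<Sum>b\<in>UNIV. nlc1 G a i b z * fst (X z) $ b)
     + (\<Sum>j\<in>UNIV. nlc2 G a i j z * fst (snd (X z)) $ j)"

definition proj_T :: "('m::finite, 'n::finite) jet_geometry \<Rightarrow> ('m, 'n) vfield \<Rightarrow> ('m, 'n) vfield" where
  "proj_T G X z = (\<Sum>a\<in>UNIV. coframe G (Tm a) X z *\<^sub>R frame G (Tm a) z)"

definition proj_M :: "('m::finite, 'n::finite) jet_geometry \<Rightarrow> ('m, 'n) vfield \<Rightarrow> ('m, 'n) vfield" where
  "proj_M G X z = (\<Sum>i\<in>UNIV. coframe G (Sp i) X z *\<^sub>R frame G (Sp i) z)"

definition proj_V :: "('m::finite, 'n::finite) jet_geometry \<Rightarrow> ('m, 'n) vfield \<Rightarrow> ('m, 'n) vfield" where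
  "proj_V G X z = (\<Sum>i\<in>UNIV. \<Sum>a\<in>UNIV. coframe G (Mo i a) X z *\<^sub>R frame G (Mo i a) z)"

text \<open>\<open>DK = 0\<close> for a tensor field \<open>K\<close> of type (1,1): \<open>D\<^sub>X (K Y) - K (D\<^sub>X Y) = 0\<close>.\<close>

definition parallel_endo ::
    "('m::finite, 'n::finite) jet set \<Rightarrow> ('m, 'n) jet_geometry \<Rightarrow>
     (('m, 'n) vfield \<Rightarrow> ('m, 'n) vfield) \<Rightarrow> bool" where
  "parallel_endo W G K \<longleftrightarrow>
     (\<forall>X Y. smooth_on W X \<longrightarrow> smooth_on W Y \<longrightarrow> (\<forall>z\<in>W. con G X (K Y) z - K (con G X Y) z = 0))"

definition kron :: "'i \<Rightarrow> 'i \<Rightarrow> real" where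
  "kron i j = (if i = j then 1 else 0)"

definition tensor_J ::
    "('m::finite, 'n::finite) jet_geometry \<Rightarrow>
     ('m, 'n) vfield \<Rightarrow> ('m, 'n) vfield \<Rightarrow> ('m, 'n) vfield \<Rightarrow> ('m, 'n) scalar" where
  "tensor_J G X Y Z z =
     (\<Sum>a\<in>UNIV. \<Sum>b\<in>UNIV. \<Sum>i\<in>UNIV. \<Sum>j\<in>UNIV. met G (fst z) $ a $ b * kron i j *
        coframe G (Mo i a) X z * coframe G (Tm b) Y z * coframe G (Sp j) Z z)"

definition parallel_J :: "('m::finite, 'n::finite) jet set \<Rightarrow> ('m, 'n) jet_geometry \<Rightarrow> bool" where
  "parallel_J W G \<longleftrightarrow>
     (\<forall>U X Y Z. smooth_on W U \<longrightarrow> smooth_on W X \<longrightarrow> smooth_on W Y \<longrightarrow> smooth_on W Z \<longrightarrow>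
        (\<forall>z\<in>W. vf_apply U (tensor_J G X Y Z) z - tensor_J G (con G U X) Y Z z
                - tensor_J G X (con G U Y) Z z - tensor_J G X Y (con G U Z) z = 0))"

text \<open>
  The nine adapted components, each read off with the dual basis (an \<open>N\<close>-linear connection preserves
  the three distributions). The last argument is the direction of differentiation: for \<open>Tm c\<close> one gets
  the \<open>A\<close>-components, for \<open>Sp k\<close> the \<open>H\<close>-components, for \<open>Mo k c\<close> the \<open>C\<close>-components.
  In \<open>comp_t G a b\<close> and \<open>comp_x G i j\<close> the upper index comes first; \<open>comp_p G i a j b\<close> is the component
  with upper indices \<open>(a)(j)\<close> and lower indices \<open>(i)(b)\<close>, whose sign convention is
  \<open>D (\<partial>/\<partial>p\<^sub>j\<^sup>b) = - comp_p G i a j b (\<partial>/\<partial>p\<^sub>i\<^sup>a)\<close>.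
\<close>

definition comp_t ::
    "('m::finite, 'n::finite) jet_geometry \<Rightarrow> 'm \<Rightarrow> 'm \<Rightarrow> ('m, 'n) adx \<Rightarrow> ('m, 'n) scalar" where
  "comp_t G a b \<gamma> = coframe G (Tm a) (con G (frame G \<gamma>) (frame G (Tm b)))"

definition comp_x ::
    "('m::finite, 'n::finite) jet_geometry \<Rightarrow> 'n \<Rightarrow> 'n \<Rightarrow> ('m, 'n) adx \<Rightarrow> ('m, 'n) scalar" where
  "comp_x G i j \<gamma> = coframe G (Sp i) (con G (frame G \<gamma>) (frame G (Sp j)))"

definition comp_p ::
    "('m::finite, 'n::finite) jet_geometry \<Rightarrow> 'n \<Rightarrow> 'm \<Rightarrow> 'n \<Rightarrow> 'm \<Rightarrow> ('m, 'n) adx \<Rightarrow> ('m, 'n) scalar" where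
  "comp_p G i a j b \<gamma> z = - coframe G (Mo i a) (con G (frame G \<gamma>) (frame G (Mo j b))) z"

definition chr :: "('m::finite, 'n::finite) jet_geometry \<Rightarrow> 'm \<Rightarrow> 'm \<Rightarrow> 'm \<Rightarrow> ('m, 'n) scalar" where
  "chr G a b c z = christoffel (met G) a b c (fst z)"

definition A_comp :: "('m::finite, 'n::finite) jet_geometry \<Rightarrow> 'n \<Rightarrow> 'n \<Rightarrow> 'm \<Rightarrow> ('m, 'n) scalar" where
  "A_comp G i j c = comp_x G i j (Tm c)"

definition H_comp :: "('m::finite, 'n::finite) jet_geometry \<Rightarrow> 'n \<Rightarrow> 'n \<Rightarrow> 'n \<Rightarrow> ('m, 'n) scalar" where
  "H_comp G i j k = comp_x G i j (Sp k)"

text \<open>\<open>C_comp G i j k c\<close> has upper indices \<open>i(k)\<close> and lower indices \<open>j(c)\<close>.\<close>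

definition C_comp :: "('m::finite, 'n::finite) jet_geometry \<Rightarrow> 'n \<Rightarrow> 'n \<Rightarrow> 'n \<Rightarrow> 'm \<Rightarrow> ('m, 'n) scalar" where
  "C_comp G i j k c = comp_x G i j (Mo k c)"


section \<open>N-linear, h-normal and Cartan type connections\<close>

definition geometry_at ::
    "(('s, 'm::finite, 'q, 'n::finite) jet_chart \<Rightarrow> 'm \<Rightarrow> 'n \<Rightarrow> 'm \<Rightarrow> ('m, 'n) scalar) \<Rightarrow>
     (('s, 'm, 'q, 'n) jet_chart \<Rightarrow> 'm \<Rightarrow> 'n \<Rightarrow> 'n \<Rightarrow> ('m, 'n) scalar) \<Rightarrow>
     (('s, 'm) chart \<Rightarrow> real ^ 'm \<Rightarrow> real ^ 'm ^ 'm) \<Rightarrow>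
     (('s, 'm, 'q, 'n) jet_chart \<Rightarrow> ('m, 'n) vfield \<Rightarrow> ('m, 'n) vfield \<Rightarrow> ('m, 'n) vfield) \<Rightarrow>
     ('s, 'm, 'q, 'n) jet_chart \<Rightarrow> ('m, 'n) jet_geometry" where
  "geometry_at N1 N2 h D \<kappa> = \<lparr>nlc1 = N1 \<kappa>, nlc2 = N2 \<kappa>, met = h (fst \<kappa>), con = D \<kappa>\<rparr>"

text \<open>The metric \<open>h\<close> does not enter the first definition; it only fills the record.\<close>

definition N_linear_connection where
  "N_linear_connection \<T> \<M> N1 N2 h D \<longleftrightarrow>
     linear_connection \<T> \<M> D \<and>
     (\<forall>\<kappa>\<in>\<T> \<times> \<M>. let G = geometry_at N1 N2 h D \<kappa>; W = jet_domain \<kappa> in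
        parallel_endo W G (proj_T G) \<and> parallel_endo W G (proj_M G) \<and> parallel_endo W G (proj_V G))"

definition h_normal where
  "h_normal \<T> \<M> N1 N2 h D \<longleftrightarrow>
     (\<forall>\<kappa>\<in>\<T> \<times> \<M>. let G = geometry_at N1 N2 h D \<kappa>; W = jet_domain \<kappa> in
        (\<forall>z\<in>W. (\<forall>a b c. comp_t G a b (Tm c) z = chr G a b c z) \<and>
               (\<forall>a b i. comp_t G a b (Sp i) z = 0) \<and>
               (\<forall>a b i c. comp_t G a b (Mo i c) z = 0)) \<and>
        parallel_J W G)"

definition Cartan_type where
  "Cartan_type \<T> \<M> N1 N2 h D \<longleftrightarrow>
     (\<forall>\<kappa>\<in>\<T> \<times> \<M>. let G = geometry_at N1 N2 h D \<kappa> in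
        \<forall>z\<in>jet_domain \<kappa>.
          (\<forall>i j k. H_comp G i j k z = H_comp G i k j z) \<and>
          (\<forall>i j k c. C_comp G i j k c z = C_comp G k j i c z))"


section \<open>Covariant derivatives of d-tensors\<close>

text \<open>
  A d-tensor is given by its adapted components \<open>T us ls\<close>, with upper indices \<open>us\<close> and lower indices
  \<open>ls\<close>. Only index lists of the kinds belonging to the tensor are meaningful. Lists are ordered as in
  the usual notation; a bracketed pair of type \<open>\<partial>/\<partial>p\<close> is an upper index and one of type \<open>\<delta>p\<close> a lower
  index, irrespective of the heights of its two entries.
\<close>

type_synonym ('m, 'n) dtensor = "('m, 'n) adx list \<Rightarrow> ('m, 'n) adx list \<Rightarrow> ('m, 'n) scalar"

definition cov ::
    "('m::finite, 'n::finite) jet_geometry \<Rightarrow> ('m, 'n) dtensor \<Rightarrow>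
     ('m, 'n) adx list \<Rightarrow> ('m, 'n) adx list \<Rightarrow> ('m, 'n) adx \<Rightarrow> ('m, 'n) scalar" where
  "cov G T us ls \<gamma> z =
     vf_apply (frame G \<gamma>) (T us ls) z
     + (\<Sum>q<length us. case us ! q of
          Tm a \<Rightarrow> (\<Sum>f\<in>UNIV. T (us[q := Tm f]) ls z * comp_t G a f \<gamma> z)
        | Sp i \<Rightarrow> (\<Sum>r\<in>UNIV. T (us[q := Sp r]) ls z * comp_x G i r \<gamma> z)
        | Mo l d \<Rightarrow> - (\<Sum>r\<in>UNIV. \<Sum>f\<in>UNIV. T (us[q := Mo r f]) ls z * comp_p G l d r f \<gamma> z))
     + (\<Sum>q<length ls. case ls ! q of
          Tm c \<Rightarrow> - (\<Sum>f\<in>UNIV. T us (ls[q := Tm f]) z * comp_t G f c \<gamma> z)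
        | Sp j \<Rightarrow> - (\<Sum>r\<in>UNIV. T us (ls[q := Sp r]) z * comp_x G r j \<gamma> z)
        | Mo k b \<Rightarrow> (\<Sum>r\<in>UNIV. \<Sum>f\<in>UNIV. T us (ls[q := Mo r f]) z * comp_p G r f k b \<gamma> z))"

fun C_tensor :: "('m::finite, 'n::finite) jet_geometry \<Rightarrow> ('m, 'n) dtensor" where
  "C_tensor G [Sp l] [Sp i, Mo k c] z = C_comp G l i k c z"


section \<open>Torsion d-tensors\<close>

fun torT :: "('m::finite, 'n::finite) jet_geometry \<Rightarrow> ('m, 'n) dtensor" where
  "torT G [Sp r] [Tm a, Sp j] z = - A_comp G r j a z"

fun torR :: "('m::finite, 'n::finite) jet_geometry \<Rightarrow> ('m, 'n) dtensor" where
  "torR G [Mo r f] [Tm a, Tm b] z =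
     vf_apply (frame G (Tm b)) (nlc1 G f r a) z - vf_apply (frame G (Tm a)) (nlc1 G f r b) z"
| "torR G [Mo r f] [Tm a, Sp j] z =
     vf_apply (frame G (Sp j)) (nlc1 G f r a) z - vf_apply (frame G (Tm a)) (nlc2 G f r j) z"
| "torR G [Mo r f] [Sp i, Sp j] z =
     vf_apply (frame G (Sp j)) (nlc2 G f r i) z - vf_apply (frame G (Sp i)) (nlc2 G f r j) z"

fun torP :: "('m::finite, 'n::finite) jet_geometry \<Rightarrow> ('m, 'n) dtensor" where
  "torP G [Mo r f] [Tm a, Mo j b] z =
     vf_apply (frame G (Mo j b)) (nlc1 G f r a) z + kron b f * A_comp G j r a z - kron r j * chr G f b a z"
| "torP G [Mo r f] [Sp i, Mo j b] z =
     vf_apply (frame G (Mo j b)) (nlc2 G f r i) z + kron b f * H_comp G j r i z"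

fun torS :: "('m::finite, 'n::finite) jet_geometry \<Rightarrow> ('m, 'n) dtensor" where
  "torS G [Mo r f] [Mo i a, Mo j b] z = - (kron a f * C_comp G i r j b z - kron b f * C_comp G j r i a z)"


section \<open>Curvature d-tensors\<close>

fun curvX :: "('m::finite, 'n::finite) jet_geometry \<Rightarrow> ('m, 'n) dtensor" where
  "curvX G [Tm d] [Tm a, Tm b, Tm c] z =
     vf_apply (frame G (Tm c)) (chr G d a b) z - vf_apply (frame G (Tm b)) (chr G d a c) z
     + (\<Sum>f\<in>UNIV. chr G f a b z * chr G d f c z - chr G f a c z * chr G d f b z)"

fun curvR :: "('m::finite, 'n::finite) jet_geometry \<Rightarrow> ('m, 'n) dtensor" where
  "curvR G [Sp l] [Sp i, Tm b, Tm c] z =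
     vf_apply (frame G (Tm c)) (A_comp G l i b) z - vf_apply (frame G (Tm b)) (A_comp G l i c) z
     + (\<Sum>r\<in>UNIV. A_comp G r i b z * A_comp G l r c z - A_comp G r i c z * A_comp G l r b z)
     + (\<Sum>r\<in>UNIV. \<Sum>f\<in>UNIV. C_comp G l i r f z * torR G [Mo r f] [Tm b, Tm c] z)"
| "curvR G [Sp l] [Sp i, Tm b, Sp k] z =
     vf_apply (frame G (Sp k)) (A_comp G l i b) z - vf_apply (frame G (Tm b)) (H_comp G l i k) z
     + (\<Sum>r\<in>UNIV. A_comp G r i b z * H_comp G l r k z - H_comp G r i k z * A_comp G l r b z)
     + (\<Sum>r\<in>UNIV. \<Sum>f\<in>UNIV. C_comp G l i r f z * torR G [Mo r f] [Tm b, Sp k] z)"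
| "curvR G [Sp l] [Sp i, Sp j, Sp k] z =
     vf_apply (frame G (Sp k)) (H_comp G l i j) z - vf_apply (frame G (Sp j)) (H_comp G l i k) z
     + (\<Sum>r\<in>UNIV. H_comp G r i j z * H_comp G l r k z - H_comp G r i k z * H_comp G l r j z)
     + (\<Sum>r\<in>UNIV. \<Sum>f\<in>UNIV. C_comp G l i r f z * torR G [Mo r f] [Sp j, Sp k] z)"

fun curvP :: "('m::finite, 'n::finite) jet_geometry \<Rightarrow> ('m, 'n) dtensor" where
  "curvP G [Sp l] [Sp i, Tm b, Mo k c] z =
     vf_apply (frame G (Mo k c)) (A_comp G l i b) z
     - cov G (C_tensor G) [Sp l] [Sp i, Mo k c] (Tm b) z
     + (\<Sum>r\<in>UNIV. \<Sum>f\<in>UNIV. C_comp G l i r f z * torP G [Mo r f] [Tm b, Mo k c] z)"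
| "curvP G [Sp l] [Sp i, Sp j, Mo k c] z =
     vf_apply (frame G (Mo k c)) (H_comp G l i j) z
     - cov G (C_tensor G) [Sp l] [Sp i, Mo k c] (Sp j) z
     + (\<Sum>r\<in>UNIV. \<Sum>f\<in>UNIV. C_comp G l i r f z * torP G [Mo r f] [Sp j, Mo k c] z)"

fun curvS :: "('m::finite, 'n::finite) jet_geometry \<Rightarrow> ('m, 'n) dtensor" where
  "curvS G [Sp l] [Sp i, Mo j b, Mo k c] z =
     vf_apply (frame G (Mo k c)) (C_comp G l i j b) z - vf_apply (frame G (Mo j b)) (C_comp G l i k c) z
     + (\<Sum>r\<in>UNIV. C_comp G r i j b z * C_comp G l r k c z - C_comp G r i k c z * C_comp G l r j b z)"

fun vcurvR :: "('m::finite, 'n::finite) jet_geometry \<Rightarrow> ('m, 'n) dtensor" where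
  "vcurvR G [Mo l d] [Mo i a, Tm b, Tm c] z =
     kron a d * curvR G [Sp i] [Sp l, Tm b, Tm c] z - kron l i * curvX G [Tm d] [Tm a, Tm b, Tm c] z"
| "vcurvR G [Mo l d] [Mo i a, Tm b, Sp k] z = kron a d * curvR G [Sp i] [Sp l, Tm b, Sp k] z"
| "vcurvR G [Mo l d] [Mo i a, Sp j, Sp k] z = kron a d * curvR G [Sp i] [Sp l, Sp j, Sp k] z"

fun vcurvP :: "('m::finite, 'n::finite) jet_geometry \<Rightarrow> ('m, 'n) dtensor" where
  "vcurvP G [Mo l d] [Mo i a, Tm b, Mo k c] z = kron a d * curvP G [Sp i] [Sp l, Tm b, Mo k c] z"
| "vcurvP G [Mo l d] [Mo i a, Sp j, Mo k c] z = kron a d * curvP G [Sp i] [Sp l, Sp j, Mo k c] z"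

fun vcurvS :: "('m::finite, 'n::finite) jet_geometry \<Rightarrow> ('m, 'n) dtensor" where
  "vcurvS G [Mo l d] [Mo i a, Mo j b, Mo k c] z = kron a d * curvS G [Sp i] [Sp l, Mo j b, Mo k c] z"


section \<open>Cyclic and alternate sums\<close>

definition cyc :: "('i \<Rightarrow> 'i \<Rightarrow> 'i \<Rightarrow> real) \<Rightarrow> 'i \<Rightarrow> 'i \<Rightarrow> 'i \<Rightarrow> real" where
  "cyc E x y z = E x y z + E y z x + E z x y"

definition alt :: "('i \<Rightarrow> 'i \<Rightarrow> real) \<Rightarrow> 'i \<Rightarrow> 'i \<Rightarrow> real" where
  "alt E x y = E x y - E y x"

end

theory Submission
  imports Defs
begin

text \<open>
  Fix a chart. The adapted frame \<open>e\<^sub>\<alpha>\<close>, with \<open>\<alpha>\<close> ranging over all three kinds of adapted indices at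
  once, has structure functions \<open>B\<close> that satisfy the Jacobi identity, and the connection has
  coefficients \<open>\<Gamma>\<close> that are block diagonal: on the momentum block, \<open>D\<J> = 0\<close> and the nondegeneracy of
  \<open>h\<close> express them through the temporal and spatial blocks. For an arbitrary frame and
  connection the two Bianchi identities,
  that the cyclic sums over \<open>\<alpha>, \<beta>, \<gamma>\<close> of
  \<open>T\<^sub>\<alpha>\<^sub>\<beta>\<^sub>;\<^sub>\<gamma> + T\<^sub>\<gamma>\<^sub>\<mu> T\<^sup>\<mu>\<^sub>\<alpha>\<^sub>\<beta> - R\<^sub>\<alpha>\<^sub>\<beta>\<^sub>\<gamma>\<close> and of \<open>R\<^sub>\<epsilon>\<^sub>\<alpha>\<^sub>\<beta>\<^sub>;\<^sub>\<gamma> + R\<^sub>\<epsilon>\<^sub>\<gamma>\<^sub>\<mu> T\<^sup>\<mu>\<^sub>\<alpha>\<^sub>\<beta>\<close> vanish, follow from the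
  commutator formula and the Jacobi identity. The d-tensors of the statement are, up to sign, the
  nonzero blocks of \<open>T\<close> and \<open>R\<close>, and the thirty identities are the blocks of these two.
\<close>

section \<open>Smooth functions\<close>

text \<open>The d-tensors of the statement are specified only on index lists of their own kinds,
  while a frame identity sums over all adapted indices. The bridge is that block-diagonal
  coefficients replace an index only by one of the same kind, so covariant differentiation respects
  the blocks; different blocks meet only where torsion is contracted with torsion or curvature over
  \<mu>. Which terms survive is then decided by the blocks that vanish: temporal torsion, because
  \<chi> is symmetric and the temporal coefficients are zero in the other directions; spatial
  torsion of two spatial directions, because H is symmetric; temporal curvature in a non-temporal
  direction, because h depends on t alone.

  The analytic input is the symmetry of second derivatives, obtained from the mean value theorem
  because smoothness is defined through iterated directional derivatives. Both the commutator
  formula and the Jacobi identity of the structure functions rest on it.\<close>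

lemma smooth_on_Ck: "smooth_on S f \<Longrightarrow> Ck_on k S f"
  by (simp add: smooth_on_def)

lemma smooth_on_differentiable:
  assumes "smooth_on S f" and "x \<in> S"
  shows "f differentiable (at x)"
  using assms smooth_on_Ck[of S f "Suc 0"] by simp

lemma smooth_on_has_derivative:
  assumes "smooth_on S f" and "x \<in> S"
  shows "(f has_derivative frechet_derivative f (at x)) (at x)"
  using smooth_on_differentiable[OF assms] frechet_derivative_works by blast

lemma smooth_on_frechet_derivative:
  assumes "smooth_on S f"
  shows "smooth_on S (\<lambda>x. frechet_derivative f (at x) v)"
  unfolding smooth_on_def using assms smooth_on_Ck[of S f "Suc k" for k] by simp

lemma smooth_on_continuous: "smooth_on S f \<Longrightarrow> continuous_on S f"
  using smooth_on_Ck[of S f 0] by simp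

lemma frechet_derivative_cong:
  assumes "open S" and "x \<in> S" and "\<And>y. y \<in> S \<Longrightarrow> f y = g y"
  shows "frechet_derivative f (at x) = frechet_derivative g (at x)"
proof -
  have "(f has_derivative F) (at x) \<longleftrightarrow> (g has_derivative F) (at x)" for F
    using assms by (metis (no_types, lifting) has_derivative_transform_within_open)
  then show ?thesis unfolding frechet_derivative_def by simp
qed

text \<open>Openness of S makes the derivative at a point of S depend only on values in S, so
  equality on S passes to the derivatives and the induction closes. This licenses rewriting a
  derivative by its sum or product formula under \<open>Ck_on\<close>.\<close>

lemma Ck_on_cong:
  assumes "open S" and "\<And>y. y \<in> S \<Longrightarrow> f y = g y"
  shows "Ck_on k S f \<longleftrightarrow> Ck_on k S g"
  using assms(2)
proof (induction k arbitrary: f g)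
  case 0
  then show ?case by (simp cong: continuous_on_cong)
next
  case (Suc k)
  have "f differentiable (at x) \<longleftrightarrow> g differentiable (at x)" if "x \<in> S" for x
    using assms(1) that Suc.prems unfolding differentiable_def
    by (metis (no_types, lifting) has_derivative_transform_within_open)
  moreover have "Ck_on k S (\<lambda>x. frechet_derivative f (at x) v) =
      Ck_on k S (\<lambda>x. frechet_derivative g (at x) v)" for v
    by (rule Suc.IH) (use frechet_derivative_cong[OF assms(1)] Suc.prems in metis)
  ultimately show ?case by simp
qed

lemma smooth_on_cong:
  assumes "open S" and "\<And>y. y \<in> S \<Longrightarrow> f y = g y"
  shows "smooth_on S f \<longleftrightarrow> smooth_on S g"
  unfolding smooth_on_def using Ck_on_cong[OF assms] by simp

lemma frechet_derivative_worksI: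
  "f differentiable (at x) \<Longrightarrow> (f has_derivative frechet_derivative f (at x)) (at x)"
  using frechet_derivative_works by blast

section \<open>Closure of smoothness under sums, bilinear products and linear maps\<close>

lemma Ck_on_lower: "Ck_on (Suc k) S f \<Longrightarrow> Ck_on k S f"
proof (induction k arbitrary: f)
  case 0
  then show ?case
    by (auto intro!: continuous_at_imp_continuous_on differentiable_imp_continuous_within)
qed auto

lemma Ck_on_const: "Ck_on k S (\<lambda>x. c)"
  by (induction k arbitrary: c) auto

lemma smooth_on_const: "smooth_on S (\<lambda>x. c)"
  by (simp add: smooth_on_def Ck_on_const)

lemma Ck_on_add:
  assumes "open S"
  shows "Ck_on k S f \<Longrightarrow> Ck_on k S g \<Longrightarrow> Ck_on k S (\<lambda>x. f x + g x)"
proof (induction k arbitrary: f g)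
  case 0
  then show ?case by (simp add: continuous_on_add)
next
  case (Suc k)
  have "frechet_derivative (\<lambda>x. f x + g x) (at x) =
      (\<lambda>v. frechet_derivative f (at x) v + frechet_derivative g (at x) v)" if "x \<in> S" for x
    using Suc.prems that
    by (intro frechet_derivative_at[symmetric] has_derivative_add)
      (auto simp: frechet_derivative_works[symmetric])
  then have "Ck_on k S (\<lambda>x. frechet_derivative (\<lambda>x. f x + g x) (at x) v) =
     Ck_on k S (\<lambda>x. frechet_derivative f (at x) v + frechet_derivative g (at x) v)" for v
    by (intro Ck_on_cong[OF assms]) auto
  then show ?case using Suc by (auto intro!: Suc.IH)
qed

text \<open>The product rule gives two products, each pairing a derivative with an undifferentiated
  factor. The latter is of class \<open>Suc k\<close>, and \<open>Ck_on_lower\<close> brings it down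
  to the level of the induction hypothesis.\<close>

lemma (in bounded_bilinear) Ck_on:
  assumes "open S"
  shows "Ck_on k S f \<Longrightarrow> Ck_on k S g \<Longrightarrow> Ck_on k S (\<lambda>x. prod (f x) (g x))"
proof (induction k arbitrary: f g)
  case 0
  then show ?case by (simp add: continuous_on)
next
  case (Suc k)
  have "frechet_derivative (\<lambda>x. prod (f x) (g x)) (at x) =
      (\<lambda>v. prod (f x) (frechet_derivative g (at x) v) + prod (frechet_derivative f (at x) v) (g x))"
    if "x \<in> S" for x
    using Suc.prems that
    by (intro frechet_derivative_at[symmetric] FDERIV)
      (auto simp: frechet_derivative_works[symmetric])
  then have "Ck_on k S (\<lambda>x. frechet_derivative (\<lambda>x. prod (f x) (g x)) (at x) v) =
     Ck_on k S (\<lambda>x. prod (f x) (frechet_derivative g (at x) v) +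
       prod (frechet_derivative f (at x) v) (g x))" for v
    by (intro Ck_on_cong[OF assms]) auto
  moreover have "Ck_on k S f" "Ck_on k S g" using Suc.prems Ck_on_lower by blast+
  moreover have "(\<lambda>x. prod (f x) (g x)) differentiable (at x)" if "x \<in> S" for x
    using Suc.prems that
    by (intro differentiableI[OF FDERIV[OF frechet_derivative_worksI frechet_derivative_worksI]])
      auto
  ultimately show ?case using Suc.prems by (auto intro!: Suc.IH Ck_on_add[OF assms])
qed

lemma smooth_on_add:
  "open S \<Longrightarrow> smooth_on S f \<Longrightarrow> smooth_on S g \<Longrightarrow> smooth_on S (\<lambda>x. f x + g x)"
  by (simp add: smooth_on_def Ck_on_add)

lemma smooth_on_scaleR:
  fixes f :: "'a::euclidean_space \<Rightarrow> real"
  shows "open S \<Longrightarrow> smooth_on S f \<Longrightarrow> smooth_on S g \<Longrightarrow> smooth_on S (\<lambda>x. f x *\<^sub>R g x)"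
  by (simp add: smooth_on_def bounded_bilinear.Ck_on[OF bounded_bilinear_scaleR])

lemma smooth_on_mult:
  fixes f g :: "'a::euclidean_space \<Rightarrow> real"
  shows "open S \<Longrightarrow> smooth_on S f \<Longrightarrow> smooth_on S g \<Longrightarrow> smooth_on S (\<lambda>x. f x * g x)"
  using smooth_on_scaleR[of S f g] by simp

lemma smooth_on_minus:
  assumes "open S" and "smooth_on S f"
  shows "smooth_on S (\<lambda>x. - f x)"
  using smooth_on_scaleR[OF assms(1) smooth_on_const[of S "-1"] assms(2)] by simp

lemma smooth_on_diff:
  "open S \<Longrightarrow> smooth_on S f \<Longrightarrow> smooth_on S g \<Longrightarrow> smooth_on S (\<lambda>x. f x - g x)"
  using smooth_on_add[of S f "\<lambda>x. - g x"] smooth_on_minus[of S g] by simp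

lemma smooth_on_sum:
  assumes "open S" and "\<And>i. i \<in> I \<Longrightarrow> smooth_on S (f i)"
  shows "smooth_on S (\<lambda>x. \<Sum>i\<in>I. f i x)"
  using assms(2)
  by (induction I rule: infinite_finite_induct)
    (auto intro: smooth_on_const smooth_on_add[OF assms(1)])

lemma Ck_on_linear_image:
  assumes "open S" and "bounded_linear L"
  shows "Ck_on k S f \<Longrightarrow> Ck_on k S (\<lambda>x. L (f x))"
proof (induction k arbitrary: f)
  case 0
  then show ?case using bounded_linear.continuous_on[OF assms(2)] by simp
next
  case (Suc k)
  have *: "((\<lambda>x. L (f x)) has_derivative (\<lambda>v. L (frechet_derivative f (at x) v))) (at x)"
    if "x \<in> S" for x
    using Suc.prems that
    by (intro bounded_linear.has_derivative[OF assms(2)])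
      (auto simp: frechet_derivative_works[symmetric])
  then have "Ck_on k S (\<lambda>x. frechet_derivative (\<lambda>x. L (f x)) (at x) v) =
     Ck_on k S (\<lambda>x. L (frechet_derivative f (at x) v))" for v
    by (intro Ck_on_cong[OF assms(1)]) (metis frechet_derivative_at)
  then show ?case using Suc * by (auto intro!: Suc.IH simp: differentiable_def)
qed

lemma smooth_on_linear_image:
  "open S \<Longrightarrow> bounded_linear L \<Longrightarrow> smooth_on S f \<Longrightarrow> smooth_on S (\<lambda>x. L (f x))"
  by (simp add: smooth_on_def Ck_on_linear_image)

section \<open>Symmetry of second directional derivatives\<close>

lemma frechet_derivative_linear:
  assumes "smooth_on S f" and "x \<in> S"
  shows "linear (frechet_derivative f (at x))"
  using smooth_on_has_derivative[OF assms] has_derivative_linear by blast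

text \<open>A second difference is the increment along v of an increment along w, so the mean value
  theorem in s and then in t turns it into a mixed second derivative at an interior point.\<close>

lemma second_difference_mean_value:
  fixes f :: "'a::euclidean_space \<Rightarrow> real"
  assumes f: "smooth_on S f" and h: "h > 0"
    and S: "\<And>s t. 0 \<le> s \<Longrightarrow> s \<le> h \<Longrightarrow> 0 \<le> t \<Longrightarrow> t \<le> h \<Longrightarrow> x + s *\<^sub>R v + t *\<^sub>R w \<in> S"
  shows "\<exists>s t. 0 < s \<and> s < h \<and> 0 < t \<and> t < h \<and>
    f (x + h *\<^sub>R v + h *\<^sub>R w) - f (x + h *\<^sub>R v) - f (x + h *\<^sub>R w) + f x =
    h * h * frechet_derivative (\<lambda>y. frechet_derivative f (at y) v) (at (x + s *\<^sub>R v + t *\<^sub>R w)) w"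
proof -
  let ?d = "\<lambda>g v y. frechet_derivative g (at y) v"
  have deriv: "((\<lambda>s. g (y + s *\<^sub>R u)) has_real_derivative ?d g u (y + s *\<^sub>R u)) (at s)"
    if "smooth_on S g" "y + s *\<^sub>R u \<in> S" for g :: "'a \<Rightarrow> real" and y u and s :: real
  proof -
    have "((\<lambda>s. y + s *\<^sub>R u) has_derivative (\<lambda>r. r *\<^sub>R u)) (at s)"
      by (auto intro!: derivative_eq_intros)
    from has_derivative_compose[OF this smooth_on_has_derivative[OF that]]
    have "((\<lambda>s. g (y + s *\<^sub>R u)) has_derivative (\<lambda>r. ?d g (r *\<^sub>R u) (y + s *\<^sub>R u))) (at s)" .
    moreover have "(\<lambda>r. ?d g (r *\<^sub>R u) (y + s *\<^sub>R u)) = (*) (?d g u (y + s *\<^sub>R u))"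
      using linear_cmul[OF frechet_derivative_linear[OF that]] by (auto simp: mult.commute)
    ultimately show ?thesis by (simp add: has_field_derivative_def)
  qed
  let ?\<phi> = "\<lambda>s. f ((x + h *\<^sub>R w) + s *\<^sub>R v) - f (x + s *\<^sub>R v)"
  have "((?\<phi>) has_real_derivative ?d f v ((x + h *\<^sub>R w) + s *\<^sub>R v) - ?d f v (x + s *\<^sub>R v)) (at s)"
    if "0 \<le> s" "s \<le> h" for s
    using S[of s h] S[of s 0] that h
    by (intro DERIV_diff deriv[OF f]) (auto simp: algebra_simps)
  from MVT2[OF h this] obtain s where s: "0 < s" "s < h" and
    1: "?\<phi> h - ?\<phi> 0 = h * (?d f v ((x + h *\<^sub>R w) + s *\<^sub>R v) - ?d f v (x + s *\<^sub>R v))" by auto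
  let ?\<psi> = "\<lambda>t. ?d f v ((x + s *\<^sub>R v) + t *\<^sub>R w)"
  have "(?\<psi> has_real_derivative ?d (?d f v) w ((x + s *\<^sub>R v) + t *\<^sub>R w)) (at t)"
    if "0 \<le> t" "t \<le> h" for t
    using S[of s t] that h s
    by (intro deriv[OF smooth_on_frechet_derivative[OF f]]) auto
  from MVT2[OF h this] obtain t where t: "0 < t" "t < h" and
    2: "?\<psi> h - ?\<psi> 0 = h * ?d (?d f v) w ((x + s *\<^sub>R v) + t *\<^sub>R w)" by auto
  show ?thesis
    using s t 1 2 by (intro exI[of _ s] exI[of _ t]) (simp add: algebra_simps)
qed

text \<open>Both mixed derivatives, at two points that tend to x with h, equal the same second
  difference divided by \<open>h * h\<close>; continuity does the rest.\<close>

lemma frechet_derivative_commute: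
  fixes f :: "'a::euclidean_space \<Rightarrow> real"
  assumes S: "open S" "x \<in> S" and f: "smooth_on S f"
  shows "frechet_derivative (\<lambda>y. frechet_derivative f (at y) v) (at x) w =
    frechet_derivative (\<lambda>y. frechet_derivative f (at y) w) (at x) v"
proof -
  let ?F = "\<lambda>v w y. frechet_derivative (\<lambda>y. frechet_derivative f (at y) v) (at y) w"
  have cont: "isCont (?F v w) x" for v w
    using smooth_on_continuous[OF smooth_on_frechet_derivative[OF smooth_on_frechet_derivative[OF f]]]
      S continuous_on_eq_continuous_at by blast
  obtain e where e: "e > 0" "ball x e \<subseteq> S" using S openE by blast
  \<comment> \<open>The parallelogram of side h spanned by v and w stays within \<open>h * K\<close>
    of x. The summand 1 keeps K positive and the bound strict even if v and w are zero.\<close>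
  define K where "K = norm v + norm w + 1"
  have K: "K > 0" using norm_ge_zero[of v] norm_ge_zero[of w] unfolding K_def by linarith
  have small: "norm (s *\<^sub>R v + t *\<^sub>R w) < h * K"
    if "0 \<le> s" "s \<le> h" "0 \<le> t" "t \<le> h" "h > 0" for s t h
  proof -
    have "norm (s *\<^sub>R v + t *\<^sub>R w) \<le> s * norm v + t * norm w"
      using norm_triangle_ineq[of "s *\<^sub>R v" "t *\<^sub>R w"] that by simp
    also have "\<dots> \<le> h * norm v + h * norm w"
      using that by (intro add_mono mult_right_mono) auto
    also have "\<dots> < h * K" using that unfolding K_def by (simp add: algebra_simps)
    finally show ?thesis .
  qed
  have close: "\<bar>?F v w x - ?F w v x\<bar> < 2 * \<epsilon>" if "\<epsilon> > 0" for \<epsilon>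
  proof -
    have near_x: "\<exists>d>0. \<forall>y. dist y x < d \<longrightarrow> dist (?F v w y) (?F v w x) < \<epsilon>" for v w
      using cont[of v w] that unfolding continuous_at_eps_delta by (elim allE impE)
    obtain d1 where d1: "d1 > 0" "\<forall>y. dist y x < d1 \<longrightarrow> dist (?F v w y) (?F v w x) < \<epsilon>"
      using near_x[of v w] by (elim exE conjE)
    obtain d2 where d2: "d2 > 0" "\<forall>y. dist y x < d2 \<longrightarrow> dist (?F w v y) (?F w v x) < \<epsilon>"
      using near_x[of w v] by (elim exE conjE)
    \<comment> \<open>One h that is small enough for S and for the continuity of both mixed
      derivatives.\<close>
    define h where "h = min e (min d1 d2) / K"
    have h: "h > 0" and hK: "h * K = min e (min d1 d2)"
      using K e d1 d2 by (auto simp: h_def)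
    have near: "dist (x + s *\<^sub>R v + t *\<^sub>R w) x < min e (min d1 d2)"
      if "0 \<le> s" "s \<le> h" "0 \<le> t" "t \<le> h" for s t
      using small[OF that h] hK by (simp add: dist_norm algebra_simps)
    have inS: "x + s *\<^sub>R v + t *\<^sub>R w \<in> S" if "0 \<le> s" "s \<le> h" "0 \<le> t" "t \<le> h" for s t
      using near[OF that] e by (auto simp: dist_commute subset_iff)
    have inS': "x + s *\<^sub>R w + t *\<^sub>R v \<in> S" if "0 \<le> s" "s \<le> h" "0 \<le> t" "t \<le> h" for s t
      using inS[of t s] that by (simp add: algebra_simps)
    obtain s t where st: "0 < s" "s < h" "0 < t" "t < h" and 1:
      "f (x + h *\<^sub>R v + h *\<^sub>R w) - f (x + h *\<^sub>R v) - f (x + h *\<^sub>R w) + f x =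
        h * h * ?F v w (x + s *\<^sub>R v + t *\<^sub>R w)"
      using second_difference_mean_value[OF f h inS] by blast
    obtain s' t' where st': "0 < s'" "s' < h" "0 < t'" "t' < h" and 2:
      "f (x + h *\<^sub>R w + h *\<^sub>R v) - f (x + h *\<^sub>R w) - f (x + h *\<^sub>R v) + f x =
        h * h * ?F w v (x + s' *\<^sub>R w + t' *\<^sub>R v)"
      using second_difference_mean_value[OF f h inS'] by blast
    \<comment> \<open>The second difference is symmetric in v and w, so the two applications of the
      mean value lemma evaluate the same number.\<close>
    have "x + h *\<^sub>R w + h *\<^sub>R v = x + h *\<^sub>R v + h *\<^sub>R w" by (simp add: algebra_simps)
    with 1 2 have "h * h * ?F v w (x + s *\<^sub>R v + t *\<^sub>R w) = h * h * ?F w v (x + s' *\<^sub>R w + t' *\<^sub>R v)"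
      by (simp only:)
    then have eq: "?F v w (x + s *\<^sub>R v + t *\<^sub>R w) = ?F w v (x + s' *\<^sub>R w + t' *\<^sub>R v)"
      using h by simp
    have "dist (x + s *\<^sub>R v + t *\<^sub>R w) x < d1"
      using near[of s t] st by simp
    moreover have "dist (x + s' *\<^sub>R w + t' *\<^sub>R v) x < d2"
      using near[of t' s'] st' by (simp add: algebra_simps)
    ultimately have "dist (?F v w (x + s *\<^sub>R v + t *\<^sub>R w)) (?F v w x) < \<epsilon>"
      "dist (?F w v (x + s' *\<^sub>R w + t' *\<^sub>R v)) (?F w v x) < \<epsilon>"
      using d1(2)[rule_format, of "x + s *\<^sub>R v + t *\<^sub>R w"]
        d2(2)[rule_format, of "x + s' *\<^sub>R w + t' *\<^sub>R v"] by (simp_all only:)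
    then show ?thesis unfolding eq dist_real_def by linarith
  qed
  show ?thesis
  proof (rule ccontr)
    assume "\<not> ?thesis"
    then show False using close[of "\<bar>?F v w x - ?F w v x\<bar> / 2"] by simp
  qed
qed


section \<open>The Bianchi identities in an arbitrary moving frame\<close>

text \<open>The Bianchi identities are algebra of derivations, so functions enter only through
  closure properties and the Leibniz rule. In classical notation
  \<open>[e\<^sub>\<alpha>, e\<^sub>\<beta>]\<close> has \<mu>-component
  \<open>B \<mu> \<alpha> \<beta>\<close>, and the derivative of \<open>e\<^sub>\<epsilon>\<close>
  in direction \<open>e\<^sub>\<gamma>\<close> has \<delta>-component
  \<open>\<Gamma> \<delta> \<epsilon> \<gamma>\<close>. The assumption \<open>jacobi\<close> is the
  \<nu>-component of the cyclic sum of
  \<open>[e\<^sub>\<gamma>, [e\<^sub>\<alpha>, e\<^sub>\<beta>]]\<close>.\<close>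

locale moving_frame =
  fixes W :: "'z set"
    and smooth :: "('z \<Rightarrow> real) \<Rightarrow> bool"
    and d :: "'i::finite \<Rightarrow> ('z \<Rightarrow> real) \<Rightarrow> 'z \<Rightarrow> real"
    and B :: "'i \<Rightarrow> 'i \<Rightarrow> 'i \<Rightarrow> 'z \<Rightarrow> real"
    and \<Gamma> :: "'i \<Rightarrow> 'i \<Rightarrow> 'i \<Rightarrow> 'z \<Rightarrow> real"
  assumes smooth_add: "\<And>f g. smooth f \<Longrightarrow> smooth g \<Longrightarrow> smooth (\<lambda>z. f z + g z)"
    and smooth_diff: "\<And>f g. smooth f \<Longrightarrow> smooth g \<Longrightarrow> smooth (\<lambda>z. f z - g z)"
    and smooth_mult: "\<And>f g. smooth f \<Longrightarrow> smooth g \<Longrightarrow> smooth (\<lambda>z. f z * g z)"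
    and smooth_sum: "\<And>f :: 'i \<Rightarrow> 'z \<Rightarrow> real. (\<And>\<mu>. smooth (f \<mu>)) \<Longrightarrow> smooth (\<lambda>z. \<Sum>\<mu>\<in>UNIV. f \<mu> z)"
    and smooth_d: "\<And>f \<alpha>. smooth f \<Longrightarrow> smooth (d \<alpha> f)"
    and d_add: "\<And>f g \<alpha> z. smooth f \<Longrightarrow> smooth g \<Longrightarrow> z \<in> W \<Longrightarrow>
      d \<alpha> (\<lambda>z. f z + g z) z = d \<alpha> f z + d \<alpha> g z"
    and d_diff: "\<And>f g \<alpha> z. smooth f \<Longrightarrow> smooth g \<Longrightarrow> z \<in> W \<Longrightarrow>
      d \<alpha> (\<lambda>z. f z - g z) z = d \<alpha> f z - d \<alpha> g z"
    and d_mult: "\<And>f g \<alpha> z. smooth f \<Longrightarrow> smooth g \<Longrightarrow> z \<in> W \<Longrightarrow>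
      d \<alpha> (\<lambda>z. f z * g z) z = d \<alpha> f z * g z + f z * d \<alpha> g z"
    and d_sum: "\<And>(f :: 'i \<Rightarrow> 'z \<Rightarrow> real) \<alpha> z. (\<And>\<mu>. smooth (f \<mu>)) \<Longrightarrow> z \<in> W \<Longrightarrow>
      d \<alpha> (\<lambda>z. \<Sum>\<mu>\<in>UNIV. f \<mu> z) z = (\<Sum>\<mu>\<in>UNIV. d \<alpha> (f \<mu>) z)"
    and smooth_B: "\<And>\<mu> \<alpha> \<beta>. smooth (B \<mu> \<alpha> \<beta>)"
    and smooth_\<Gamma>: "\<And>\<delta> \<gamma> \<alpha>. smooth (\<Gamma> \<delta> \<gamma> \<alpha>)"
    and B_swap: "\<And>\<mu> \<alpha> \<beta> z. B \<mu> \<alpha> \<beta> z = - B \<mu> \<beta> \<alpha> z"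
    and commutator: "\<And>f \<alpha> \<beta> z. smooth f \<Longrightarrow> z \<in> W \<Longrightarrow>
      d \<alpha> (d \<beta> f) z - d \<beta> (d \<alpha> f) z = (\<Sum>\<mu>\<in>UNIV. B \<mu> \<alpha> \<beta> z * d \<mu> f z)"
    and jacobi: "\<And>\<nu> \<alpha> \<beta> \<gamma> z. z \<in> W \<Longrightarrow>
      cyc (\<lambda>\<alpha> \<beta> \<gamma>. d \<gamma> (B \<nu> \<alpha> \<beta>) z + (\<Sum>\<mu>\<in>UNIV. B \<nu> \<gamma> \<mu> z * B \<mu> \<alpha> \<beta> z)) \<alpha> \<beta> \<gamma> = 0"
begin

text \<open>
  The lower indices are in the order of the paper: \<open>torsion \<delta> \<alpha> \<beta>\<close> is the \<open>\<delta>\<close>-component of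
  \<open>T(e\<^sub>\<beta>, e\<^sub>\<alpha>)\<close> and \<open>curvature \<delta> \<epsilon> \<alpha> \<beta>\<close> that of \<open>R(e\<^sub>\<beta>, e\<^sub>\<alpha>) e\<^sub>\<epsilon>\<close>.
\<close>

definition torsion :: "'i \<Rightarrow> 'i \<Rightarrow> 'i \<Rightarrow> 'z \<Rightarrow> real" where
  "torsion \<delta> \<alpha> \<beta> z = \<Gamma> \<delta> \<alpha> \<beta> z - \<Gamma> \<delta> \<beta> \<alpha> z + B \<delta> \<alpha> \<beta> z"

definition curvature :: "'i \<Rightarrow> 'i \<Rightarrow> 'i \<Rightarrow> 'i \<Rightarrow> 'z \<Rightarrow> real" where
  "curvature \<delta> \<epsilon> \<alpha> \<beta> z = d \<beta> (\<Gamma> \<delta> \<epsilon> \<alpha>) z - d \<alpha> (\<Gamma> \<delta> \<epsilon> \<beta>) z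
     + (\<Sum>\<eta>\<in>UNIV. \<Gamma> \<eta> \<epsilon> \<alpha> z * \<Gamma> \<delta> \<eta> \<beta> z - \<Gamma> \<eta> \<epsilon> \<beta> z * \<Gamma> \<delta> \<eta> \<alpha> z)
     + (\<Sum>\<mu>\<in>UNIV. \<Gamma> \<delta> \<epsilon> \<mu> z * B \<mu> \<alpha> \<beta> z)"

lemma torsion_swap: "torsion \<delta> \<beta> \<alpha> z = - torsion \<delta> \<alpha> \<beta> z"
  unfolding torsion_def using B_swap[of \<delta> \<alpha> \<beta> z] by simp

lemma curvature_swap: "curvature \<delta> \<epsilon> \<beta> \<alpha> z = - curvature \<delta> \<epsilon> \<alpha> \<beta> z"
proof -
  have "(\<Sum>\<mu>\<in>UNIV. \<Gamma> \<delta> \<epsilon> \<mu> z * B \<mu> \<beta> \<alpha> z) = - (\<Sum>\<mu>\<in>UNIV. \<Gamma> \<delta> \<epsilon> \<mu> z * B \<mu> \<alpha> \<beta> z)"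
    unfolding sum_negf[symmetric] by (intro sum.cong refl) (subst B_swap, simp)
  then show ?thesis unfolding curvature_def by (simp add: sum_subtractf)
qed

lemmas smooth_intros = smooth_add smooth_diff smooth_mult smooth_sum smooth_d smooth_B smooth_\<Gamma>

lemma smooth_torsion: "smooth (torsion \<delta> \<alpha> \<beta>)"
  unfolding torsion_def[abs_def] by (intro smooth_intros)

lemma smooth_curvature: "smooth (curvature \<delta> \<epsilon> \<alpha> \<beta>)"
  unfolding curvature_def[abs_def] by (intro smooth_intros)

lemma d_torsion:
  assumes "z \<in> W"
  shows "d \<gamma> (torsion \<delta> \<alpha> \<beta>) z = d \<gamma> (\<Gamma> \<delta> \<alpha> \<beta>) z - d \<gamma> (\<Gamma> \<delta> \<beta> \<alpha>) z + d \<gamma> (B \<delta> \<alpha> \<beta>) z"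
proof -
  have "torsion \<delta> \<alpha> \<beta> = (\<lambda>z. (\<Gamma> \<delta> \<alpha> \<beta> z - \<Gamma> \<delta> \<beta> \<alpha> z) + B \<delta> \<alpha> \<beta> z)"
    by (auto simp: torsion_def)
  then show ?thesis
    using assms by (simp add: d_add d_diff smooth_intros)
qed

lemma d_curvature:
  assumes "z \<in> W"
  shows "d \<gamma> (curvature \<delta> \<epsilon> \<alpha> \<beta>) z = d \<gamma> (d \<beta> (\<Gamma> \<delta> \<epsilon> \<alpha>)) z - d \<gamma> (d \<alpha> (\<Gamma> \<delta> \<epsilon> \<beta>)) z
     + (\<Sum>\<eta>\<in>UNIV. d \<gamma> (\<Gamma> \<eta> \<epsilon> \<alpha>) z * \<Gamma> \<delta> \<eta> \<beta> z + \<Gamma> \<eta> \<epsilon> \<alpha> z * d \<gamma> (\<Gamma> \<delta> \<eta> \<beta>) z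
         - (d \<gamma> (\<Gamma> \<eta> \<epsilon> \<beta>) z * \<Gamma> \<delta> \<eta> \<alpha> z + \<Gamma> \<eta> \<epsilon> \<beta> z * d \<gamma> (\<Gamma> \<delta> \<eta> \<alpha>) z))
     + (\<Sum>\<mu>\<in>UNIV. d \<gamma> (\<Gamma> \<delta> \<epsilon> \<mu>) z * B \<mu> \<alpha> \<beta> z + \<Gamma> \<delta> \<epsilon> \<mu> z * d \<gamma> (B \<mu> \<alpha> \<beta>) z)"
proof -
  have "curvature \<delta> \<epsilon> \<alpha> \<beta> = (\<lambda>z. ((d \<beta> (\<Gamma> \<delta> \<epsilon> \<alpha>) z - d \<alpha> (\<Gamma> \<delta> \<epsilon> \<beta>) z)
     + (\<Sum>\<eta>\<in>UNIV. \<Gamma> \<eta> \<epsilon> \<alpha> z * \<Gamma> \<delta> \<eta> \<beta> z - \<Gamma> \<eta> \<epsilon> \<beta> z * \<Gamma> \<delta> \<eta> \<alpha> z))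
     + (\<Sum>\<mu>\<in>UNIV. \<Gamma> \<delta> \<epsilon> \<mu> z * B \<mu> \<alpha> \<beta> z))"
    by (auto simp: curvature_def)
  then show ?thesis
    using assms by (simp add: d_add d_diff d_mult d_sum smooth_intros)
qed

text \<open>In each term the derivative of \<open>\<Gamma> \<delta> \<alpha> \<beta>\<close> from
  the torsion cancels the one from the curvature, and the two remaining derivatives of \<Gamma>
  telescope round the cycle. The derivatives of B belong to the Jacobi expression \<open>J\<close>;
  what is left is quadratic.\<close>

theorem first_bianchi:
  assumes z: "z \<in> W"
  shows "cyc (\<lambda>\<alpha> \<beta> \<gamma>. d \<gamma> (torsion \<delta> \<alpha> \<beta>) z + (\<Sum>\<mu>\<in>UNIV. torsion \<mu> \<alpha> \<beta> z * \<Gamma> \<delta> \<mu> \<gamma> z)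
      - (\<Sum>\<mu>\<in>UNIV. torsion \<delta> \<mu> \<beta> z * \<Gamma> \<mu> \<alpha> \<gamma> z) - (\<Sum>\<mu>\<in>UNIV. torsion \<delta> \<alpha> \<mu> z * \<Gamma> \<mu> \<beta> \<gamma> z)
      + (\<Sum>\<mu>\<in>UNIV. torsion \<delta> \<gamma> \<mu> z * torsion \<mu> \<alpha> \<beta> z) - curvature \<delta> \<alpha> \<beta> \<gamma> z) \<alpha> \<beta> \<gamma> = 0"
    (is "cyc ?E \<alpha> \<beta> \<gamma> = 0")
proof -
  define J where "J \<alpha> \<beta> \<gamma> = d \<gamma> (B \<delta> \<alpha> \<beta>) z + (\<Sum>\<mu>\<in>UNIV. B \<delta> \<gamma> \<mu> z * B \<mu> \<alpha> \<beta> z)" for \<alpha> \<beta> \<gamma>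
  \<comment> \<open>The quadratic remainder, less the product of structure functions that
    \<open>J\<close> takes over. Its cyclic sum vanishes for each \<mu> separately, by antisymmetry
    of B.\<close>
  define S where "S \<alpha> \<beta> \<gamma> \<mu> = torsion \<mu> \<alpha> \<beta> z * \<Gamma> \<delta> \<mu> \<gamma> z - torsion \<delta> \<mu> \<beta> z * \<Gamma> \<mu> \<alpha> \<gamma> z
     - torsion \<delta> \<alpha> \<mu> z * \<Gamma> \<mu> \<beta> \<gamma> z + torsion \<delta> \<gamma> \<mu> z * torsion \<mu> \<alpha> \<beta> z
     - B \<delta> \<gamma> \<mu> z * B \<mu> \<alpha> \<beta> z
     - (\<Gamma> \<mu> \<alpha> \<beta> z * \<Gamma> \<delta> \<mu> \<gamma> z - \<Gamma> \<mu> \<alpha> \<gamma> z * \<Gamma> \<delta> \<mu> \<beta> z) - \<Gamma> \<delta> \<alpha> \<mu> z * B \<mu> \<beta> \<gamma> z" for \<alpha> \<beta> \<gamma> \<mu>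
  have E: "?E \<alpha> \<beta> \<gamma> = d \<gamma> (\<Gamma> \<delta> \<alpha> \<beta>) z - d \<gamma> (\<Gamma> \<delta> \<beta> \<alpha>) z - d \<gamma> (\<Gamma> \<delta> \<alpha> \<beta>) z
      + d \<beta> (\<Gamma> \<delta> \<alpha> \<gamma>) z + J \<alpha> \<beta> \<gamma> + (\<Sum>\<mu>\<in>UNIV. S \<alpha> \<beta> \<gamma> \<mu>)" for \<alpha> \<beta> \<gamma>
    unfolding d_torsion[OF z] curvature_def J_def S_def by (simp add: sum.distrib sum_subtractf)
  have "S \<alpha> \<beta> \<gamma> \<mu> + S \<beta> \<gamma> \<alpha> \<mu> + S \<gamma> \<alpha> \<beta> \<mu> = 0" for \<mu>
    using B_swap[of \<mu> \<beta> \<alpha> z] B_swap[of \<mu> \<gamma> \<beta> z] B_swap[of \<mu> \<alpha> \<gamma> z]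
      B_swap[of \<delta> \<mu> \<alpha> z] B_swap[of \<delta> \<mu> \<beta> z] B_swap[of \<delta> \<mu> \<gamma> z]
    unfolding S_def torsion_def by (simp add: algebra_simps)
  then have "(\<Sum>\<mu>\<in>UNIV. S \<alpha> \<beta> \<gamma> \<mu>) + (\<Sum>\<mu>\<in>UNIV. S \<beta> \<gamma> \<alpha> \<mu>) + (\<Sum>\<mu>\<in>UNIV. S \<gamma> \<alpha> \<beta> \<mu>) = 0"
    unfolding sum.distrib[symmetric] by simp
  moreover have "J \<alpha> \<beta> \<gamma> + J \<beta> \<gamma> \<alpha> + J \<gamma> \<alpha> \<beta> = 0"
    using jacobi[OF z, of \<delta> \<alpha> \<beta> \<gamma>] unfolding J_def cyc_def .
  ultimately show ?thesis unfolding cyc_def E by linarith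
qed

text \<open>With \<open>g \<alpha>\<close> read as the matrix of the connection in direction
  \<alpha>, and apart from the terms that transport the lower indices \<alpha> and \<beta>, this is
  the Bianchi identity of a matrix-valued one-form, written in a frame with brackets: the derivative
  of the curvature plus its commutator with the connection matrix has cyclic sum zero.\<close>

theorem second_bianchi:
  assumes z: "z \<in> W"
  shows "cyc (\<lambda>\<alpha> \<beta> \<gamma>. d \<gamma> (curvature \<delta> \<epsilon> \<alpha> \<beta>) z
      + (\<Sum>\<mu>\<in>UNIV. curvature \<mu> \<epsilon> \<alpha> \<beta> z * \<Gamma> \<delta> \<mu> \<gamma> z)
      - (\<Sum>\<mu>\<in>UNIV. curvature \<delta> \<mu> \<alpha> \<beta> z * \<Gamma> \<mu> \<epsilon> \<gamma> z)
      - (\<Sum>\<mu>\<in>UNIV. curvature \<delta> \<epsilon> \<mu> \<beta> z * \<Gamma> \<mu> \<alpha> \<gamma> z)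
      - (\<Sum>\<mu>\<in>UNIV. curvature \<delta> \<epsilon> \<alpha> \<mu> z * \<Gamma> \<mu> \<beta> \<gamma> z)
      + (\<Sum>\<mu>\<in>UNIV. curvature \<delta> \<epsilon> \<gamma> \<mu> z * torsion \<mu> \<alpha> \<beta> z)) \<alpha> \<beta> \<gamma> = 0"
    (is "cyc ?E \<alpha> \<beta> \<gamma> = 0")
proof -
  define g where "g \<alpha> \<delta> \<epsilon> = \<Gamma> \<delta> \<epsilon> \<alpha> z" for \<alpha> \<delta> \<epsilon>
  define g' where "g' \<gamma> \<alpha> \<delta> \<epsilon> = d \<gamma> (\<Gamma> \<delta> \<epsilon> \<alpha>) z" for \<gamma> \<alpha> \<delta> \<epsilon>
  define b where "b \<mu> \<alpha> \<beta> = B \<mu> \<alpha> \<beta> z" for \<mu> \<alpha> \<beta>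
  define R where "R \<alpha> \<beta> \<delta> \<epsilon> = curvature \<delta> \<epsilon> \<alpha> \<beta> z" for \<alpha> \<beta> \<delta> \<epsilon>
  \<comment> \<open>The transport of \<alpha> and \<beta> together with the \<Gamma>-part of the
    torsion contraction; the B-part is expanded in \<open>A3\<close>. Antisymmetry of the curvature
    alone makes the cyclic sum vanish.\<close>
  define S where "S \<alpha> \<beta> \<gamma> \<mu> = R \<gamma> \<mu> \<delta> \<epsilon> * (g \<beta> \<mu> \<alpha> - g \<alpha> \<mu> \<beta>) - R \<mu> \<beta> \<delta> \<epsilon> * g \<gamma> \<mu> \<alpha>
    - R \<alpha> \<mu> \<delta> \<epsilon> * g \<gamma> \<mu> \<beta>" for \<alpha> \<beta> \<gamma> \<mu>
  define J where "J \<alpha> \<beta> \<gamma> \<nu> = d \<gamma> (B \<nu> \<alpha> \<beta>) z + (\<Sum>\<mu>\<in>UNIV. b \<nu> \<gamma> \<mu> * b \<mu> \<alpha> \<beta>)" for \<alpha> \<beta> \<gamma> \<nu>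
  \<comment> \<open>\<open>P1\<close> holds the products of \<Gamma> with a derivative of \<Gamma>.
    \<open>P2\<close> holds the cubic terms, a double commutator of connection matrices, whose
    cyclic sum vanishes by the Jacobi identity for matrices.\<close>
  define P1 where "P1 \<alpha> \<beta> \<gamma> \<eta> = g' \<gamma> \<alpha> \<eta> \<epsilon> * g \<beta> \<delta> \<eta> + g \<alpha> \<eta> \<epsilon> * g' \<gamma> \<beta> \<delta> \<eta>
     - (g' \<gamma> \<beta> \<eta> \<epsilon> * g \<alpha> \<delta> \<eta> + g \<beta> \<eta> \<epsilon> * g' \<gamma> \<alpha> \<delta> \<eta>)
     + (g' \<beta> \<alpha> \<eta> \<epsilon> - g' \<alpha> \<beta> \<eta> \<epsilon>) * g \<gamma> \<delta> \<eta> - (g' \<beta> \<alpha> \<delta> \<eta> - g' \<alpha> \<beta> \<delta> \<eta>) * g \<gamma> \<eta> \<epsilon>"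
    for \<alpha> \<beta> \<gamma> \<eta>
  define P2 where "P2 \<alpha> \<beta> \<gamma> \<eta> \<xi> = (g \<alpha> \<xi> \<epsilon> * g \<beta> \<eta> \<xi> - g \<beta> \<xi> \<epsilon> * g \<alpha> \<eta> \<xi>) * g \<gamma> \<delta> \<eta>
     - (g \<alpha> \<eta> \<xi> * g \<beta> \<delta> \<eta> - g \<beta> \<eta> \<xi> * g \<alpha> \<delta> \<eta>) * g \<gamma> \<xi> \<epsilon>" for \<alpha> \<beta> \<gamma> \<eta> \<xi>
  have R: "R \<alpha> \<beta> \<delta> \<epsilon> = g' \<beta> \<alpha> \<delta> \<epsilon> - g' \<alpha> \<beta> \<delta> \<epsilon>
     + (\<Sum>\<eta>\<in>UNIV. g \<alpha> \<eta> \<epsilon> * g \<beta> \<delta> \<eta> - g \<beta> \<eta> \<epsilon> * g \<alpha> \<delta> \<eta>) + (\<Sum>\<mu>\<in>UNIV. g \<mu> \<delta> \<epsilon> * b \<mu> \<alpha> \<beta>)"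
    for \<alpha> \<beta> \<delta> \<epsilon>
    by (simp add: R_def curvature_def g_def g'_def b_def)
  have A1: "(\<Sum>\<eta>\<in>UNIV. R \<alpha> \<beta> \<eta> \<epsilon> * g \<gamma> \<delta> \<eta>) =
      (\<Sum>\<eta>\<in>UNIV. (g' \<beta> \<alpha> \<eta> \<epsilon> - g' \<alpha> \<beta> \<eta> \<epsilon>) * g \<gamma> \<delta> \<eta>)
      + (\<Sum>\<eta>\<in>UNIV. \<Sum>\<xi>\<in>UNIV. (g \<alpha> \<xi> \<epsilon> * g \<beta> \<eta> \<xi> - g \<beta> \<xi> \<epsilon> * g \<alpha> \<eta> \<xi>) * g \<gamma> \<delta> \<eta>)
      + (\<Sum>\<mu>\<in>UNIV. b \<mu> \<alpha> \<beta> * (\<Sum>\<eta>\<in>UNIV. g \<mu> \<eta> \<epsilon> * g \<gamma> \<delta> \<eta>))" for \<alpha> \<beta> \<gamma>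
  proof -
    have "(\<Sum>\<mu>\<in>UNIV. b \<mu> \<alpha> \<beta> * (\<Sum>\<eta>\<in>UNIV. g \<mu> \<eta> \<epsilon> * g \<gamma> \<delta> \<eta>)) =
        (\<Sum>\<eta>\<in>UNIV. (\<Sum>\<mu>\<in>UNIV. g \<mu> \<eta> \<epsilon> * b \<mu> \<alpha> \<beta>) * g \<gamma> \<delta> \<eta>)"
      unfolding sum_distrib_left sum_distrib_right
      by (subst sum.swap) (simp add: mult_ac)
    then show ?thesis
      unfolding R by (simp only: sum_distrib_right[symmetric] sum.distrib[symmetric])
        (simp add: algebra_simps)
  qed
  have A2: "(\<Sum>\<xi>\<in>UNIV. R \<alpha> \<beta> \<delta> \<xi> * g \<gamma> \<xi> \<epsilon>) =
      (\<Sum>\<eta>\<in>UNIV. (g' \<beta> \<alpha> \<delta> \<eta> - g' \<alpha> \<beta> \<delta> \<eta>) * g \<gamma> \<eta> \<epsilon>)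
      + (\<Sum>\<eta>\<in>UNIV. \<Sum>\<xi>\<in>UNIV. (g \<alpha> \<eta> \<xi> * g \<beta> \<delta> \<eta> - g \<beta> \<eta> \<xi> * g \<alpha> \<delta> \<eta>) * g \<gamma> \<xi> \<epsilon>)
      + (\<Sum>\<mu>\<in>UNIV. b \<mu> \<alpha> \<beta> * (\<Sum>\<eta>\<in>UNIV. g \<mu> \<delta> \<eta> * g \<gamma> \<eta> \<epsilon>))" for \<alpha> \<beta> \<gamma>
  proof -
    have "(\<Sum>\<mu>\<in>UNIV. b \<mu> \<alpha> \<beta> * (\<Sum>\<eta>\<in>UNIV. g \<mu> \<delta> \<eta> * g \<gamma> \<eta> \<epsilon>)) =
        (\<Sum>\<eta>\<in>UNIV. (\<Sum>\<mu>\<in>UNIV. g \<mu> \<delta> \<eta> * b \<mu> \<alpha> \<beta>) * g \<gamma> \<eta> \<epsilon>)"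
      unfolding sum_distrib_left sum_distrib_right
      by (subst sum.swap) (simp add: mult_ac)
    \<comment> \<open>Exchanging the sums puts \<eta> and \<xi> in the same places of the triple
      products as in \<open>A1\<close>, so that the cyclic sum of \<open>P2\<close> cancels summand
      by summand.\<close>
    moreover have "(\<Sum>\<eta>\<in>UNIV. \<Sum>\<xi>\<in>UNIV. (g \<alpha> \<eta> \<xi> * g \<beta> \<delta> \<eta> - g \<beta> \<eta> \<xi> * g \<alpha> \<delta> \<eta>) * g \<gamma> \<xi> \<epsilon>) =
        (\<Sum>\<xi>\<in>UNIV. (\<Sum>\<eta>\<in>UNIV. g \<alpha> \<eta> \<xi> * g \<beta> \<delta> \<eta> - g \<beta> \<eta> \<xi> * g \<alpha> \<delta> \<eta>) * g \<gamma> \<xi> \<epsilon>)"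
      unfolding sum_distrib_right by (rule sum.swap)
    ultimately show ?thesis
      unfolding R by (simp only: sum.distrib[symmetric]) (simp add: algebra_simps)
  qed
  have A3: "(\<Sum>\<mu>\<in>UNIV. R \<gamma> \<mu> \<delta> \<epsilon> * b \<mu> \<alpha> \<beta>) = (\<Sum>\<mu>\<in>UNIV. (g' \<mu> \<gamma> \<delta> \<epsilon> - g' \<gamma> \<mu> \<delta> \<epsilon>) * b \<mu> \<alpha> \<beta>)
      + (\<Sum>\<mu>\<in>UNIV. b \<mu> \<alpha> \<beta> * (\<Sum>\<eta>\<in>UNIV. g \<mu> \<delta> \<eta> * g \<gamma> \<eta> \<epsilon>))
      - (\<Sum>\<mu>\<in>UNIV. b \<mu> \<alpha> \<beta> * (\<Sum>\<eta>\<in>UNIV. g \<mu> \<eta> \<epsilon> * g \<gamma> \<delta> \<eta>))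
      + (\<Sum>\<nu>\<in>UNIV. g \<nu> \<delta> \<epsilon> * (\<Sum>\<mu>\<in>UNIV. b \<nu> \<gamma> \<mu> * b \<mu> \<alpha> \<beta>))" for \<alpha> \<beta> \<gamma>
  proof -
    have "(\<Sum>\<nu>\<in>UNIV. g \<nu> \<delta> \<epsilon> * (\<Sum>\<mu>\<in>UNIV. b \<nu> \<gamma> \<mu> * b \<mu> \<alpha> \<beta>)) =
        (\<Sum>\<mu>\<in>UNIV. (\<Sum>\<nu>\<in>UNIV. g \<nu> \<delta> \<epsilon> * b \<nu> \<gamma> \<mu>) * b \<mu> \<alpha> \<beta>)"
      unfolding sum_distrib_left sum_distrib_right
      by (subst sum.swap) (simp add: mult_ac)
    then show ?thesis
      unfolding R by (simp only: sum.distrib[symmetric] sum_subtractf[symmetric])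
        (simp add: algebra_simps sum_subtractf)
  qed
  have E: "?E \<alpha> \<beta> \<gamma> = d \<gamma> (d \<beta> (\<Gamma> \<delta> \<epsilon> \<alpha>)) z - d \<gamma> (d \<alpha> (\<Gamma> \<delta> \<epsilon> \<beta>)) z
      + (\<Sum>\<eta>\<in>UNIV. P1 \<alpha> \<beta> \<gamma> \<eta>) + (\<Sum>\<eta>\<in>UNIV. \<Sum>\<xi>\<in>UNIV. P2 \<alpha> \<beta> \<gamma> \<eta> \<xi>)
      + (\<Sum>\<nu>\<in>UNIV. g \<nu> \<delta> \<epsilon> * J \<alpha> \<beta> \<gamma> \<nu>) + (\<Sum>\<mu>\<in>UNIV. b \<mu> \<alpha> \<beta> * g' \<mu> \<gamma> \<delta> \<epsilon>)
      + (\<Sum>\<mu>\<in>UNIV. S \<alpha> \<beta> \<gamma> \<mu>)" for \<alpha> \<beta> \<gamma>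
  proof -
    have "?E \<alpha> \<beta> \<gamma> = d \<gamma> (d \<beta> (\<Gamma> \<delta> \<epsilon> \<alpha>)) z - d \<gamma> (d \<alpha> (\<Gamma> \<delta> \<epsilon> \<beta>)) z
       + (\<Sum>\<eta>\<in>UNIV. g' \<gamma> \<alpha> \<eta> \<epsilon> * g \<beta> \<delta> \<eta> + g \<alpha> \<eta> \<epsilon> * g' \<gamma> \<beta> \<delta> \<eta>
         - (g' \<gamma> \<beta> \<eta> \<epsilon> * g \<alpha> \<delta> \<eta> + g \<beta> \<eta> \<epsilon> * g' \<gamma> \<alpha> \<delta> \<eta>))
       + (\<Sum>\<mu>\<in>UNIV. g' \<gamma> \<mu> \<delta> \<epsilon> * b \<mu> \<alpha> \<beta> + g \<mu> \<delta> \<epsilon> * d \<gamma> (B \<mu> \<alpha> \<beta>) z)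
       + (\<Sum>\<mu>\<in>UNIV. R \<alpha> \<beta> \<mu> \<epsilon> * g \<gamma> \<delta> \<mu>) - (\<Sum>\<mu>\<in>UNIV. R \<alpha> \<beta> \<delta> \<mu> * g \<gamma> \<mu> \<epsilon>)
       + (\<Sum>\<mu>\<in>UNIV. R \<gamma> \<mu> \<delta> \<epsilon> * b \<mu> \<alpha> \<beta>) + (\<Sum>\<mu>\<in>UNIV. S \<alpha> \<beta> \<gamma> \<mu>)"
      unfolding d_curvature[OF z] S_def
      by (simp add: g_def g'_def b_def R_def torsion_def algebra_simps sum.distrib sum_subtractf)
    also have "\<dots> = d \<gamma> (d \<beta> (\<Gamma> \<delta> \<epsilon> \<alpha>)) z - d \<gamma> (d \<alpha> (\<Gamma> \<delta> \<epsilon> \<beta>)) z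
      + (\<Sum>\<eta>\<in>UNIV. P1 \<alpha> \<beta> \<gamma> \<eta>) + (\<Sum>\<eta>\<in>UNIV. \<Sum>\<xi>\<in>UNIV. P2 \<alpha> \<beta> \<gamma> \<eta> \<xi>)
      + (\<Sum>\<nu>\<in>UNIV. g \<nu> \<delta> \<epsilon> * J \<alpha> \<beta> \<gamma> \<nu>) + (\<Sum>\<mu>\<in>UNIV. b \<mu> \<alpha> \<beta> * g' \<mu> \<gamma> \<delta> \<epsilon>)
      + (\<Sum>\<mu>\<in>UNIV. S \<alpha> \<beta> \<gamma> \<mu>)"
    proof -
      have 1: "(\<Sum>\<eta>\<in>UNIV. P1 \<alpha> \<beta> \<gamma> \<eta>) = (\<Sum>\<eta>\<in>UNIV. g' \<gamma> \<alpha> \<eta> \<epsilon> * g \<beta> \<delta> \<eta> + g \<alpha> \<eta> \<epsilon> * g' \<gamma> \<beta> \<delta> \<eta>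
         - (g' \<gamma> \<beta> \<eta> \<epsilon> * g \<alpha> \<delta> \<eta> + g \<beta> \<eta> \<epsilon> * g' \<gamma> \<alpha> \<delta> \<eta>))
         + (\<Sum>\<eta>\<in>UNIV. (g' \<beta> \<alpha> \<eta> \<epsilon> - g' \<alpha> \<beta> \<eta> \<epsilon>) * g \<gamma> \<delta> \<eta>)
         - (\<Sum>\<eta>\<in>UNIV. (g' \<beta> \<alpha> \<delta> \<eta> - g' \<alpha> \<beta> \<delta> \<eta>) * g \<gamma> \<eta> \<epsilon>)"
        unfolding P1_def by (simp only: sum.distrib sum_subtractf)
      have 2: "(\<Sum>\<eta>\<in>UNIV. \<Sum>\<xi>\<in>UNIV. P2 \<alpha> \<beta> \<gamma> \<eta> \<xi>) =
         (\<Sum>\<eta>\<in>UNIV. \<Sum>\<xi>\<in>UNIV. (g \<alpha> \<xi> \<epsilon> * g \<beta> \<eta> \<xi> - g \<beta> \<xi> \<epsilon> * g \<alpha> \<eta> \<xi>) * g \<gamma> \<delta> \<eta>)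
         - (\<Sum>\<eta>\<in>UNIV. \<Sum>\<xi>\<in>UNIV. (g \<alpha> \<eta> \<xi> * g \<beta> \<delta> \<eta> - g \<beta> \<eta> \<xi> * g \<alpha> \<delta> \<eta>) * g \<gamma> \<xi> \<epsilon>)"
        unfolding P2_def by (simp only: sum_subtractf)
      have 3: "(\<Sum>\<nu>\<in>UNIV. g \<nu> \<delta> \<epsilon> * J \<alpha> \<beta> \<gamma> \<nu>) = (\<Sum>\<nu>\<in>UNIV. g \<nu> \<delta> \<epsilon> * d \<gamma> (B \<nu> \<alpha> \<beta>) z)
         + (\<Sum>\<nu>\<in>UNIV. g \<nu> \<delta> \<epsilon> * (\<Sum>\<mu>\<in>UNIV. b \<nu> \<gamma> \<mu> * b \<mu> \<alpha> \<beta>))"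
        unfolding J_def distrib_left sum.distrib ..
      have 4: "(\<Sum>\<mu>\<in>UNIV. (g' \<mu> \<gamma> \<delta> \<epsilon> - g' \<gamma> \<mu> \<delta> \<epsilon>) * b \<mu> \<alpha> \<beta>) =
        (\<Sum>\<mu>\<in>UNIV. b \<mu> \<alpha> \<beta> * g' \<mu> \<gamma> \<delta> \<epsilon>) - (\<Sum>\<mu>\<in>UNIV. g' \<gamma> \<mu> \<delta> \<epsilon> * b \<mu> \<alpha> \<beta>)"
        unfolding sum_subtractf[symmetric] by (simp add: algebra_simps)
      show ?thesis unfolding 1 2 3 A1 A2 A3 4 sum.distrib by simp
    qed
    finally show ?thesis .
  qed
  have P1: "(\<Sum>\<eta>\<in>UNIV. P1 \<alpha> \<beta> \<gamma> \<eta>) + (\<Sum>\<eta>\<in>UNIV. P1 \<beta> \<gamma> \<alpha> \<eta>) + (\<Sum>\<eta>\<in>UNIV. P1 \<gamma> \<alpha> \<beta> \<eta>) = 0"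
    unfolding sum.distrib[symmetric] P1_def by (simp add: algebra_simps)
  have P2: "(\<Sum>\<eta>\<in>UNIV. \<Sum>\<xi>\<in>UNIV. P2 \<alpha> \<beta> \<gamma> \<eta> \<xi>) + (\<Sum>\<eta>\<in>UNIV. \<Sum>\<xi>\<in>UNIV. P2 \<beta> \<gamma> \<alpha> \<eta> \<xi>)
      + (\<Sum>\<eta>\<in>UNIV. \<Sum>\<xi>\<in>UNIV. P2 \<gamma> \<alpha> \<beta> \<eta> \<xi>) = 0"
    unfolding sum.distrib[symmetric] P2_def by (simp add: algebra_simps)
  have "J \<alpha> \<beta> \<gamma> \<nu> + J \<beta> \<gamma> \<alpha> \<nu> + J \<gamma> \<alpha> \<beta> \<nu> = 0" for \<nu>
    using jacobi[OF z, of \<nu> \<alpha> \<beta> \<gamma>] unfolding J_def cyc_def b_def .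
  then have J: "(\<Sum>\<nu>\<in>UNIV. g \<nu> \<delta> \<epsilon> * J \<alpha> \<beta> \<gamma> \<nu>) + (\<Sum>\<nu>\<in>UNIV. g \<nu> \<delta> \<epsilon> * J \<beta> \<gamma> \<alpha> \<nu>)
      + (\<Sum>\<nu>\<in>UNIV. g \<nu> \<delta> \<epsilon> * J \<gamma> \<alpha> \<beta> \<nu>) = 0"
    unfolding sum.distrib[symmetric] distrib_left[symmetric] by simp
  have R_swap: "R \<mu> \<alpha> \<delta> \<epsilon> = - R \<alpha> \<mu> \<delta> \<epsilon>" for \<alpha> \<mu>
    unfolding R_def by (rule curvature_swap)
  have "S \<alpha> \<beta> \<gamma> \<mu> + S \<beta> \<gamma> \<alpha> \<mu> + S \<gamma> \<alpha> \<beta> \<mu> = 0" for \<mu>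
    using R_swap[of \<mu> \<alpha>] R_swap[of \<mu> \<beta>] R_swap[of \<mu> \<gamma>]
    unfolding S_def by (simp add: algebra_simps)
  then have S: "(\<Sum>\<mu>\<in>UNIV. S \<alpha> \<beta> \<gamma> \<mu>) + (\<Sum>\<mu>\<in>UNIV. S \<beta> \<gamma> \<alpha> \<mu>) + (\<Sum>\<mu>\<in>UNIV. S \<gamma> \<alpha> \<beta> \<mu>) = 0"
    unfolding sum.distrib[symmetric] by simp
  \<comment> \<open>Commuting the two derivatives of one coefficient produces exactly the bracket
    term with first derivatives that \<open>E\<close> leaves over in another term of the
    cycle.\<close>
  have comm: "d \<gamma> (d \<beta> (\<Gamma> \<delta> \<epsilon> \<alpha>)) z - d \<beta> (d \<gamma> (\<Gamma> \<delta> \<epsilon> \<alpha>)) z =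
      - (\<Sum>\<mu>\<in>UNIV. b \<mu> \<beta> \<gamma> * g' \<mu> \<alpha> \<delta> \<epsilon>)" for \<alpha> \<beta> \<gamma>
    using commutator[OF smooth_\<Gamma> z, of \<beta> \<gamma> \<delta> \<epsilon> \<alpha>] unfolding b_def g'_def by simp
  show ?thesis
    unfolding cyc_def E
    using P1 P2 J S comm[of \<gamma> \<beta> \<alpha>] comm[of \<alpha> \<gamma> \<beta>] comm[of \<beta> \<alpha> \<gamma>] by linarith
qed

end


section \<open>Vector fields acting on functions\<close>

lemma vf_apply_cong:
  assumes "open W" and "z \<in> W" and "\<And>w. w \<in> W \<Longrightarrow> f w = g w"
  shows "vf_apply X f z = vf_apply X g z"
  unfolding vf_apply_def using frechet_derivative_cong[OF assms] by simp

lemma vf_apply_const [simp]: "vf_apply X (\<lambda>z. c) z = 0"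
  by (simp add: vf_apply_def)

lemma vf_apply_add:
  assumes "smooth_on W f" and "smooth_on W g" and "z \<in> W"
  shows "vf_apply X (\<lambda>z. f z + g z) z = vf_apply X f z + vf_apply X g z"
proof -
  note D = has_derivative_add[OF smooth_on_has_derivative[OF assms(1,3)]
      smooth_on_has_derivative[OF assms(2,3)]]
  show ?thesis unfolding vf_apply_def frechet_derivative_at[OF D, symmetric] ..
qed

lemma vf_apply_diff:
  assumes "smooth_on W f" and "smooth_on W g" and "z \<in> W"
  shows "vf_apply X (\<lambda>z. f z - g z) z = vf_apply X f z - vf_apply X g z"
proof -
  note D = has_derivative_diff[OF smooth_on_has_derivative[OF assms(1,3)]
      smooth_on_has_derivative[OF assms(2,3)]]
  show ?thesis unfolding vf_apply_def frechet_derivative_at[OF D, symmetric] ..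
qed

lemma vf_apply_mult:
  assumes "smooth_on W f" and "smooth_on W g" and "z \<in> W"
  shows "vf_apply X (\<lambda>z. f z * g z) z = vf_apply X f z * g z + f z * vf_apply X g z"
proof -
  note D = has_derivative_mult[OF smooth_on_has_derivative[OF assms(1,3)]
      smooth_on_has_derivative[OF assms(2,3)]]
  show ?thesis unfolding vf_apply_def frechet_derivative_at[OF D, symmetric] by simp
qed

lemma vf_apply_minus:
  assumes "smooth_on W f" and "z \<in> W"
  shows "vf_apply X (\<lambda>z. - f z) z = - vf_apply X f z"
proof -
  note D = has_derivative_minus[OF smooth_on_has_derivative[OF assms]]
  show ?thesis unfolding vf_apply_def frechet_derivative_at[OF D, symmetric] ..
qed

lemma vf_apply_sum:
  assumes "\<And>i. i \<in> I \<Longrightarrow> smooth_on W (f i)" and "z \<in> W"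
  shows "vf_apply X (\<lambda>z. \<Sum>i\<in>I. f i z) z = (\<Sum>i\<in>I. vf_apply X (f i) z)"
proof -
  have D: "((\<lambda>z. \<Sum>i\<in>I. f i z) has_derivative
      (\<lambda>v. \<Sum>i\<in>I. frechet_derivative (f i) (at z) v)) (at z)"
    by (intro has_derivative_sum smooth_on_has_derivative[OF assms(1) assms(2)])
  show ?thesis unfolding vf_apply_def frechet_derivative_at[OF D, symmetric] ..
qed

text \<open>\<open>smooth_on_frechet_derivative\<close> is about a fixed direction, while here the
  direction varies with the point. Expansion in \<open>Basis\<close> separates the two
  dependences.\<close>

lemma vf_apply_expand:
  assumes "smooth_on W f" and "z \<in> W"
  shows "vf_apply X f z = (\<Sum>u\<in>Basis. (X z \<bullet> u) * frechet_derivative f (at z) u)"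
proof -
  note L = frechet_derivative_linear[OF assms]
  have "frechet_derivative f (at z) (X z) =
      frechet_derivative f (at z) (\<Sum>u\<in>Basis. (X z \<bullet> u) *\<^sub>R u)"
    by (simp add: euclidean_representation)
  also have "\<dots> = (\<Sum>u\<in>Basis. (X z \<bullet> u) * frechet_derivative f (at z) u)"
    by (simp add: linear_sum[OF L] linear_cmul[OF L])
  finally show ?thesis unfolding vf_apply_def .
qed

lemma smooth_on_vf_apply:
  assumes W: "open W" and X: "smooth_on W X" and f: "smooth_on W f"
  shows "smooth_on W (vf_apply X f)"
proof -
  have "smooth_on W (\<lambda>z. \<Sum>u\<in>Basis. (X z \<bullet> u) * frechet_derivative f (at z) u)"
    by (intro smooth_on_sum smooth_on_mult smooth_on_frechet_derivative f W
        smooth_on_linear_image[OF W bounded_linear_inner_left X])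
  then show ?thesis
    by (subst smooth_on_cong[OF W vf_apply_expand[OF f]]) auto
qed

text \<open>The second derivatives of f enter both compositions through the same expression, by
  \<open>frechet_derivative_commute\<close>. Only the derivative of f along the Lie bracket of X and
  Y survives.\<close>

lemma vf_apply_commutator:
  assumes W: "open W" and z: "z \<in> W"
    and X: "smooth_on W X" and Y: "smooth_on W Y" and f: "smooth_on W f"
  shows "vf_apply X (vf_apply Y f) z - vf_apply Y (vf_apply X f) z =
    frechet_derivative f (at z)
      (frechet_derivative Y (at z) (X z) - frechet_derivative X (at z) (Y z))"
proof -
  let ?d = "\<lambda>u z. frechet_derivative f (at z) u"
  have second: "vf_apply X (vf_apply Y f) z =
      frechet_derivative f (at z) (frechet_derivative Y (at z) (X z))
      + (\<Sum>u\<in>Basis. \<Sum>v\<in>Basis. (Y z \<bullet> u) * ((X z \<bullet> v) * frechet_derivative (?d u) (at z) v))"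
    if X: "smooth_on W X" and Y: "smooth_on W Y" for X Y
  proof -
    note L = frechet_derivative_linear[OF f z]
    have Yu: "smooth_on W (\<lambda>z. Y z \<bullet> u)" for u
      by (rule smooth_on_linear_image[OF W bounded_linear_inner_left Y])
    have Yu': "vf_apply X (\<lambda>z. Y z \<bullet> u) z = frechet_derivative Y (at z) (X z) \<bullet> u" for u
      unfolding vf_apply_def
      using bounded_linear.has_derivative[OF bounded_linear_inner_left
          smooth_on_has_derivative[OF Y z], of u]
      by (metis frechet_derivative_at)
    have "vf_apply X (vf_apply Y f) z = vf_apply X (\<lambda>z. \<Sum>u\<in>Basis. (Y z \<bullet> u) * ?d u z) z"
      by (rule vf_apply_cong[OF W z vf_apply_expand[OF f]])
    also have "\<dots> = (\<Sum>u\<in>Basis. vf_apply X (\<lambda>z. Y z \<bullet> u) z * ?d u z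
        + (Y z \<bullet> u) * vf_apply X (?d u) z)"
      by (subst vf_apply_sum[OF _ z])
        (auto intro!: smooth_on_mult W Yu smooth_on_frechet_derivative f sum.cong
          vf_apply_mult[OF Yu smooth_on_frechet_derivative[OF f] z])
    also have "\<dots> = (\<Sum>u\<in>Basis. (frechet_derivative Y (at z) (X z) \<bullet> u) * ?d u z)
        + (\<Sum>u\<in>Basis. \<Sum>v\<in>Basis. (Y z \<bullet> u) * ((X z \<bullet> v) * frechet_derivative (?d u) (at z) v))"
      unfolding Yu' vf_apply_expand[OF smooth_on_frechet_derivative[OF f] z]
      by (simp add: sum.distrib sum_distrib_left)
    also have "(\<Sum>u\<in>Basis. (frechet_derivative Y (at z) (X z) \<bullet> u) * ?d u z) =
        frechet_derivative f (at z) (\<Sum>u\<in>Basis. (frechet_derivative Y (at z) (X z) \<bullet> u) *\<^sub>R u)"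
      by (simp add: linear_sum[OF L] linear_cmul[OF L])
    finally show ?thesis by (simp add: euclidean_representation)
  qed
  have "(\<Sum>u\<in>Basis. \<Sum>v\<in>Basis. (Y z \<bullet> u) * ((X z \<bullet> v) * frechet_derivative (?d u) (at z) v)) =
      (\<Sum>u\<in>Basis. \<Sum>v\<in>Basis. (X z \<bullet> u) * ((Y z \<bullet> v) * frechet_derivative (?d u) (at z) v))"
    by (subst sum.swap)
      (intro sum.cong refl, subst frechet_derivative_commute[OF W z f], simp)
  then show ?thesis
    unfolding second[OF X Y] second[OF Y X]
    by (simp add: linear_diff[OF frechet_derivative_linear[OF f z]])
qed

section \<open>The adapted frame\<close>

instance adx :: (finite, finite) finite
proof
  have "(UNIV :: ('a, 'b) adx set) = range Tm \<union> range Sp \<union> range (\<lambda>(i, a). Mo i a)"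
    (is "_ = ?R")
  proof -
    have "x \<in> ?R" for x by (cases x) auto
    then show ?thesis by auto
  qed
  then show "finite (UNIV :: ('a, 'b) adx set)" by (metis finite_Un finite_imageI finite)
qed

text \<open>Turns a contraction over \<mu> in a frame identity into the single and double sums of
  the local identities.\<close>

lemma sum_adx:
  fixes f :: "('m::finite, 'n::finite) adx \<Rightarrow> real"
  shows "(\<Sum>\<mu>\<in>UNIV. f \<mu>) = (\<Sum>a\<in>UNIV. f (Tm a)) + (\<Sum>i\<in>UNIV. f (Sp i))
    + (\<Sum>i\<in>UNIV. \<Sum>a\<in>UNIV. f (Mo i a))"
proof -
  have U: "(UNIV :: ('m, 'n) adx set) = (range Tm \<union> range Sp) \<union> range (\<lambda>(i, a). Mo i a)"
    (is "_ = ?R")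
  proof -
    have "x \<in> ?R" for x by (cases x) auto
    then show ?thesis by auto
  qed
  have "(\<Sum>\<mu>\<in>UNIV. f \<mu>) = (\<Sum>\<mu>\<in>range Tm \<union> range Sp. f \<mu>) + (\<Sum>\<mu>\<in>range (\<lambda>(i, a). Mo i a). f \<mu>)"
    unfolding U by (rule sum.union_disjoint) auto
  moreover have "(\<Sum>\<mu>\<in>range Tm \<union> range Sp. f \<mu>) = (\<Sum>\<mu>\<in>range Tm. f \<mu>) + (\<Sum>\<mu>\<in>range Sp. f \<mu>)"
    by (rule sum.union_disjoint) auto
  moreover have "(\<Sum>\<mu>\<in>range Tm. f \<mu>) = (\<Sum>a\<in>UNIV. f (Tm a))"
    by (subst sum.reindex) (auto simp: inj_def)
  moreover have "(\<Sum>\<mu>\<in>range Sp. f \<mu>) = (\<Sum>a\<in>UNIV. f (Sp a))"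
    by (subst sum.reindex) (auto simp: inj_def)
  moreover have "(\<Sum>\<mu>\<in>range (\<lambda>(i, a). Mo i a). f \<mu>) = (\<Sum>i\<in>UNIV. \<Sum>a\<in>UNIV. f (Mo i a))"
    by (subst sum.reindex) (auto simp: inj_def sum.cartesian_product split_def)
  ultimately show ?thesis by simp
qed

text \<open>
  With zero in the momentum directions, \<open>[e\<^sub>\<alpha>, e\<^sub>\<beta>] = (e\<^sub>\<beta> N\<^sub>\<alpha> - e\<^sub>\<alpha> N\<^sub>\<beta>) \<partial>/\<partial>p\<close> holds for all three kinds of
  frame fields.
\<close>

fun nlc :: "('m::finite, 'n::finite) jet_geometry \<Rightarrow> 'n \<Rightarrow> 'm \<Rightarrow> ('m, 'n) adx \<Rightarrow> ('m, 'n) scalar" where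
  "nlc G r f (Tm a) = nlc1 G f r a"
| "nlc G r f (Sp i) = nlc2 G f r i"
| "nlc G r f (Mo i a) = (\<lambda>z. 0)"

fun bracket_coeff ::
    "('m::finite, 'n::finite) jet_geometry \<Rightarrow> ('m, 'n) adx \<Rightarrow> ('m, 'n) adx \<Rightarrow> ('m, 'n) adx \<Rightarrow> ('m, 'n) scalar"
  where
  "bracket_coeff G (Mo r f) \<alpha> \<beta> z =
     vf_apply (frame G \<beta>) (nlc G r f \<alpha>) z - vf_apply (frame G \<alpha>) (nlc G r f \<beta>) z"
| "bracket_coeff G (Tm a) \<alpha> \<beta> z = 0"
| "bracket_coeff G (Sp i) \<alpha> \<beta> z = 0"

text \<open>The momentum coordinates transform with the temporal tangent bundle and the spatial
  cotangent bundle. The third equation is accordingly the tensor product of the temporal connection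
  with the dual of the spatial one, whence the transposed indices and the minus sign. The zeros in
  the last equation express that the three distributions are preserved.\<close>

fun conn_coeff ::
    "('m::finite, 'n::finite) jet_geometry \<Rightarrow> ('m, 'n) adx \<Rightarrow> ('m, 'n) adx \<Rightarrow> ('m, 'n) adx \<Rightarrow> ('m, 'n) scalar"
  where
  "conn_coeff G (Tm a) (Tm b) \<gamma> z = comp_t G a b \<gamma> z"
| "conn_coeff G (Sp i) (Sp j) \<gamma> z = comp_x G i j \<gamma> z"
| "conn_coeff G (Mo i a) (Mo j b) \<gamma> z = kron i j * comp_t G a b \<gamma> z - kron b a * comp_x G j i \<gamma> z"
| "conn_coeff G \<delta> \<epsilon> \<gamma> z = 0"

locale adapted_geometry =
  fixes W :: "('m::finite, 'n::finite) jet set" and G :: "('m, 'n) jet_geometry"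
  assumes open_W: "open W"
    and smooth_nlc1: "smooth_on W (nlc1 G f r a)"
    and smooth_nlc2: "smooth_on W (nlc2 G f r i)"
begin

lemma smooth_nlc: "smooth_on W (nlc G r f \<alpha>)"
  by (cases \<alpha>) (auto simp: smooth_nlc1 smooth_nlc2 smooth_on_const)

text \<open>Isolates the dependence of a frame field on the point: scalar coefficients along
  constant vertical vectors. Smoothness and derivatives of the frame thus reduce to those of
  \<open>nlc\<close>, and brackets of frame fields come out vertical.\<close>

lemma frame_expand:
  "\<exists>c. frame G \<alpha> = (\<lambda>z. c - (\<Sum>r\<in>UNIV. \<Sum>f\<in>UNIV. nlc G r f \<alpha> z *\<^sub>R (0, 0, axis r (axis f 1))))"
proof -
  have *: "(\<Sum>r\<in>UNIV. \<Sum>f\<in>UNIV. g r f *\<^sub>R (0 :: real^'m, 0 :: real^'n, axis r (axis f 1))) =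
      (0, 0, \<chi> r f. g r f)" (is "?L = _") for g :: "'n \<Rightarrow> 'm \<Rightarrow> real"
  proof -
    have if_sum: "(\<Sum>x\<in>UNIV. if P then F x else 0) = (if P then \<Sum>x\<in>UNIV. F x else 0)"
      for P and F :: "'m \<Rightarrow> real" by simp
    have "snd (snd ?L) = (\<chi> r f. g r f)"
      by (simp add: snd_sum vec_eq_iff axis_def if_distrib[of "\<lambda>x. x $ _"] if_distrib[of "(*) _"]
          if_sum cong: if_cong)
    moreover have "fst ?L = 0" "fst (snd ?L) = 0"
      by (simp_all add: fst_sum snd_sum)
    ultimately show ?thesis unfolding prod_eq_iff by simp
  qed
  show ?thesis
  proof (cases \<alpha>)
    case (Tm a)
    then show ?thesis unfolding * by (intro exI[of _ "(axis a 1, 0, 0)"] ext) (simp add: vec_eq_iff)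
  next
    case (Sp i)
    then show ?thesis unfolding * by (intro exI[of _ "(0, axis i 1, 0)"] ext) (simp add: vec_eq_iff)
  next
    case (Mo i a)
    then show ?thesis unfolding * by (intro exI[of _ "(0, 0, axis i (axis a 1))"] ext) (simp add: vec_eq_iff)
  qed
qed

lemma smooth_frame: "smooth_on W (frame G \<alpha>)"
proof -
  obtain c where c: "frame G \<alpha> = (\<lambda>z. c - (\<Sum>r\<in>UNIV. \<Sum>f\<in>UNIV. nlc G r f \<alpha> z *\<^sub>R (0, 0, axis r (axis f 1))))"
    using frame_expand[of \<alpha>] by (elim exE)
  show ?thesis unfolding c
    by (intro smooth_on_diff smooth_on_const smooth_on_sum smooth_on_scaleR smooth_nlc open_W)
qed

lemma frechet_derivative_frame:
  assumes "z \<in> W"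
  shows "frechet_derivative (frame G \<alpha>) (at z) v =
    - (\<Sum>r\<in>UNIV. \<Sum>f\<in>UNIV. frechet_derivative (nlc G r f \<alpha>) (at z) v *\<^sub>R (0, 0, axis r (axis f 1)))"
proof -
  obtain c where c: "frame G \<alpha> = (\<lambda>z. c - (\<Sum>r\<in>UNIV. \<Sum>f\<in>UNIV. nlc G r f \<alpha> z *\<^sub>R (0, 0, axis r (axis f 1))))"
    using frame_expand[of \<alpha>] by (elim exE)
  have "(frame G \<alpha> has_derivative (\<lambda>v. 0 - (\<Sum>r\<in>UNIV. \<Sum>f\<in>UNIV.
      frechet_derivative (nlc G r f \<alpha>) (at z) v *\<^sub>R (0, 0, axis r (axis f 1))))) (at z)"
    unfolding c
    by (intro has_derivative_diff has_derivative_const has_derivative_sum has_derivative_scaleR_left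
        smooth_on_has_derivative[OF smooth_nlc assms])
  from frechet_derivative_at[OF this, symmetric] show ?thesis by simp
qed

lemma frame_commutator:
  assumes f: "smooth_on W f" and z: "z \<in> W"
  shows "vf_apply (frame G \<alpha>) (vf_apply (frame G \<beta>) f) z - vf_apply (frame G \<beta>) (vf_apply (frame G \<alpha>) f) z =
    (\<Sum>\<mu>\<in>UNIV. bracket_coeff G \<mu> \<alpha> \<beta> z * vf_apply (frame G \<mu>) f z)"
proof -
  note L = frechet_derivative_linear[OF f z]
  have "frechet_derivative (frame G \<beta>) (at z) (frame G \<alpha> z) - frechet_derivative (frame G \<alpha>) (at z) (frame G \<beta> z)
    = (\<Sum>r\<in>UNIV. \<Sum>f\<in>UNIV. bracket_coeff G (Mo r f) \<alpha> \<beta> z *\<^sub>R frame G (Mo r f) z)"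
    unfolding frechet_derivative_frame[OF z]
    by (simp add: vf_apply_def scaleR_diff_left sum_subtractf del: scaleR_Pair)
  then show ?thesis
    unfolding vf_apply_commutator[OF open_W z smooth_frame smooth_frame f]
    by (simp add: sum_adx linear_sum[OF L] linear_cmul[OF L] vf_apply_def
        del: frame.simps bracket_coeff.simps(1))
qed

lemma smooth_on_frame_apply: "smooth_on W f \<Longrightarrow> smooth_on W (vf_apply (frame G \<alpha>) f)"
  by (rule smooth_on_vf_apply[OF open_W smooth_frame])

lemma smooth_bracket_coeff: "smooth_on W (bracket_coeff G \<mu> \<alpha> \<beta>)"
proof (cases \<mu>)
  case (Mo r f)
  then show ?thesis
    by (auto simp: bracket_coeff.simps[abs_def] intro!: smooth_on_diff open_W smooth_on_frame_apply smooth_nlc)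
qed (auto simp: bracket_coeff.simps[abs_def] smooth_on_const)

lemma bracket_coeff_swap: "bracket_coeff G \<mu> \<alpha> \<beta> z = - bracket_coeff G \<mu> \<beta> \<alpha> z"
  by (cases \<mu>) auto

text \<open>For a momentum index this is the commutator formula applied to the coefficients of the
  nonlinear connection themselves: the second derivatives regroup, round the cycle, into one
  commutator for each of \<alpha>, \<beta>, \<gamma>.\<close>

lemma bracket_coeff_jacobi:
  assumes z: "z \<in> W"
  shows "cyc (\<lambda>\<alpha> \<beta> \<gamma>. vf_apply (frame G \<gamma>) (bracket_coeff G \<nu> \<alpha> \<beta>) z
    + (\<Sum>\<mu>\<in>UNIV. bracket_coeff G \<nu> \<gamma> \<mu> z * bracket_coeff G \<mu> \<alpha> \<beta> z)) \<alpha> \<beta> \<gamma> = 0"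
proof (cases \<nu>)
  case (Mo l d)
  let ?N = "nlc G l d"
  have comp: "bracket_coeff G \<nu> \<alpha> \<beta> =
      (\<lambda>z. vf_apply (frame G \<beta>) (?N \<alpha>) z - vf_apply (frame G \<alpha>) (?N \<beta>) z)" for \<alpha> \<beta>
    using Mo by (auto simp: bracket_coeff.simps[abs_def])
  have 1: "vf_apply (frame G \<gamma>) (bracket_coeff G \<nu> \<alpha> \<beta>) z =
      vf_apply (frame G \<gamma>) (vf_apply (frame G \<beta>) (?N \<alpha>)) z
      - vf_apply (frame G \<gamma>) (vf_apply (frame G \<alpha>) (?N \<beta>)) z" for \<alpha> \<beta> \<gamma>
    unfolding comp by (intro vf_apply_diff[OF _ _ z] smooth_on_frame_apply smooth_nlc)
  \<comment> \<open>Only vertical \<mu> contribute to the bracket of \<alpha> and \<beta>, and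
    \<open>nlc\<close> is zero there, so \<open>bracket_coeff G \<nu> \<gamma> \<mu>\<close> has
    just one of its two derivatives.\<close>
  have 2: "(\<Sum>\<mu>\<in>UNIV. bracket_coeff G \<nu> \<gamma> \<mu> z * bracket_coeff G \<mu> \<alpha> \<beta> z) =
      (\<Sum>\<mu>\<in>UNIV. bracket_coeff G \<mu> \<alpha> \<beta> z * vf_apply (frame G \<mu>) (?N \<gamma>) z)" for \<alpha> \<beta> \<gamma>
    unfolding comp by (simp add: sum_adx mult.commute del: frame.simps bracket_coeff.simps(1))
  show ?thesis
    unfolding cyc_def 1 2
    using frame_commutator[OF smooth_nlc z, of \<beta> \<gamma> l d \<alpha>]
      frame_commutator[OF smooth_nlc z, of \<gamma> \<alpha> l d \<beta>]
      frame_commutator[OF smooth_nlc z, of \<alpha> \<beta> l d \<gamma>] by linarith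
qed (auto simp: cyc_def bracket_coeff.simps[abs_def])

end


section \<open>The blocks of torsion and curvature\<close>

text \<open>Lets agreement of two index lists in kind be stated as an equality of
  \<open>map kind\<close>.\<close>

fun kind :: "('m, 'n) adx \<Rightarrow> nat" where
  "kind (Tm a) = 0"
| "kind (Sp i) = 1"
| "kind (Mo i a) = 2"

lemma sum_kron:
  fixes F :: "'i::finite \<Rightarrow> real"
  shows "(\<Sum>r\<in>UNIV. kron r i * F r) = F i" and "(\<Sum>r\<in>UNIV. kron i r * F r) = F i"
proof -
  have "kron r i * F r = (if r = i then F r else 0)" "kron i r * F r = (if r = i then F r else 0)"
    for r by (auto simp: kron_def)
  then show "(\<Sum>r\<in>UNIV. kron r i * F r) = F i" "(\<Sum>r\<in>UNIV. kron i r * F r) = F i"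
    by simp_all
qed

text \<open>The interface between the connection in one chart and the frame computation.
  \<open>comp_p_eq\<close> is the parallelism of J solved for the momentum components; the
  assumptions on \<open>chr\<close> record that it is symmetric and depends on t alone.\<close>

locale cartan_geometry = adapted_geometry W G
  for W :: "('m::finite, 'n::finite) jet set" and G :: "('m, 'n) jet_geometry" +
  assumes smooth_comp_t: "smooth_on W (comp_t G a b \<gamma>)"
    and smooth_comp_x: "smooth_on W (comp_x G i j \<gamma>)"
    and comp_t_Tm: "z \<in> W \<Longrightarrow> comp_t G a b (Tm c) z = chr G a b c z"
    and comp_t_Sp: "z \<in> W \<Longrightarrow> comp_t G a b (Sp i) z = 0"
    and comp_t_Mo: "z \<in> W \<Longrightarrow> comp_t G a b (Mo i c) z = 0"
    and comp_p_eq: "z \<in> W \<Longrightarrow>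
      comp_p G i a j b \<gamma> z = kron b a * comp_x G j i \<gamma> z - kron i j * comp_t G a b \<gamma> z"
    and chr_commute: "z \<in> W \<Longrightarrow> chr G a b c z = chr G a c b z"
    and chr_horizontal: "z \<in> W \<Longrightarrow> vf_apply (frame G (Sp i)) (chr G a b c) z = 0"
    and chr_vertical: "z \<in> W \<Longrightarrow> vf_apply (frame G (Mo i d)) (chr G a b c) z = 0"
    and H_commute: "z \<in> W \<Longrightarrow> comp_x G i j (Sp k) z = comp_x G i k (Sp j) z"
begin

section \<open>Block-diagonal coefficients and covariant differentiation\<close>

lemma conn_coeff_fun:
  "conn_coeff G (Tm a) (Tm b) \<gamma> = comp_t G a b \<gamma>"
  "conn_coeff G (Sp i) (Sp j) \<gamma> = comp_x G i j \<gamma>"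
  "conn_coeff G (Mo i a) (Mo j b) \<gamma> = (\<lambda>z. kron i j * comp_t G a b \<gamma> z - kron b a * comp_x G j i \<gamma> z)"
  by auto

lemma conn_coeff_off_diagonal:
  "kind \<delta> \<noteq> kind \<epsilon> \<Longrightarrow> conn_coeff G \<delta> \<epsilon> \<gamma> = (\<lambda>z. 0)"
  by (cases \<delta>; cases \<epsilon>) auto

lemma smooth_conn_coeff: "smooth_on W (conn_coeff G \<delta> \<epsilon> \<gamma>)"
proof (cases "kind \<delta> = kind \<epsilon>")
  case True
  then show ?thesis
    by (cases \<delta>; cases \<epsilon>)
      (auto simp: conn_coeff_fun intro!: smooth_comp_t smooth_comp_x smooth_on_diff smooth_on_mult
        smooth_on_const open_W)
qed (simp add: conn_coeff_off_diagonal smooth_on_const)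

sublocale frame: moving_frame W "smooth_on W" "\<lambda>\<alpha>. vf_apply (frame G \<alpha>)" "bracket_coeff G" "conn_coeff G"
  by unfold_locales
    (auto intro!: smooth_on_add smooth_on_diff smooth_on_mult smooth_on_sum open_W smooth_on_frame_apply
      smooth_bracket_coeff smooth_conn_coeff vf_apply_add[of W] vf_apply_diff[of W] vf_apply_mult[of W]
      vf_apply_sum[of _ W] frame_commutator bracket_coeff_jacobi bracket_coeff_swap)

text \<open>Unlike \<open>torR\<close> and its companions, \<open>tor\<close> and \<open>cur\<close>
  are meaningful for indices of all kinds at once. They have the type of d-tensors so that
  \<open>cov\<close> applies to them.\<close>

definition tor :: "('m, 'n) dtensor" where
  "tor us ls = frame.torsion (us ! 0) (ls ! 0) (ls ! 1)"

definition cur :: "('m, 'n) dtensor" where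
  "cur us ls = frame.curvature (us ! 0) (ls ! 0) (ls ! 1) (ls ! 2)"

lemma cur_swap: "cur [\<delta>] [\<epsilon>, \<beta>, \<alpha>] z = - cur [\<delta>] [\<epsilon>, \<alpha>, \<beta>] z"
  by (simp add: cur_def frame.curvature_swap[of \<delta> \<epsilon> \<beta>])

text \<open>For a bracketed pair the reversed signs in \<open>cov\<close> compensate the sign
  convention of \<open>comp_p\<close>, and \<open>conn_coeff\<close> is zero between different
  kinds. The case distinction therefore collapses to one formula.\<close>

lemma cov_expand:
  assumes z: "z \<in> W"
  shows "cov G T us ls \<gamma> z = vf_apply (frame G \<gamma>) (T us ls) z
    + (\<Sum>q<length us. \<Sum>\<mu>\<in>UNIV. T (us[q := \<mu>]) ls z * conn_coeff G (us ! q) \<mu> \<gamma> z)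
    - (\<Sum>q<length ls. \<Sum>\<mu>\<in>UNIV. T us (ls[q := \<mu>]) z * conn_coeff G \<mu> (ls ! q) \<gamma> z)"
proof -
  have u: "(case us ! q of
          Tm a \<Rightarrow> (\<Sum>f\<in>UNIV. T (us[q := Tm f]) ls z * comp_t G a f \<gamma> z)
        | Sp i \<Rightarrow> (\<Sum>r\<in>UNIV. T (us[q := Sp r]) ls z * comp_x G i r \<gamma> z)
        | Mo l d \<Rightarrow> - (\<Sum>r\<in>UNIV. \<Sum>f\<in>UNIV. T (us[q := Mo r f]) ls z * comp_p G l d r f \<gamma> z))
      = (\<Sum>\<mu>\<in>UNIV. T (us[q := \<mu>]) ls z * conn_coeff G (us ! q) \<mu> \<gamma> z)" for q
    by (cases "us ! q") (simp_all add: sum_adx comp_p_eq[OF z] algebra_simps sum_subtractf)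
  have l: "(case ls ! q of
          Tm c \<Rightarrow> - (\<Sum>f\<in>UNIV. T us (ls[q := Tm f]) z * comp_t G f c \<gamma> z)
        | Sp j \<Rightarrow> - (\<Sum>r\<in>UNIV. T us (ls[q := Sp r]) z * comp_x G r j \<gamma> z)
        | Mo k b \<Rightarrow> (\<Sum>r\<in>UNIV. \<Sum>f\<in>UNIV. T us (ls[q := Mo r f]) z * comp_p G r f k b \<gamma> z))
      = - (\<Sum>\<mu>\<in>UNIV. T us (ls[q := \<mu>]) z * conn_coeff G \<mu> (ls ! q) \<gamma> z)" for q
    by (cases "ls ! q") (simp_all add: sum_adx comp_p_eq[OF z] algebra_simps sum_subtractf)
  show ?thesis unfolding cov_def u l by (simp add: sum_negf)
qed

text \<open>Replacing an index by one of another kind meets a zero coefficient, so only index lists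
  of the given kinds enter. This allows a d-tensor, specified only on such lists, to be exchanged
  for a block of \<open>tor\<close> or \<open>cur\<close>. Agreement is required on all of W because
  the components are also differentiated.\<close>

lemma cov_cong:
  assumes z: "z \<in> W"
    and "\<And>us' ls' w. map kind us' = map kind us \<Longrightarrow> map kind ls' = map kind ls \<Longrightarrow> w \<in> W \<Longrightarrow>
      T us' ls' w = T' us' ls' w"
  shows "cov G T us ls \<gamma> z = cov G T' us ls \<gamma> z"
proof -
  have u: "T (us[q := \<mu>]) ls z * conn_coeff G (us ! q) \<mu> \<gamma> z =
      T' (us[q := \<mu>]) ls z * conn_coeff G (us ! q) \<mu> \<gamma> z" if "q < length us" for q \<mu>
  proof (cases "kind \<mu> = kind (us ! q)")
    case True
    then have "map kind (us[q := \<mu>]) = map kind us"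
      using that by (simp add: map_update list_update_same_conv)
    then show ?thesis using assms by simp
  next
    case False
    then have "conn_coeff G (us ! q) \<mu> \<gamma> z = 0"
      by (subst conn_coeff_off_diagonal) auto
    then show ?thesis by simp
  qed
  have l: "T us (ls[q := \<mu>]) z * conn_coeff G \<mu> (ls ! q) \<gamma> z =
      T' us (ls[q := \<mu>]) z * conn_coeff G \<mu> (ls ! q) \<gamma> z" if "q < length ls" for q \<mu>
  proof (cases "kind \<mu> = kind (ls ! q)")
    case True
    then have "map kind (ls[q := \<mu>]) = map kind ls"
      using that by (simp add: map_update list_update_same_conv)
    then show ?thesis using assms by simp
  next
    case False
    then have "conn_coeff G \<mu> (ls ! q) \<gamma> z = 0"
      by (subst conn_coeff_off_diagonal) auto
    then show ?thesis by simp
  qed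
  have d: "vf_apply (frame G \<gamma>) (T us ls) z = vf_apply (frame G \<gamma>) (T' us ls) z"
    using assms by (intro vf_apply_cong[OF open_W z]) auto
  show ?thesis
    unfolding cov_expand[OF z] d
    by (intro arg_cong2[of _ _ _ _ minus] arg_cong2[of _ _ _ _ plus] sum.cong refl u l) auto
qed

lemma cov_zero:
  assumes "z \<in> W"
    and "\<And>us' ls' w. map kind us' = map kind us \<Longrightarrow> map kind ls' = map kind ls \<Longrightarrow> w \<in> W \<Longrightarrow>
      T us' ls' w = 0"
  shows "cov G T us ls \<gamma> z = 0"
proof -
  have "cov G T us ls \<gamma> z = cov G (\<lambda>us ls z. 0) us ls \<gamma> z"
    using assms by (intro cov_cong) auto
  then show ?thesis by (simp add: cov_expand[OF assms(1)])
qed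

lemma cov_tor:
  assumes z: "z \<in> W"
  shows "cov G tor [\<delta>] [\<alpha>, \<beta>] \<gamma> z = vf_apply (frame G \<gamma>) (frame.torsion \<delta> \<alpha> \<beta>) z
    + (\<Sum>\<mu>\<in>UNIV. frame.torsion \<mu> \<alpha> \<beta> z * conn_coeff G \<delta> \<mu> \<gamma> z)
    - (\<Sum>\<mu>\<in>UNIV. frame.torsion \<delta> \<mu> \<beta> z * conn_coeff G \<mu> \<alpha> \<gamma> z)
    - (\<Sum>\<mu>\<in>UNIV. frame.torsion \<delta> \<alpha> \<mu> z * conn_coeff G \<mu> \<beta> \<gamma> z)"
  by (simp add: cov_expand[OF z] tor_def lessThan_Suc numeral_2_eq_2)

lemma cov_cur:
  assumes z: "z \<in> W"
  shows "cov G cur [\<delta>] [\<epsilon>, \<alpha>, \<beta>] \<gamma> z = vf_apply (frame G \<gamma>) (frame.curvature \<delta> \<epsilon> \<alpha> \<beta>) z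
    + (\<Sum>\<mu>\<in>UNIV. frame.curvature \<mu> \<epsilon> \<alpha> \<beta> z * conn_coeff G \<delta> \<mu> \<gamma> z)
    - (\<Sum>\<mu>\<in>UNIV. frame.curvature \<delta> \<mu> \<alpha> \<beta> z * conn_coeff G \<mu> \<epsilon> \<gamma> z)
    - (\<Sum>\<mu>\<in>UNIV. frame.curvature \<delta> \<epsilon> \<mu> \<beta> z * conn_coeff G \<mu> \<alpha> \<gamma> z)
    - (\<Sum>\<mu>\<in>UNIV. frame.curvature \<delta> \<epsilon> \<alpha> \<mu> z * conn_coeff G \<mu> \<beta> \<gamma> z)"
  by (simp add: cov_expand[OF z] cur_def lessThan_Suc numeral_3_eq_3 numeral_2_eq_2)

lemma cov_tor_swap:
  assumes z: "z \<in> W"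
  shows "cov G tor [\<delta>] [\<beta>, \<alpha>] \<gamma> z = - cov G tor [\<delta>] [\<alpha>, \<beta>] \<gamma> z"
proof -
  have "frame.torsion \<delta> \<beta> \<alpha> = (\<lambda>z. - frame.torsion \<delta> \<alpha> \<beta> z)"
    using frame.torsion_swap by blast
  then show ?thesis unfolding cov_tor[OF z]
    by (simp add: frame.torsion_swap[of _ \<beta>] frame.torsion_swap[of _ _ \<alpha>] vf_apply_minus[OF frame.smooth_torsion z] sum_negf)
qed

lemma cov_cur_swap:
  assumes z: "z \<in> W"
  shows "cov G cur [\<delta>] [\<epsilon>, \<beta>, \<alpha>] \<gamma> z = - cov G cur [\<delta>] [\<epsilon>, \<alpha>, \<beta>] \<gamma> z"
proof -
  have "frame.curvature \<delta> \<epsilon> \<beta> \<alpha> = (\<lambda>z. - frame.curvature \<delta> \<epsilon> \<alpha> \<beta> z)"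
    using frame.curvature_swap by blast
  then show ?thesis unfolding cov_cur[OF z]
    by (simp add: frame.curvature_swap[of _ _ \<beta>] frame.curvature_swap[of _ _ _ \<alpha>] vf_apply_minus[OF frame.smooth_curvature z] sum_negf)
qed

lemma cov_first_bianchi:
  assumes z: "z \<in> W"
  shows "cyc (\<lambda>\<alpha> \<beta> \<gamma>. cov G tor [\<delta>] [\<alpha>, \<beta>] \<gamma> z
    + (\<Sum>\<mu>\<in>UNIV. tor [\<delta>] [\<gamma>, \<mu>] z * tor [\<mu>] [\<alpha>, \<beta>] z) - cur [\<delta>] [\<alpha>, \<beta>, \<gamma>] z) \<alpha> \<beta> \<gamma> = 0"
  using frame.first_bianchi[OF z, of \<delta> \<alpha> \<beta> \<gamma>] unfolding cov_tor[OF z] by (simp add: tor_def cur_def)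

lemma cov_second_bianchi:
  assumes z: "z \<in> W"
  shows "cyc (\<lambda>\<alpha> \<beta> \<gamma>. cov G cur [\<delta>] [\<epsilon>, \<alpha>, \<beta>] \<gamma> z
    + (\<Sum>\<mu>\<in>UNIV. cur [\<delta>] [\<epsilon>, \<gamma>, \<mu>] z * tor [\<mu>] [\<alpha>, \<beta>] z)) \<alpha> \<beta> \<gamma> = 0"
  using frame.second_bianchi[OF z, of \<delta> \<epsilon> \<alpha> \<beta> \<gamma>] unfolding cov_cur[OF z] by (simp add: tor_def cur_def)

section \<open>Identification of the blocks with the d-tensors\<close>

lemma bracket_coeff_torR:
  "bracket_coeff G (Mo r f) (Tm a) (Tm b) z = torR G [Mo r f] [Tm a, Tm b] z"
  "bracket_coeff G (Mo r f) (Tm a) (Sp j) z = torR G [Mo r f] [Tm a, Sp j] z"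
  "bracket_coeff G (Mo r f) (Sp i) (Sp j) z = torR G [Mo r f] [Sp i, Sp j] z"
  by simp_all

text \<open>Temporal components vanish since brackets are vertical and \<open>chr\<close> is
  symmetric, and the component on two spatial directions vanishes by \<open>H_commute\<close>. In a
  mixed block at most one of the two coefficients survives, which gives \<open>torT\<close>, the
  C-components and, together with a bracket, \<open>torP\<close>.\<close>

lemma tor_simps:
  assumes "z \<in> W"
  shows "tor [Tm c] [\<alpha>, \<beta>] z = 0"
    and "tor [Sp l] [Tm a, Tm b] z = 0"
    and "tor [Sp l] [Tm a, Sp k] z = torT G [Sp l] [Tm a, Sp k] z"
    and "tor [Sp l] [Sp k, Tm a] z = - torT G [Sp l] [Tm a, Sp k] z"
    and "tor [Sp l] [Tm a, Mo k b] z = 0"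
    and "tor [Sp l] [Mo k b, Tm a] z = 0"
    and "tor [Sp l] [Sp i, Sp j] z = 0"
    and "tor [Sp l] [Sp i, Mo k c] z = C_tensor G [Sp l] [Sp i, Mo k c] z"
    and "tor [Sp l] [Mo k c, Sp i] z = - C_tensor G [Sp l] [Sp i, Mo k c] z"
    and "tor [Sp l] [Mo j b, Mo k c] z = 0"
    and "tor [Mo r f] [Tm a, Tm b] z = torR G [Mo r f] [Tm a, Tm b] z"
    and "tor [Mo r f] [Tm a, Sp j] z = torR G [Mo r f] [Tm a, Sp j] z"
    and "tor [Mo r f] [Sp j, Tm a] z = - torR G [Mo r f] [Tm a, Sp j] z"
    and "tor [Mo r f] [Sp i, Sp j] z = torR G [Mo r f] [Sp i, Sp j] z"
    and "tor [Mo r f] [Tm a, Mo j b] z = torP G [Mo r f] [Tm a, Mo j b] z"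
    and "tor [Mo r f] [Mo j b, Tm a] z = - torP G [Mo r f] [Tm a, Mo j b] z"
    and "tor [Mo r f] [Sp i, Mo j b] z = torP G [Mo r f] [Sp i, Mo j b] z"
    and "tor [Mo r f] [Mo j b, Sp i] z = - torP G [Mo r f] [Sp i, Mo j b] z"
    and "tor [Mo r f] [Mo i a, Mo j b] z = torS G [Mo r f] [Mo i a, Mo j b] z"
proof -
  show "tor [Tm c] [\<alpha>, \<beta>] z = 0"
    using assms by (cases \<alpha>; cases \<beta>)
      (auto simp: tor_def frame.torsion_def comp_t_Tm comp_t_Sp comp_t_Mo intro: chr_commute)
qed (use assms in \<open>simp_all add: tor_def frame.torsion_def A_comp_def C_comp_def H_comp_def
      comp_t_Tm comp_t_Sp comp_t_Mo H_commute[of z l i j] kron_def\<close>)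

text \<open>In a product of two coefficients the intermediate index cannot match both kinds.
  Consequently a curvature term of the first identity survives only if its first lower index has the
  kind of the upper one.\<close>

lemma cur_off_diagonal:
  assumes "kind \<delta> \<noteq> kind \<epsilon>"
  shows "cur [\<delta>] [\<epsilon>, \<alpha>, \<beta>] z = 0"
proof -
  have *: "conn_coeff G \<eta> \<epsilon> \<alpha> z * conn_coeff G \<delta> \<eta> \<beta> z = 0" for \<eta> \<alpha> \<beta>
    using assms by (cases "kind \<eta> = kind \<epsilon>") (simp_all add: conn_coeff_off_diagonal)
  then show ?thesis
    using assms by (simp add: cur_def frame.curvature_def conn_coeff_off_diagonal * del: mult_eq_0_iff)
qed

text \<open>The temporal block carries the Levi-Civita connection of h: its coefficients are zero in
  non-temporal directions and constant along them. The bracket term drops out because brackets are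
  vertical.\<close>

lemma cur_Tm:
  assumes z: "z \<in> W"
  shows "cur [Tm d] [Tm e, Tm a, Tm b] z = curvX G [Tm d] [Tm e, Tm a, Tm b] z"
    and "kind \<alpha> \<noteq> 0 \<or> kind \<beta> \<noteq> 0 \<Longrightarrow> cur [Tm d] [Tm e, \<alpha>, \<beta>] z = 0"
proof -
  have D: "vf_apply (frame G \<beta>) (comp_t G d e (Tm a)) z = vf_apply (frame G \<beta>) (chr G d e a) z"
    "vf_apply (frame G \<beta>) (comp_t G d e (Sp i)) z = 0"
    "vf_apply (frame G \<beta>) (comp_t G d e (Mo i a)) z = 0" for \<beta> d e a i
    using vf_apply_cong[OF open_W z comp_t_Tm] vf_apply_cong[OF open_W z comp_t_Sp]
      vf_apply_cong[OF open_W z comp_t_Mo] by simp_all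
  show "cur [Tm d] [Tm e, Tm a, Tm b] z = curvX G [Tm d] [Tm e, Tm a, Tm b] z"
    by (simp add: cur_def frame.curvature_def sum_adx conn_coeff_fun D comp_t_Tm[OF z]
        comp_t_Sp[OF z] comp_t_Mo[OF z] del: frame.simps bracket_coeff.simps(1))
  show "cur [Tm d] [Tm e, \<alpha>, \<beta>] z = 0" if "kind \<alpha> \<noteq> 0 \<or> kind \<beta> \<noteq> 0"
    using that chr_horizontal[OF z] chr_vertical[OF z]
    by (cases \<alpha>; cases \<beta>)
      (simp_all add: cur_def frame.curvature_def sum_adx conn_coeff_fun D comp_t_Tm[OF z]
        comp_t_Sp[OF z] comp_t_Mo[OF z] del: frame.simps bracket_coeff.simps(1))
qed

lemma C_cov:
  assumes z: "z \<in> W"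
  shows "cov G (C_tensor G) [Sp l] [Sp i, Mo k c] \<gamma> z = vf_apply (frame G \<gamma>) (C_comp G l i k c) z
    + (\<Sum>r\<in>UNIV. C_comp G r i k c z * comp_x G l r \<gamma> z)
    - (\<Sum>r\<in>UNIV. C_comp G l r k c z * comp_x G r i \<gamma> z)
    - (\<Sum>r\<in>UNIV. \<Sum>f\<in>UNIV. C_comp G l i r f z * conn_coeff G (Mo r f) (Mo k c) \<gamma> z)"
proof -
  have "C_tensor G [Sp l] [Sp i, Mo k c] = C_comp G l i k c" by auto
  then show ?thesis
    by (simp add: cov_expand[OF z] lessThan_Suc numeral_2_eq_2 sum_adx del: frame.simps conn_coeff.simps(3))
qed

text \<open>For the R-blocks the bracket coefficients are \<open>torR\<close>; for the S-block the
  bracket is zero. In \<open>curvP\<close> the momentum index of C contributes a connection term to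
  the covariant derivative, and this cancels the connection part of \<open>torP\<close>; the bracket
  coefficient that remains is the one in the frame curvature.\<close>

lemma cur_Sp:
  assumes z: "z \<in> W"
  shows "cur [Sp l] [Sp i, Tm b, Tm c] z = curvR G [Sp l] [Sp i, Tm b, Tm c] z"
    and "cur [Sp l] [Sp i, Tm b, Sp k] z = curvR G [Sp l] [Sp i, Tm b, Sp k] z"
    and "cur [Sp l] [Sp i, Sp k, Tm b] z = - curvR G [Sp l] [Sp i, Tm b, Sp k] z"
    and "cur [Sp l] [Sp i, Sp j, Sp k] z = curvR G [Sp l] [Sp i, Sp j, Sp k] z"
    and "cur [Sp l] [Sp i, Tm b, Mo k c] z = curvP G [Sp l] [Sp i, Tm b, Mo k c] z"
    and "cur [Sp l] [Sp i, Mo k c, Tm b] z = - curvP G [Sp l] [Sp i, Tm b, Mo k c] z"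
    and "cur [Sp l] [Sp i, Sp j, Mo k c] z = curvP G [Sp l] [Sp i, Sp j, Mo k c] z"
    and "cur [Sp l] [Sp i, Mo k c, Sp j] z = - curvP G [Sp l] [Sp i, Sp j, Mo k c] z"
    and "cur [Sp l] [Sp i, Mo j b, Mo k c] z = curvS G [Sp l] [Sp i, Mo j b, Mo k c] z"
proof -
  note expand = cur_def frame.curvature_def sum_adx conn_coeff_fun
    A_comp_def[symmetric] H_comp_def[symmetric] C_comp_def[symmetric]
  show R1: "cur [Sp l] [Sp i, Tm b, Tm c] z = curvR G [Sp l] [Sp i, Tm b, Tm c] z"
    by (simp add: expand bracket_coeff_torR del: frame.simps bracket_coeff.simps(1) torR.simps)
  show R2: "cur [Sp l] [Sp i, Tm b, Sp k] z = curvR G [Sp l] [Sp i, Tm b, Sp k] z"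
    by (simp add: expand bracket_coeff_torR del: frame.simps bracket_coeff.simps(1) torR.simps)
  then show "cur [Sp l] [Sp i, Sp k, Tm b] z = - curvR G [Sp l] [Sp i, Tm b, Sp k] z"
    by (simp only: cur_swap[of _ _ "Sp k"])
  show R3: "cur [Sp l] [Sp i, Sp j, Sp k] z = curvR G [Sp l] [Sp i, Sp j, Sp k] z"
    by (simp add: expand bracket_coeff_torR del: frame.simps bracket_coeff.simps(1) torR.simps)
  show P1: "cur [Sp l] [Sp i, Tm b, Mo k c] z = curvP G [Sp l] [Sp i, Tm b, Mo k c] z"
    by (simp add: expand C_cov[OF z] comp_t_Tm[OF z] sum.distrib sum_subtractf algebra_simps
        del: frame.simps)
  then show "cur [Sp l] [Sp i, Mo k c, Tm b] z = - curvP G [Sp l] [Sp i, Tm b, Mo k c] z"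
    by (simp only: cur_swap[of _ _ "Mo k c"])
  show P2: "cur [Sp l] [Sp i, Sp j, Mo k c] z = curvP G [Sp l] [Sp i, Sp j, Mo k c] z"
    by (simp add: expand C_cov[OF z] comp_t_Sp[OF z] sum.distrib sum_subtractf sum_negf algebra_simps
        del: frame.simps)
  then show "cur [Sp l] [Sp i, Mo k c, Sp j] z = - curvP G [Sp l] [Sp i, Sp j, Mo k c] z"
    by (simp only: cur_swap[of _ _ "Mo k c" "Sp j"])
  show "cur [Sp l] [Sp i, Mo j b, Mo k c] z = curvS G [Sp l] [Sp i, Mo j b, Mo k c] z"
    by (simp add: expand del: frame.simps)
qed

text \<open>Curvature of a tensor product with a dual: temporal curvature minus transposed spatial
  curvature. Its value is the negative of \<open>vcurvR\<close>, \<open>vcurvP\<close> and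
  \<open>vcurvS\<close>.\<close>

lemma cur_Mo:
  assumes z: "z \<in> W"
  shows "cur [Mo l d] [Mo i a, \<alpha>, \<beta>] z =
    kron l i * cur [Tm d] [Tm a, \<alpha>, \<beta>] z - kron a d * cur [Sp i] [Sp l, \<alpha>, \<beta>] z"
proof -
  have D: "vf_apply (frame G \<beta>) (\<lambda>z. kron l i * comp_t G d a \<alpha> z - kron a d * comp_x G i l \<alpha> z) z =
      kron l i * vf_apply (frame G \<beta>) (comp_t G d a \<alpha>) z - kron a d * vf_apply (frame G \<beta>) (comp_x G i l \<alpha>) z"
    for \<alpha> \<beta>
    by (simp add: vf_apply_diff[OF _ _ z] vf_apply_mult[OF _ _ z] smooth_on_mult open_W smooth_on_const
        smooth_comp_t smooth_comp_x)
  \<comment> \<open>The two mixed products are together symmetric in \<alpha> and \<beta> and drop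
    out of the curvature. The spatial products appear in reversed order, which turns their
    commutator into its negative.\<close>
  have Q: "(\<Sum>\<eta>\<in>UNIV. conn_coeff G \<eta> (Mo i a) \<alpha> z * conn_coeff G (Mo l d) \<eta> \<beta> z) =
      kron l i * (\<Sum>f\<in>UNIV. comp_t G f a \<alpha> z * comp_t G d f \<beta> z)
      + kron a d * (\<Sum>r\<in>UNIV. comp_x G i r \<alpha> z * comp_x G r l \<beta> z)
      - comp_x G i l \<alpha> z * comp_t G d a \<beta> z - comp_t G d a \<alpha> z * comp_x G i l \<beta> z" for \<alpha> \<beta>
  proof -
    have "(\<Sum>\<eta>\<in>UNIV. conn_coeff G \<eta> (Mo i a) \<alpha> z * conn_coeff G (Mo l d) \<eta> \<beta> z) =
      (\<Sum>r\<in>UNIV. \<Sum>f\<in>UNIV. kron r i * (kron l r * (comp_t G f a \<alpha> z * comp_t G d f \<beta> z))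
        - kron r i * (kron f d * (comp_t G f a \<alpha> z * comp_x G r l \<beta> z))
        - kron l r * (kron a f * (comp_x G i r \<alpha> z * comp_t G d f \<beta> z))
        + kron a f * (kron f d * (comp_x G i r \<alpha> z * comp_x G r l \<beta> z)))"
      by (simp add: sum_adx algebra_simps)
    also have "\<dots> = kron l i * (\<Sum>f\<in>UNIV. comp_t G f a \<alpha> z * comp_t G d f \<beta> z)
      + kron a d * (\<Sum>r\<in>UNIV. comp_x G i r \<alpha> z * comp_x G r l \<beta> z)
      - comp_x G i l \<alpha> z * comp_t G d a \<beta> z - comp_t G d a \<alpha> z * comp_x G i l \<beta> z"
      by (simp add: sum.distrib sum_subtractf sum_distrib_left[symmetric] sum_kron)
    finally show ?thesis .
  qed
  show ?thesis
    unfolding cur_def frame.curvature_def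
    by (simp add: conn_coeff_fun D sum_subtractf Q sum_adx algebra_simps sum_distrib_left sum.distrib 
       del: frame.simps bracket_coeff.simps(1))
qed

end

text \<open>From here on these d-tensors stay opaque and only the block rules act on them.
  \<open>vcurvR\<close>, \<open>vcurvP\<close> and \<open>vcurvS\<close> still unfold, so that they
  meet the right side of \<open>cur_Mo\<close>.\<close>

declare torT.simps [simp del] torR.simps [simp del] torP.simps [simp del] torS.simps [simp del]
  C_tensor.simps [simp del] curvX.simps [simp del] curvR.simps [simp del] curvP.simps [simp del]
  curvS.simps [simp del]

lemma kind_iff:
  "kind \<alpha> = 0 \<longleftrightarrow> (\<exists>a. \<alpha> = Tm a)"
  "kind \<alpha> = Suc 0 \<longleftrightarrow> (\<exists>i. \<alpha> = Sp i)"
  "kind \<alpha> = 2 \<longleftrightarrow> (\<exists>i a. \<alpha> = Mo i a)"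
  by (cases \<alpha>; simp)+

context cartan_geometry
begin

lemma cov_tor_simps:
  assumes z: "z \<in> W"
  shows "cov G tor [Tm c] [\<alpha>, \<beta>] \<gamma> z = 0"
    and "cov G tor [Sp l] [Tm a, Tm b] \<gamma> z = 0"
    and "cov G tor [Sp l] [Tm a, Sp k] \<gamma> z = cov G (torT G) [Sp l] [Tm a, Sp k] \<gamma> z"
    and "cov G tor [Sp l] [Sp k, Tm a] \<gamma> z = - cov G (torT G) [Sp l] [Tm a, Sp k] \<gamma> z"
    and "cov G tor [Sp l] [Tm a, Mo k b] \<gamma> z = 0"
    and "cov G tor [Sp l] [Mo k b, Tm a] \<gamma> z = 0"
    and "cov G tor [Sp l] [Sp i, Sp j] \<gamma> z = 0"
    and "cov G tor [Sp l] [Sp i, Mo k c] \<gamma> z = cov G (C_tensor G) [Sp l] [Sp i, Mo k c] \<gamma> z"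
    and "cov G tor [Sp l] [Mo k c, Sp i] \<gamma> z = - cov G (C_tensor G) [Sp l] [Sp i, Mo k c] \<gamma> z"
    and "cov G tor [Sp l] [Mo j b, Mo k c] \<gamma> z = 0"
    and "cov G tor [Mo r f] [Tm a, Tm b] \<gamma> z = cov G (torR G) [Mo r f] [Tm a, Tm b] \<gamma> z"
    and "cov G tor [Mo r f] [Tm a, Sp j] \<gamma> z = cov G (torR G) [Mo r f] [Tm a, Sp j] \<gamma> z"
    and "cov G tor [Mo r f] [Sp j, Tm a] \<gamma> z = - cov G (torR G) [Mo r f] [Tm a, Sp j] \<gamma> z"
    and "cov G tor [Mo r f] [Sp i, Sp j] \<gamma> z = cov G (torR G) [Mo r f] [Sp i, Sp j] \<gamma> z"
    and "cov G tor [Mo r f] [Tm a, Mo j b] \<gamma> z = cov G (torP G) [Mo r f] [Tm a, Mo j b] \<gamma> z"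
    and "cov G tor [Mo r f] [Mo j b, Tm a] \<gamma> z = - cov G (torP G) [Mo r f] [Tm a, Mo j b] \<gamma> z"
    and "cov G tor [Mo r f] [Sp i, Mo j b] \<gamma> z = cov G (torP G) [Mo r f] [Sp i, Mo j b] \<gamma> z"
    and "cov G tor [Mo r f] [Mo j b, Sp i] \<gamma> z = - cov G (torP G) [Mo r f] [Sp i, Mo j b] \<gamma> z"
    and "cov G tor [Mo r f] [Mo i a, Mo j b] \<gamma> z = cov G (torS G) [Mo r f] [Mo i a, Mo j b] \<gamma> z"
  \<comment> \<open>A goal with a minus sign has its lower indices in the order opposite to that of
    the d-tensor, and antisymmetry restores the order. Otherwise the block is compared
    directly.\<close>
  by (subst cov_tor_swap[OF z], simp,
      rule cov_cong[OF z] cov_zero[OF z], force simp: map_eq_Cons_conv kind_iff tor_simps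
    | rule cov_cong[OF z] cov_zero[OF z], force simp: map_eq_Cons_conv kind_iff tor_simps)+

lemma cov_cur_simps:
  assumes z: "z \<in> W"
  shows "cov G cur [Tm d] [Tm e, Tm a, Tm b] \<gamma> z = cov G (curvX G) [Tm d] [Tm e, Tm a, Tm b] \<gamma> z"
    and "kind \<alpha> \<noteq> 0 \<or> kind \<beta> \<noteq> 0 \<Longrightarrow> cov G cur [Tm d] [Tm e, \<alpha>, \<beta>] \<gamma> z = 0"
    and "cov G cur [Sp l] [Sp i, Tm b, Tm c] \<gamma> z = cov G (curvR G) [Sp l] [Sp i, Tm b, Tm c] \<gamma> z"
    and "cov G cur [Sp l] [Sp i, Tm b, Sp k] \<gamma> z = cov G (curvR G) [Sp l] [Sp i, Tm b, Sp k] \<gamma> z"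
    and "cov G cur [Sp l] [Sp i, Sp k, Tm b] \<gamma> z = - cov G (curvR G) [Sp l] [Sp i, Tm b, Sp k] \<gamma> z"
    and "cov G cur [Sp l] [Sp i, Sp j, Sp k] \<gamma> z = cov G (curvR G) [Sp l] [Sp i, Sp j, Sp k] \<gamma> z"
    and "cov G cur [Sp l] [Sp i, Tm b, Mo k c] \<gamma> z = cov G (curvP G) [Sp l] [Sp i, Tm b, Mo k c] \<gamma> z"
    and "cov G cur [Sp l] [Sp i, Mo k c, Tm b] \<gamma> z = - cov G (curvP G) [Sp l] [Sp i, Tm b, Mo k c] \<gamma> z"
    and "cov G cur [Sp l] [Sp i, Sp j, Mo k c] \<gamma> z = cov G (curvP G) [Sp l] [Sp i, Sp j, Mo k c] \<gamma> z"
    and "cov G cur [Sp l] [Sp i, Mo k c, Sp j] \<gamma> z = - cov G (curvP G) [Sp l] [Sp i, Sp j, Mo k c] \<gamma> z"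
    and "cov G cur [Sp l] [Sp i, Mo j b, Mo k c] \<gamma> z = cov G (curvS G) [Sp l] [Sp i, Mo j b, Mo k c] \<gamma> z"
proof -
  show "kind \<alpha> \<noteq> 0 \<or> kind \<beta> \<noteq> 0 \<Longrightarrow> cov G cur [Tm d] [Tm e, \<alpha>, \<beta>] \<gamma> z = 0"
    by (cases \<alpha>; cases \<beta>)
      (auto intro!: cov_zero[OF z] simp: map_eq_Cons_conv kind_iff cur_Tm(2))
qed (subst cov_cur_swap[OF z], simp,
      rule cov_cong[OF z], force simp: map_eq_Cons_conv kind_iff cur_Tm cur_Sp
    | rule cov_cong[OF z], force simp: map_eq_Cons_conv kind_iff cur_Tm cur_Sp)+

lemmas first_bianchi_expanded = cov_first_bianchi[unfolded cyc_def sum_adx]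
lemmas second_bianchi_expanded = cov_second_bianchi[unfolded cyc_def sum_adx]

end

section \<open>The geometry of a Cartan type connection in a chart\<close>

text \<open>Serves to show that \<open>chr\<close>, which depends on t alone, is annihilated by the
  frame fields without temporal part.\<close>

lemma frechet_derivative_constant_direction:
  assumes "f differentiable (at z)" and "\<And>s. f (z + s *\<^sub>R v) = f z"
  shows "frechet_derivative f (at z) v = 0"
proof -
  have line: "((\<lambda>s::real. z + s *\<^sub>R v) has_derivative (\<lambda>s. s *\<^sub>R v)) (at 0)"
    by (auto intro!: derivative_eq_intros)
  have "(f has_derivative frechet_derivative f (at z)) (at (z + 0 *\<^sub>R v))"
    using frechet_derivative_worksI[OF assms(1)] by simp
  from has_derivative_compose[OF line this]
  have "((\<lambda>s::real. f z) has_derivative (\<lambda>s. frechet_derivative f (at z) (s *\<^sub>R v))) (at 0)"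
    by (simp add: assms(2))
  then have "(\<lambda>s::real. frechet_derivative f (at z) (s *\<^sub>R v)) = (\<lambda>s. 0)"
    by (rule has_derivative_unique) simp
  from fun_cong[OF this, of 1] show ?thesis by simp
qed

lemma matrix_inv_mult:
  assumes "invertible (A :: real ^ 'm::finite ^ 'm)"
  shows "A ** matrix_inv A = mat 1" and "matrix_inv A ** A = mat 1"
proof -
  have "\<exists>A'. A ** A' = mat 1 \<and> A' ** A = mat 1"
    using assms unfolding invertible_def .
  from someI_ex[OF this] show "A ** matrix_inv A = mat 1" "matrix_inv A ** A = mat 1"
    unfolding matrix_inv_def by blast+
qed

lemma matrix_inv_right_component:
  assumes "invertible (A :: real ^ 'm::finite ^ 'm)"
  shows "(\<Sum>d\<in>UNIV. A $ b $ d * matrix_inv A $ d $ e) = kron b e"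
proof -
  have "(A ** matrix_inv A) $ b $ e = kron b e"
    using matrix_inv_mult(1)[OF assms] by (simp add: mat_def kron_def)
  then show ?thesis by (simp add: matrix_matrix_mult_def)
qed

lemma kron_commute: "kron i j = kron j i"
  by (auto simp: kron_def)

text \<open>Lowering the index with h cancels the inverse matrix and leaves the Christoffel symbols
  of the first kind, of which two add up to a derivative of h.\<close>

lemma christoffel_lower:
  assumes "invertible (h t)"
  shows "(\<Sum>d\<in>UNIV. h t $ b $ d * christoffel h d a g t) =
    (frechet_derivative (\<lambda>u. h u $ b $ g) (at t) (axis a 1)
     + frechet_derivative (\<lambda>u. h u $ b $ a) (at t) (axis g 1)
     - frechet_derivative (\<lambda>u. h u $ a $ g) (at t) (axis b 1)) / 2"
proof -
  define S where "S e = (frechet_derivative (\<lambda>u. h u $ e $ g) (at t) (axis a 1)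
     + frechet_derivative (\<lambda>u. h u $ e $ a) (at t) (axis g 1)
     - frechet_derivative (\<lambda>u. h u $ a $ g) (at t) (axis e 1)) / 2" for e
  have "(\<Sum>d\<in>UNIV. h t $ b $ d * christoffel h d a g t) =
      (\<Sum>d\<in>UNIV. \<Sum>e\<in>UNIV. h t $ b $ d * (matrix_inv (h t) $ d $ e * S e))"
    by (simp add: christoffel_def S_def sum_distrib_left)
  also have "\<dots> = (\<Sum>e\<in>UNIV. (\<Sum>d\<in>UNIV. h t $ b $ d * matrix_inv (h t) $ d $ e) * S e)"
    by (subst sum.swap) (simp add: sum_distrib_right mult.assoc)
  also have "\<dots> = S b"
    by (simp add: matrix_inv_right_component[OF assms] sum_kron)
  finally show ?thesis unfolding S_def .
qed

lemma (in adapted_geometry) smooth_coframe: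
  assumes X: "smooth_on W X"
  shows "smooth_on W (coframe G \<alpha> X)"
proof -
  have t: "smooth_on W (\<lambda>z. fst (X z) $ a)" for a
    by (rule smooth_on_linear_image[OF open_W _ X, of "\<lambda>v. fst v $ a"])
      (intro bounded_linear_compose[OF bounded_linear_vec_nth] bounded_linear_fst)
  have x: "smooth_on W (\<lambda>z. fst (snd (X z)) $ i)" for i
    by (rule smooth_on_linear_image[OF open_W _ X, of "\<lambda>v. fst (snd v) $ i"])
      (intro bounded_linear_compose[OF bounded_linear_vec_nth]
        bounded_linear_compose[OF bounded_linear_fst] bounded_linear_snd)
  have p: "smooth_on W (\<lambda>z. snd (snd (X z)) $ i $ a)" for i a
    by (rule smooth_on_linear_image[OF open_W _ X, of "\<lambda>v. snd (snd v) $ i $ a"])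
      (intro bounded_linear_compose[OF bounded_linear_vec_nth]
        bounded_linear_compose[OF bounded_linear_snd] bounded_linear_snd)
  show ?thesis
    by (cases \<alpha>) (auto simp: coframe.simps[abs_def] intro!: t x p smooth_on_add smooth_on_sum smooth_on_mult
        open_W smooth_nlc1 smooth_nlc2)
qed

section \<open>The tensor J on frame fields\<close>

lemma coframe_frame:
  "coframe G (Tm a) (frame G (Tm b)) z = kron b a"
  "coframe G (Sp i) (frame G (Sp j)) z = kron j i"
  "coframe G (Mo i a) (frame G (Mo j b)) z = kron j i * kron b a"
  by (auto simp: kron_def axis_def)

lemma tensor_J_contract:
  "tensor_J G X Y Z z = (\<Sum>a\<in>UNIV. \<Sum>b\<in>UNIV. \<Sum>i\<in>UNIV. met G (fst z) $ a $ b *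
     coframe G (Mo i a) X z * coframe G (Tm b) Y z * coframe G (Sp i) Z z)"
proof -
  have "(\<Sum>j\<in>UNIV. met G (fst z) $ a $ b * kron i j *
        coframe G (Mo i a) X z * coframe G (Tm b) Y z * coframe G (Sp j) Z z) =
      (\<Sum>j\<in>UNIV. kron i j * (met G (fst z) $ a $ b *
        coframe G (Mo i a) X z * coframe G (Tm b) Y z * coframe G (Sp j) Z z))" for a b i
    by (simp add: mult_ac)
  then show ?thesis unfolding tensor_J_def by (simp add: sum_kron)
qed

text \<open>With frame fields in two slots, J reads off components of the field in the third. These
  are the three connection terms of the condition that J is parallel.\<close>

lemma tensor_J_frames:
  "tensor_J G X (frame G (Tm b)) (frame G (Sp j)) z =
    (\<Sum>c\<in>UNIV. met G (fst z) $ c $ b * coframe G (Mo j c) X z)"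
  "tensor_J G (frame G (Mo i a)) Y (frame G (Sp j)) z =
    kron i j * (\<Sum>c\<in>UNIV. met G (fst z) $ a $ c * coframe G (Tm c) Y z)"
  "tensor_J G (frame G (Mo i a)) (frame G (Tm b)) Z z = met G (fst z) $ a $ b * coframe G (Sp i) Z z"
proof -
  have "tensor_J G X (frame G (Tm b)) (frame G (Sp j)) z =
     (\<Sum>c\<in>UNIV. \<Sum>b'\<in>UNIV. kron b b' * (\<Sum>i\<in>UNIV. kron j i * (met G (fst z) $ c $ b' * coframe G (Mo i c) X z)))"
    unfolding tensor_J_contract coframe_frame by (simp add: sum_distrib_left mult_ac del: coframe.simps)
  then show "tensor_J G X (frame G (Tm b)) (frame G (Sp j)) z =
    (\<Sum>c\<in>UNIV. met G (fst z) $ c $ b * coframe G (Mo j c) X z)"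
    by (simp add: sum_kron del: coframe.simps)
  have "tensor_J G (frame G (Mo i a)) Y Z z =
     (\<Sum>a'\<in>UNIV. kron a a' * (\<Sum>b\<in>UNIV. \<Sum>i'\<in>UNIV. kron i i' * (met G (fst z) $ a' $ b *
       coframe G (Tm b) Y z * coframe G (Sp i') Z z)))" for Y Z
    unfolding tensor_J_contract coframe_frame by (simp add: sum_distrib_left mult_ac del: coframe.simps)
  then have *: "tensor_J G (frame G (Mo i a)) Y Z z =
     (\<Sum>b\<in>UNIV. met G (fst z) $ a $ b * coframe G (Tm b) Y z * coframe G (Sp i) Z z)" for Y Z
    by (simp add: sum_kron del: coframe.simps)
  show "tensor_J G (frame G (Mo i a)) Y (frame G (Sp j)) z =
    kron i j * (\<Sum>c\<in>UNIV. met G (fst z) $ a $ c * coframe G (Tm c) Y z)"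
    unfolding * coframe_frame by (simp add: sum_distrib_left mult_ac kron_commute[of j i] del: coframe.simps)
  have "tensor_J G (frame G (Mo i a)) (frame G (Tm b)) Z z =
     (\<Sum>b'\<in>UNIV. kron b b' * (met G (fst z) $ a $ b' * coframe G (Sp i) Z z))"
    unfolding * coframe_frame by (simp add: mult_ac del: coframe.simps)
  then show "tensor_J G (frame G (Mo i a)) (frame G (Tm b)) Z z = met G (fst z) $ a $ b * coframe G (Sp i) Z z"
    by (simp add: sum_kron del: coframe.simps)
qed

lemma cartan_geometry_at:
  fixes \<T> :: "('s::{t2_space, second_countable_topology}, 'm::finite) chart set"
    and \<M> :: "('q::{t2_space, second_countable_topology}, 'n::finite) chart set"
    and \<kappa> :: "('s, 'm, 'q, 'n) jet_chart"
  assumes T: "smooth_manifold \<T>" and M: "smooth_manifold \<M>"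
    and N: "nonlinear_connection \<T> \<M> N1 N2"
    and h: "semi_riemannian_metric \<T> h"
    and D: "N_linear_connection \<T> \<M> N1 N2 h D"
    and normal: "h_normal \<T> \<M> N1 N2 h D"
    and cartan: "Cartan_type \<T> \<M> N1 N2 h D"
    and \<kappa>: "\<kappa> \<in> \<T> \<times> \<M>"
  shows "cartan_geometry (jet_domain \<kappa>) (geometry_at N1 N2 h D \<kappa>)"
proof -
  define W where "W = jet_domain \<kappa>"
  define G where "G = geometry_at N1 N2 h D \<kappa>"
  define C where "C = chart_image (fst \<kappa>)"
  have \<kappa>': "fst \<kappa> \<in> \<T>" "snd \<kappa> \<in> \<M>" using \<kappa> by auto
  have open_C: "open C" and open_x: "open (chart_image (snd \<kappa>))"
    using T M \<kappa>' unfolding smooth_manifold_def C_def by blast+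
  have W_times: "W = C \<times> chart_image (snd \<kappa>) \<times> UNIV"
    by (simp add: W_def C_def jet_domain_def)
  have open_W: "open W"
    unfolding W_times by (intro open_Times open_C open_x open_UNIV)
  have G_simps: "nlc1 G = N1 \<kappa>" "nlc2 G = N2 \<kappa>" "met G = h (fst \<kappa>)" "con G = D \<kappa>"
    by (simp_all add: G_def geometry_at_def)
  have "\<forall>\<kappa>\<in>\<T> \<times> \<M>. (\<forall>a i b. smooth_on (jet_domain \<kappa>) (N1 \<kappa> a i b)) \<and>
      (\<forall>a i j. smooth_on (jet_domain \<kappa>) (N2 \<kappa> a i j))"
    using N unfolding nonlinear_connection_def by (elim conjE)
  then interpret adapted_geometry W G
    using \<kappa> open_W by unfold_locales (simp_all only: G_simps W_def)
  have "linear_connection \<T> \<M> D"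
    using D unfolding N_linear_connection_def by (elim conjE)
  then have "\<forall>\<kappa>\<in>\<T> \<times> \<M>. linear_connection_on (jet_domain \<kappa>) (D \<kappa>)"
    unfolding linear_connection_def by (elim conjE)
  from bspec[OF this \<kappa>] have "linear_connection_on W (con G)"
    unfolding G_simps W_def .
  then have "\<forall>X Y. smooth_on W X \<longrightarrow> smooth_on W Y \<longrightarrow> smooth_on W (con G X Y)"
    unfolding linear_connection_on_def by (elim conjE)
  then have smooth_con: "smooth_on W (con G X Y)" if "smooth_on W X" "smooth_on W Y" for X Y
    using that by simp
  have smooth_t: "smooth_on W (comp_t G a b \<gamma>)" for a b \<gamma>
    unfolding comp_t_def by (intro smooth_coframe smooth_con smooth_frame)
  have smooth_x: "smooth_on W (comp_x G i j \<gamma>)" for i j \<gamma>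
    unfolding comp_x_def by (intro smooth_coframe smooth_con smooth_frame)
  have normal': "(\<forall>z\<in>W. (\<forall>a b c. comp_t G a b (Tm c) z = chr G a b c z) \<and>
      (\<forall>a b i. comp_t G a b (Sp i) z = 0) \<and> (\<forall>a b i c. comp_t G a b (Mo i c) z = 0)) \<and> parallel_J W G"
    using bspec[OF normal[unfolded h_normal_def] \<kappa>] unfolding Let_def W_def G_def .
  then have t_Tm: "comp_t G a b (Tm c) z = chr G a b c z" and t_Sp: "comp_t G a b (Sp i) z = 0"
    and t_Mo: "comp_t G a b (Mo i c) z = 0" if "z \<in> W" for z a b c i
    using that by simp_all
  have J: "parallel_J W G" using normal' ..
  have met: "smooth_on C (met G)" and "\<forall>t\<in>C. transpose (met G t) = met G t \<and> invertible (met G t)"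
    using h \<kappa>' unfolding semi_riemannian_metric_def G_simps C_def by blast+
  then have "transpose (met G t) $ a $ b = met G t $ a $ b" and invertible: "invertible (met G t)"
    if "t \<in> C" for t a b using that by simp_all
  then have met_sym: "met G t $ a $ b = met G t $ b $ a" if "t \<in> C" for t a b
    using that by (simp add: transpose_def)
  have d_met_sym: "frechet_derivative (\<lambda>u. met G u $ a $ b) (at t) = frechet_derivative (\<lambda>u. met G u $ b $ a) (at t)"
    if "t \<in> C" for t a b
    using frechet_derivative_cong[OF open_C that met_sym] .
  have smooth_met: "smooth_on C (\<lambda>u. met G u $ a $ b)" for a b
    by (rule smooth_on_linear_image[OF open_C _ met, of "\<lambda>A. A $ a $ b"])
      (intro bounded_linear_compose[OF bounded_linear_vec_nth] bounded_linear_vec_nth)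
  have fst_W: "fst z \<in> C" if "z \<in> W" for z using that by (auto simp: W_times)
  have d_met: "((\<lambda>z. met G (fst z) $ a $ b) has_derivative
      (\<lambda>v. frechet_derivative (\<lambda>u. met G u $ a $ b) (at (fst z)) (fst v))) (at z)" if "z \<in> W" for z a b
    by (rule has_derivative_compose[OF has_derivative_fst[OF has_derivative_ident]
          smooth_on_has_derivative[OF smooth_met fst_W[OF that]]])
  \<comment> \<open>Metric compatibility. In temporal directions it is the Levi-Civita property of
    \<chi>; in the others both sides are zero, since h depends on t alone and \<open>comp_t\<close>
    vanishes.\<close>
  have compat: "vf_apply (frame G \<gamma>) (\<lambda>z. met G (fst z) $ a $ b) z =
      (\<Sum>d\<in>UNIV. met G (fst z) $ b $ d * comp_t G d a \<gamma> z) + (\<Sum>d\<in>UNIV. met G (fst z) $ a $ d * comp_t G d b \<gamma> z)"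
    if z: "z \<in> W" for z a b \<gamma>
  proof -
    have d: "vf_apply (frame G \<gamma>) (\<lambda>z. met G (fst z) $ a $ b) z =
        frechet_derivative (\<lambda>u. met G u $ a $ b) (at (fst z)) (fst (frame G \<gamma> z))" for \<gamma>
      unfolding vf_apply_def frechet_derivative_at[OF d_met[OF z], symmetric] ..
    note zero = linear_0[OF frechet_derivative_linear[OF smooth_met fst_W[OF z]]]
    show ?thesis
    proof (cases \<gamma>)
      case (Tm g)
      show ?thesis
        unfolding d
        unfolding Tm t_Tm[OF z] chr_def christoffel_lower[of "met G" "fst z", OF invertible[OF fst_W[OF z]]]
          d_met_sym[OF fst_W[OF z], of b a] by (simp add: field_simps)
    qed (simp_all add: d zero t_Sp[OF z] t_Mo[OF z])
  qed
  have comp_p: "comp_p G i a j b \<gamma> z = kron b a * comp_x G j i \<gamma> z - kron i j * comp_t G a b \<gamma> z"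
    if z: "z \<in> W" for z i a j b \<gamma>
  proof -
    \<comment> \<open>The parallelism of J, evaluated on \<open>frame G (Mo j b)\<close>,
      \<open>frame G (Tm e)\<close> and \<open>frame G (Sp i)\<close>, yields the claim only
      contracted with h over the upper temporal index. So v collects the errors for all values of
      that index: h annihilates v, and invertibility of h gives v = 0.\<close>
    define v :: "real^'m" where "v = (\<chi> c. comp_p G i c j b \<gamma> z - (kron b c * comp_x G j i \<gamma> z - kron i j * comp_t G c b \<gamma> z))"
    have "(met G (fst z) *v v) $ e = 0" for e
    proof -
      let ?m = "\<lambda>a b. met G (fst z) $ a $ b"
      have "tensor_J G (frame G (Mo j b)) (frame G (Tm e)) (frame G (Sp i)) = (\<lambda>z. met G (fst z) $ b $ e * kron j i)"
        by (rule ext) (simp add: tensor_J_frames(3) coframe_frame kron_commute[of i j] del: frame.simps coframe.simps)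
      moreover have "vf_apply (frame G \<gamma>) (\<lambda>z. met G (fst z) $ b $ e * kron j i) z =
          vf_apply (frame G \<gamma>) (\<lambda>z. met G (fst z) $ b $ e) z * kron j i"
        unfolding vf_apply_def frechet_derivative_at[OF has_derivative_mult_left[OF d_met[OF z]], symmetric]
          frechet_derivative_at[OF d_met[OF z], symmetric] ..
      moreover have "vf_apply (frame G \<gamma>) (tensor_J G (frame G (Mo j b)) (frame G (Tm e)) (frame G (Sp i))) z
          - tensor_J G (con G (frame G \<gamma>) (frame G (Mo j b))) (frame G (Tm e)) (frame G (Sp i)) z
          - tensor_J G (frame G (Mo j b)) (con G (frame G \<gamma>) (frame G (Tm e))) (frame G (Sp i)) z
          - tensor_J G (frame G (Mo j b)) (frame G (Tm e)) (con G (frame G \<gamma>) (frame G (Sp i))) z = 0"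
        by (rule J[unfolded parallel_J_def, rule_format, OF smooth_frame smooth_frame smooth_frame smooth_frame z])
      ultimately have "(\<Sum>c\<in>UNIV. ?m c e * comp_p G i c j b \<gamma> z) =
          ?m b e * comp_x G j i \<gamma> z - kron j i * (\<Sum>d\<in>UNIV. ?m e d * comp_t G d b \<gamma> z)"
        by (simp add: tensor_J_frames compat[OF z] comp_p_def comp_t_def comp_x_def sum_negf algebra_simps
            del: frame.simps coframe.simps)
      moreover have "(\<Sum>c\<in>UNIV. ?m c e * comp_p G i c j b \<gamma> z) = (\<Sum>c\<in>UNIV. ?m e c * comp_p G i c j b \<gamma> z)"
        using met_sym[OF fst_W[OF z]] by (intro sum.cong refl) metis
      moreover have "(\<Sum>c\<in>UNIV. ?m e c * (kron b c * comp_x G j i \<gamma> z)) = ?m b e * comp_x G j i \<gamma> z"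
      proof -
        have "(\<Sum>c\<in>UNIV. ?m e c * (kron b c * comp_x G j i \<gamma> z)) = (\<Sum>c\<in>UNIV. kron b c * (?m e c * comp_x G j i \<gamma> z))"
          by (simp add: mult_ac)
        then show ?thesis by (simp add: sum_kron met_sym[OF fst_W[OF z], of e b])
      qed
      ultimately show ?thesis
        by (simp add: v_def matrix_vector_mult_def algebra_simps sum.distrib sum_subtractf
            sum_distrib_left kron_commute[of j i])
    qed
    then have "met G (fst z) *v v = 0" by (simp add: vec_eq_iff)
    then have "v = 0"
      using matrix_inv_mult(2)[OF invertible[OF fst_W[OF z]]]
      by (metis matrix_vector_mul_assoc matrix_vector_mul_lid matrix_vector_mult_0_right)
    then have "v $ a = 0" by simp
    then show ?thesis by (simp add: v_def)
  qed
  have chr_sym: "chr G a b c z = chr G a c b z" if "z \<in> W" for z a b c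
    unfolding chr_def christoffel_def Let_def d_met_sym[OF fst_W[OF that], of c b] by (simp add: algebra_simps)
  have chr_const: "vf_apply (frame G \<gamma>) (chr G a b c) z = 0" if z: "z \<in> W" and "fst (frame G \<gamma> z) = 0"
    for z \<gamma> a b c
  proof -
    \<comment> \<open>Smoothness is inherited from \<open>comp_t\<close>, with which
      \<open>chr\<close> agrees on W; this avoids differentiating the inverse matrix of h.\<close>
    have "smooth_on W (chr G a b c)"
      using smooth_on_cong[OF open_W, of "comp_t G a b (Tm c)" "chr G a b c"] t_Tm smooth_t by simp
    then show ?thesis
      unfolding vf_apply_def
      by (intro frechet_derivative_constant_direction smooth_on_differentiable[OF _ z])
        (simp_all add: chr_def that(2))
  qed
  have "comp_x G i j (Sp k) z = comp_x G i k (Sp j) z" if "z \<in> W" for z i j k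
    using bspec[OF cartan[unfolded Cartan_type_def] \<kappa>] that
    unfolding Let_def W_def G_def H_comp_def by blast
  then have "cartan_geometry W G"
    by unfold_locales (auto intro: smooth_t smooth_x t_Tm t_Sp t_Mo comp_p chr_sym chr_const)
  then show ?thesis unfolding W_def G_def .
qed


section \<open>The thirty identities\<close>

theorem theorem6p1:
  fixes \<T> :: "('s::{t2_space, second_countable_topology}, 'm::finite) chart set"
    and \<M> :: "('q::{t2_space, second_countable_topology}, 'n::finite) chart set"
    and N1 :: "('s, 'm, 'q, 'n) jet_chart \<Rightarrow> 'm \<Rightarrow> 'n \<Rightarrow> 'm \<Rightarrow> ('m, 'n) scalar"
    and N2 :: "('s, 'm, 'q, 'n) jet_chart \<Rightarrow> 'm \<Rightarrow> 'n \<Rightarrow> 'n \<Rightarrow> ('m, 'n) scalar"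
    and h :: "('s, 'm) chart \<Rightarrow> real ^ 'm \<Rightarrow> real ^ 'm ^ 'm"
    and D :: "('s, 'm, 'q, 'n) jet_chart \<Rightarrow> ('m, 'n) vfield \<Rightarrow> ('m, 'n) vfield \<Rightarrow> ('m, 'n) vfield"
    and \<kappa> :: "('s, 'm, 'q, 'n) jet_chart"
    and G :: "('m, 'n) jet_geometry"
    and z :: "('m, 'n) jet"
    and a b c d e :: 'm
    and i j k l p :: 'n
  assumes "smooth_manifold \<T>" and "smooth_manifold \<M>"
    and "nonlinear_connection \<T> \<M> N1 N2"
    and "semi_riemannian_metric \<T> h"
    and "N_linear_connection \<T> \<M> N1 N2 h D"
    and "h_normal \<T> \<M> N1 N2 h D"
    and "Cartan_type \<T> \<M> N1 N2 h D"
    and "\<kappa> \<in> \<T> \<times> \<M>"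
    and "G = geometry_at N1 N2 h D \<kappa>"
    and "z \<in> jet_domain \<kappa>"
  shows "
    \<comment> \<open>first set: 1 - 4\<close>
    cyc (\<lambda>a b c. curvX G [Tm d] [Tm a, Tm b, Tm c] z) a b c = 0
  \<and> alt (\<lambda>a b. (\<Sum>r\<in>UNIV. torT G [Sp l] [Tm a, Sp r] z * torT G [Sp r] [Tm b, Sp k] z)
              - cov G (torT G) [Sp l] [Tm a, Sp k] (Tm b) z) a b
    = curvR G [Sp l] [Sp k, Tm a, Tm b] z
      - (\<Sum>r\<in>UNIV. \<Sum>f\<in>UNIV. C_tensor G [Sp l] [Sp k, Mo r f] z * torR G [Mo r f] [Tm a, Tm b] z)
  \<and> alt (\<lambda>j k. (\<Sum>r\<in>UNIV. \<Sum>f\<in>UNIV. C_tensor G [Sp l] [Sp k, Mo r f] z * torR G [Mo r f] [Tm a, Sp j] z)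
              + curvR G [Sp l] [Sp j, Tm a, Sp k] z
              + cov G (torT G) [Sp l] [Tm a, Sp j] (Sp k) z) j k
    = 0
  \<and> cyc (\<lambda>i j k. (\<Sum>r\<in>UNIV. \<Sum>f\<in>UNIV. C_tensor G [Sp l] [Sp k, Mo r f] z * torR G [Mo r f] [Sp i, Sp j] z)
              - curvR G [Sp l] [Sp i, Sp j, Sp k] z) i j k
    = 0

    \<comment> \<open>second set: 5 - 8\<close>
  \<and> cyc (\<lambda>a b c. cov G (torR G) [Mo l d] [Tm a, Tm b] (Tm c) z
              + (\<Sum>r\<in>UNIV. \<Sum>f\<in>UNIV. torP G [Mo l d] [Tm c, Mo r f] z * torR G [Mo r f] [Tm a, Tm b] z)) a b c
    = 0
  \<and> alt (\<lambda>a b. cov G (torR G) [Mo l d] [Tm a, Sp k] (Tm b) z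
              + (\<Sum>r\<in>UNIV. \<Sum>f\<in>UNIV. torP G [Mo l d] [Tm b, Mo r f] z * torR G [Mo r f] [Tm a, Sp k] z)
              + (\<Sum>r\<in>UNIV. torR G [Mo l d] [Tm b, Sp r] z * torT G [Sp r] [Tm a, Sp k] z)) a b
    = cov G (torR G) [Mo l d] [Tm a, Tm b] (Sp k) z
      + (\<Sum>r\<in>UNIV. \<Sum>f\<in>UNIV. torP G [Mo l d] [Sp k, Mo r f] z * torR G [Mo r f] [Tm a, Tm b] z)
  \<and> alt (\<lambda>j k. cov G (torR G) [Mo l d] [Tm a, Sp j] (Sp k) z
              + (\<Sum>r\<in>UNIV. \<Sum>f\<in>UNIV. torP G [Mo l d] [Sp k, Mo r f] z * torR G [Mo r f] [Tm a, Sp j] z)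
              + (\<Sum>r\<in>UNIV. torR G [Mo l d] [Sp k, Sp r] z * torT G [Sp r] [Tm a, Sp j] z)) j k
    = - cov G (torR G) [Mo l d] [Sp j, Sp k] (Tm a) z
      - (\<Sum>r\<in>UNIV. \<Sum>f\<in>UNIV. torP G [Mo l d] [Tm a, Mo r f] z * torR G [Mo r f] [Sp j, Sp k] z)
  \<and> cyc (\<lambda>i j k. cov G (torR G) [Mo l d] [Sp i, Sp j] (Sp k) z
              + (\<Sum>r\<in>UNIV. \<Sum>f\<in>UNIV. torP G [Mo l d] [Sp k, Mo r f] z * torR G [Mo r f] [Sp i, Sp j] z)) i j k
    = 0

    \<comment> \<open>third set: 9 - 10\<close>
  \<and> cov G (torT G) [Sp l] [Tm a, Sp k] (Mo p e) z
      - (\<Sum>r\<in>UNIV. C_tensor G [Sp l] [Sp r, Mo p e] z * torT G [Sp r] [Tm a, Sp k] z)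
      + curvP G [Sp l] [Sp k, Tm a, Mo p e] z
      + cov G (C_tensor G) [Sp l] [Sp k, Mo p e] (Tm a) z
      - (\<Sum>r\<in>UNIV. \<Sum>f\<in>UNIV. C_tensor G [Sp l] [Sp k, Mo r f] z * torP G [Mo r f] [Tm a, Mo p e] z)
      + (\<Sum>r\<in>UNIV. C_tensor G [Sp r] [Sp k, Mo p e] z * torT G [Sp l] [Tm a, Sp r] z)
    = 0
  \<and> alt (\<lambda>j k. cov G (C_tensor G) [Sp l] [Sp j, Mo p e] (Sp k) z
              + (\<Sum>r\<in>UNIV. \<Sum>f\<in>UNIV. C_tensor G [Sp l] [Sp k, Mo r f] z * torP G [Mo r f] [Sp j, Mo p e] z)
              + curvP G [Sp l] [Sp j, Sp k, Mo p e] z) j k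
    = 0

    \<comment> \<open>fourth set: 11 - 13\<close>
  \<and> alt (\<lambda>\<alpha> \<beta>. cov G (torP G) [Mo l d] [\<alpha>, Mo p e] \<beta> z
              + (\<Sum>r\<in>UNIV. \<Sum>f\<in>UNIV. torP G [Mo l d] [\<beta>, Mo r f] z * torP G [Mo r f] [\<alpha>, Mo p e] z)) (Tm a) (Tm b)
    = cov G (torR G) [Mo l d] [Tm a, Tm b] (Mo p e) z
      + vcurvR G [Mo l d] [Mo p e, Tm a, Tm b] z
      + (\<Sum>r\<in>UNIV. \<Sum>f\<in>UNIV. torS G [Mo l d] [Mo p e, Mo r f] z * torR G [Mo r f] [Tm a, Tm b] z)
  \<and> alt (\<lambda>\<alpha> \<beta>. cov G (torP G) [Mo l d] [\<alpha>, Mo p e] \<beta> z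
              + (\<Sum>r\<in>UNIV. \<Sum>f\<in>UNIV. torP G [Mo l d] [\<beta>, Mo r f] z * torP G [Mo r f] [\<alpha>, Mo p e] z)) (Tm a) (Sp k)
    = cov G (torR G) [Mo l d] [Tm a, Sp k] (Mo p e) z
      + vcurvR G [Mo l d] [Mo p e, Tm a, Sp k] z
      + (\<Sum>r\<in>UNIV. \<Sum>f\<in>UNIV. torS G [Mo l d] [Mo p e, Mo r f] z * torR G [Mo r f] [Tm a, Sp k] z)
      + (\<Sum>r\<in>UNIV. torR G [Mo l d] [Tm a, Sp r] z * C_tensor G [Sp r] [Sp k, Mo p e] z)
      - (\<Sum>r\<in>UNIV. torT G [Sp r] [Tm a, Sp k] z * torP G [Mo l d] [Sp r, Mo p e] z)
  \<and> alt (\<lambda>j k. cov G (torP G) [Mo l d] [Sp j, Mo p e] (Sp k) z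
              + (\<Sum>r\<in>UNIV. \<Sum>f\<in>UNIV. torP G [Mo l d] [Sp k, Mo r f] z * torP G [Mo r f] [Sp j, Mo p e] z)
              + (\<Sum>r\<in>UNIV. torR G [Mo l d] [Sp k, Sp r] z * C_tensor G [Sp r] [Sp j, Mo p e] z)) j k
    = cov G (torR G) [Mo l d] [Sp j, Sp k] (Mo p e) z
      + vcurvR G [Mo l d] [Mo p e, Sp j, Sp k] z
      + (\<Sum>r\<in>UNIV. \<Sum>f\<in>UNIV. torS G [Mo l d] [Mo p e, Mo r f] z * torR G [Mo r f] [Sp j, Sp k] z)

    \<comment> \<open>fifth set: 14\<close>
  \<and> alt (\<lambda>\<beta> \<gamma>. cov G (C_tensor G) [Sp l] [Sp i, \<beta>] \<gamma> z
              + (\<Sum>r\<in>UNIV. C_tensor G [Sp r] [Sp i, \<gamma>] z * C_tensor G [Sp l] [Sp r, \<beta>] z)) (Mo j b) (Mo k c)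
    = curvS G [Sp l] [Sp i, Mo j b, Mo k c] z
      - (\<Sum>r\<in>UNIV. \<Sum>f\<in>UNIV. C_tensor G [Sp l] [Sp i, Mo r f] z * torS G [Mo r f] [Mo j b, Mo k c] z)

    \<comment> \<open>sixth set: 15 - 16\<close>
  \<and> alt (\<lambda>\<beta> \<gamma>. cov G (torP G) [Mo l d] [Tm a, \<beta>] \<gamma> z
              + (\<Sum>r\<in>UNIV. \<Sum>f\<in>UNIV. torP G [Mo r f] [Tm a, \<beta>] z * torS G [Mo l d] [\<gamma>, Mo r f] z)
              - vcurvP G [Mo l d] [\<beta>, Tm a, \<gamma>] z) (Mo j b) (Mo k c)
    = - cov G (torS G) [Mo l d] [Mo j b, Mo k c] (Tm a) z
      - (\<Sum>r\<in>UNIV. \<Sum>f\<in>UNIV. torS G [Mo r f] [Mo j b, Mo k c] z * torP G [Mo l d] [Tm a, Mo r f] z)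
  \<and> alt (\<lambda>\<beta> \<gamma>. cov G (torP G) [Mo l d] [Sp i, \<beta>] \<gamma> z
              + (\<Sum>r\<in>UNIV. \<Sum>f\<in>UNIV. torP G [Mo r f] [Sp i, \<beta>] z * torS G [Mo l d] [\<gamma>, Mo r f] z)
              - vcurvP G [Mo l d] [\<beta>, Sp i, \<gamma>] z
              - (\<Sum>r\<in>UNIV. C_tensor G [Sp r] [Sp i, \<beta>] z * torP G [Mo l d] [Sp r, \<gamma>] z)) (Mo j b) (Mo k c)
    = - cov G (torS G) [Mo l d] [Mo j b, Mo k c] (Sp i) z
      - (\<Sum>r\<in>UNIV. \<Sum>f\<in>UNIV. torS G [Mo r f] [Mo j b, Mo k c] z * torP G [Mo l d] [Sp i, Mo r f] z)

    \<comment> \<open>seventh set: 17\<close>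
  \<and> cyc (\<lambda>\<alpha> \<beta> \<gamma>. cov G (torS G) [Mo l d] [\<alpha>, \<beta>] \<gamma> z
              + (\<Sum>r\<in>UNIV. \<Sum>f\<in>UNIV. torS G [Mo r f] [\<alpha>, \<beta>] z * torS G [Mo l d] [\<gamma>, Mo r f] z)
              + vcurvS G [Mo l d] [\<alpha>, \<beta>, \<gamma>] z) (Mo i a) (Mo j b) (Mo k c)
    = 0

    \<comment> \<open>eighth set: 18 - 24\<close>
  \<and> cyc (\<lambda>a b c. cov G (curvX G) [Tm d] [Tm e, Tm a, Tm b] (Tm c) z) a b c = 0
  \<and> cov G (curvX G) [Tm d] [Tm e, Tm a, Tm b] (Sp k) z = 0
  \<and> cov G (curvX G) [Tm d] [Tm e, Tm a, Tm b] (Mo k c) z = 0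
  \<and> cyc (\<lambda>a b c. cov G (curvR G) [Sp l] [Sp p, Tm a, Tm b] (Tm c) z
              + (\<Sum>r\<in>UNIV. \<Sum>f\<in>UNIV. torR G [Mo r f] [Tm a, Tm b] z * curvP G [Sp l] [Sp p, Tm c, Mo r f] z)) a b c
    = 0
  \<and> alt (\<lambda>a b. cov G (curvR G) [Sp l] [Sp p, Tm a, Sp k] (Tm b) z
              + (\<Sum>r\<in>UNIV. \<Sum>f\<in>UNIV. torR G [Mo r f] [Tm a, Sp k] z * curvP G [Sp l] [Sp p, Tm b, Mo r f] z)
              + (\<Sum>r\<in>UNIV. torT G [Sp r] [Tm a, Sp k] z * curvR G [Sp l] [Sp p, Tm b, Sp r] z)) a b
    = cov G (curvR G) [Sp l] [Sp p, Tm a, Tm b] (Sp k) z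
      + (\<Sum>r\<in>UNIV. \<Sum>f\<in>UNIV. torR G [Mo r f] [Tm a, Tm b] z * curvP G [Sp l] [Sp p, Sp k, Mo r f] z)
  \<and> alt (\<lambda>j k. cov G (curvR G) [Sp l] [Sp p, Tm a, Sp j] (Sp k) z
              + (\<Sum>r\<in>UNIV. \<Sum>f\<in>UNIV. torR G [Mo r f] [Tm a, Sp j] z * curvP G [Sp l] [Sp p, Sp k, Mo r f] z)
              + (\<Sum>r\<in>UNIV. torT G [Sp r] [Tm a, Sp j] z * curvR G [Sp l] [Sp p, Sp k, Sp r] z)) j k
    = - cov G (curvR G) [Sp l] [Sp p, Sp j, Sp k] (Tm a) z
      - (\<Sum>r\<in>UNIV. \<Sum>f\<in>UNIV. torR G [Mo r f] [Sp j, Sp k] z * curvP G [Sp l] [Sp p, Tm a, Mo r f] z)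
  \<and> cyc (\<lambda>i j k. cov G (curvR G) [Sp l] [Sp p, Sp i, Sp j] (Sp k) z
              + (\<Sum>r\<in>UNIV. \<Sum>f\<in>UNIV. torR G [Mo r f] [Sp i, Sp j] z * curvP G [Sp l] [Sp p, Sp k, Mo r f] z)) i j k
    = 0

    \<comment> \<open>ninth set: 25 - 27\<close>
  \<and> alt (\<lambda>\<alpha> \<beta>. cov G (curvP G) [Sp l] [Sp i, \<alpha>, Mo p e] \<beta> z
              + (\<Sum>r\<in>UNIV. \<Sum>f\<in>UNIV. torP G [Mo r f] [\<alpha>, Mo p e] z * curvP G [Sp l] [Sp i, \<beta>, Mo r f] z)) (Tm a) (Tm b)
    = cov G (curvR G) [Sp l] [Sp i, Tm a, Tm b] (Mo p e) z
      + (\<Sum>r\<in>UNIV. \<Sum>f\<in>UNIV. torR G [Mo r f] [Tm a, Tm b] z * curvS G [Sp l] [Sp i, Mo p e, Mo r f] z)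
  \<and> alt (\<lambda>\<alpha> \<beta>. cov G (curvP G) [Sp l] [Sp i, \<alpha>, Mo p e] \<beta> z
              + (\<Sum>r\<in>UNIV. \<Sum>f\<in>UNIV. torP G [Mo r f] [\<alpha>, Mo p e] z * curvP G [Sp l] [Sp i, \<beta>, Mo r f] z)) (Tm a) (Sp k)
    = cov G (curvR G) [Sp l] [Sp i, Tm a, Sp k] (Mo p e) z
      + (\<Sum>r\<in>UNIV. \<Sum>f\<in>UNIV. torR G [Mo r f] [Tm a, Sp k] z * curvS G [Sp l] [Sp i, Mo p e, Mo r f] z)
      + (\<Sum>r\<in>UNIV. C_tensor G [Sp r] [Sp k, Mo p e] z * curvR G [Sp l] [Sp i, Tm a, Sp r] z)
      - (\<Sum>r\<in>UNIV. torT G [Sp r] [Tm a, Sp k] z * curvP G [Sp l] [Sp i, Sp r, Mo p e] z)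
  \<and> alt (\<lambda>j k. cov G (curvP G) [Sp l] [Sp i, Sp j, Mo p e] (Sp k) z
              + (\<Sum>r\<in>UNIV. \<Sum>f\<in>UNIV. torP G [Mo r f] [Sp j, Mo p e] z * curvP G [Sp l] [Sp i, Sp k, Mo r f] z)
              + (\<Sum>r\<in>UNIV. C_tensor G [Sp r] [Sp j, Mo p e] z * curvR G [Sp l] [Sp i, Sp k, Sp r] z)) j k
    = cov G (curvR G) [Sp l] [Sp i, Sp j, Sp k] (Mo p e) z
      + (\<Sum>r\<in>UNIV. \<Sum>f\<in>UNIV. torR G [Mo r f] [Sp j, Sp k] z * curvS G [Sp l] [Sp i, Mo p e, Mo r f] z)

    \<comment> \<open>tenth set: 28 - 29\<close>
  \<and> alt (\<lambda>\<beta> \<gamma>. cov G (curvP G) [Sp l] [Sp p, Tm a, \<beta>] \<gamma> z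
              + (\<Sum>r\<in>UNIV. \<Sum>f\<in>UNIV. torP G [Mo r f] [Tm a, \<beta>] z * curvS G [Sp l] [Sp p, \<gamma>, Mo r f] z)) (Mo j b) (Mo k c)
    = - cov G (curvS G) [Sp l] [Sp p, Mo j b, Mo k c] (Tm a) z
      - (\<Sum>r\<in>UNIV. \<Sum>f\<in>UNIV. torS G [Mo r f] [Mo j b, Mo k c] z * curvP G [Sp l] [Sp p, Tm a, Mo r f] z)
  \<and> alt (\<lambda>\<beta> \<gamma>. cov G (curvP G) [Sp l] [Sp p, Sp i, \<beta>] \<gamma> z
              + (\<Sum>r\<in>UNIV. \<Sum>f\<in>UNIV. torP G [Mo r f] [Sp i, \<beta>] z * curvS G [Sp l] [Sp p, \<gamma>, Mo r f] z)
              - (\<Sum>r\<in>UNIV. C_tensor G [Sp r] [Sp i, \<beta>] z * curvP G [Sp l] [Sp p, Sp r, \<gamma>] z)) (Mo j b) (Mo k c)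
    = - cov G (curvS G) [Sp l] [Sp p, Mo j b, Mo k c] (Sp i) z
      - (\<Sum>r\<in>UNIV. \<Sum>f\<in>UNIV. torS G [Mo r f] [Mo j b, Mo k c] z * curvP G [Sp l] [Sp p, Sp i, Mo r f] z)

    \<comment> \<open>eleventh set: 30\<close>
  \<and> cyc (\<lambda>\<alpha> \<beta> \<gamma>. cov G (curvS G) [Sp l] [Sp p, \<alpha>, \<beta>] \<gamma> z
              + (\<Sum>r\<in>UNIV. \<Sum>f\<in>UNIV. torS G [Mo r f] [\<alpha>, \<beta>] z * curvS G [Sp l] [Sp p, \<gamma>, Mo r f] z)) (Mo i a) (Mo j b) (Mo k c)
    = 0"
proof -
  have z: "z \<in> jet_domain \<kappa>" by fact
  interpret cartan_geometry "jet_domain \<kappa>" G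
    unfolding assms(9) by (rule cartan_geometry_at[OF assms(1-8)])
  \<comment> \<open>An identity is selected by the kinds of its free indices. The rules delete the
    vanishing blocks, put each surviving one into the index order of its d-tensor, and turn the
    momentum curvature of the first identity into the negative vertical curvature tensors.\<close>
  note to_blocks = tor_simps[OF z] cov_tor_simps[OF z] cov_cur_simps[OF z] cur_Tm[OF z] cur_Sp[OF z]
    cur_Mo[OF z] cur_off_diagonal cyc_def alt_def sum_negf algebra_simps
  show ?thesis
  proof (intro conjI, goal_cases)
    case 1
    show ?case using first_bianchi_expanded[OF z, of "Tm d" "Tm a" "Tm b" "Tm c"] by (simp add: to_blocks)
  next
    case 2
    show ?case using first_bianchi_expanded[OF z, of "Sp l" "Tm a" "Tm b" "Sp k"] by (simp add: to_blocks)
  next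
    case 3
    show ?case using first_bianchi_expanded[OF z, of "Sp l" "Tm a" "Sp j" "Sp k"] by (simp add: to_blocks)
  next
    case 4
    show ?case using first_bianchi_expanded[OF z, of "Sp l" "Sp i" "Sp j" "Sp k"] by (simp add: to_blocks)
  next
    case 5
    show ?case using first_bianchi_expanded[OF z, of "Mo l d" "Tm a" "Tm b" "Tm c"] by (simp add: to_blocks)
  next
    case 6
    show ?case using first_bianchi_expanded[OF z, of "Mo l d" "Tm a" "Tm b" "Sp k"] by (simp add: to_blocks)
  next
    case 7
    show ?case using first_bianchi_expanded[OF z, of "Mo l d" "Tm a" "Sp j" "Sp k"] by (simp add: to_blocks)
  next
    case 8
    show ?case using first_bianchi_expanded[OF z, of "Mo l d" "Sp i" "Sp j" "Sp k"] by (simp add: to_blocks)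
  next
    case 9
    show ?case using first_bianchi_expanded[OF z, of "Sp l" "Tm a" "Sp k" "Mo p e"] by (simp add: to_blocks)
  next
    case 10
    show ?case using first_bianchi_expanded[OF z, of "Sp l" "Sp j" "Sp k" "Mo p e"] by (simp add: to_blocks)
  next
    case 11
    show ?case using first_bianchi_expanded[OF z, of "Mo l d" "Tm a" "Tm b" "Mo p e"] by (simp add: to_blocks)
  next
    case 12
    show ?case using first_bianchi_expanded[OF z, of "Mo l d" "Tm a" "Sp k" "Mo p e"] by (simp add: to_blocks)
  next
    case 13
    show ?case using first_bianchi_expanded[OF z, of "Mo l d" "Sp j" "Sp k" "Mo p e"] by (simp add: to_blocks)
  next
    case 14
    show ?case using first_bianchi_expanded[OF z, of "Sp l" "Sp i" "Mo j b" "Mo k c"] by (simp add: to_blocks)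
  next
    case 15
    show ?case using first_bianchi_expanded[OF z, of "Mo l d" "Tm a" "Mo j b" "Mo k c"] by (simp add: to_blocks)
  next
    case 16
    show ?case using first_bianchi_expanded[OF z, of "Mo l d" "Sp i" "Mo j b" "Mo k c"] by (simp add: to_blocks)
  next
    case 17
    show ?case using first_bianchi_expanded[OF z, of "Mo l d" "Mo i a" "Mo j b" "Mo k c"] by (simp add: to_blocks)
  next
    case 18
    show ?case using second_bianchi_expanded[OF z, of "Tm d" "Tm e" "Tm a" "Tm b" "Tm c"] by (simp add: to_blocks)
  next
    \<comment> \<open>Temporal curvature with a non-temporal direction vanishes together with its
      covariant derivatives, and temporal torsion is zero, so a single term of the cyclic sum is
      left and must itself be zero. The same happens for a vertical direction in the next
      case.\<close>
    case 19
    show ?case using second_bianchi_expanded[OF z, of "Tm d" "Tm e" "Tm a" "Tm b" "Sp k"] by (simp add: to_blocks)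
  next
    case 20
    show ?case using second_bianchi_expanded[OF z, of "Tm d" "Tm e" "Tm a" "Tm b" "Mo k c"] by (simp add: to_blocks)
  next
    case 21
    show ?case using second_bianchi_expanded[OF z, of "Sp l" "Sp p" "Tm a" "Tm b" "Tm c"] by (simp add: to_blocks)
  next
    case 22
    show ?case using second_bianchi_expanded[OF z, of "Sp l" "Sp p" "Tm a" "Tm b" "Sp k"] by (simp add: to_blocks)
  next
    case 23
    show ?case using second_bianchi_expanded[OF z, of "Sp l" "Sp p" "Tm a" "Sp j" "Sp k"] by (simp add: to_blocks)
  next
    case 24
    show ?case using second_bianchi_expanded[OF z, of "Sp l" "Sp p" "Sp i" "Sp j" "Sp k"] by (simp add: to_blocks)
  next
    case 25
    show ?case using second_bianchi_expanded[OF z, of "Sp l" "Sp i" "Tm a" "Tm b" "Mo p e"] by (simp add: to_blocks)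
  next
    case 26
    show ?case using second_bianchi_expanded[OF z, of "Sp l" "Sp i" "Tm a" "Sp k" "Mo p e"] by (simp add: to_blocks)
  next
    case 27
    show ?case using second_bianchi_expanded[OF z, of "Sp l" "Sp i" "Sp j" "Sp k" "Mo p e"] by (simp add: to_blocks)
  next
    case 28
    show ?case using second_bianchi_expanded[OF z, of "Sp l" "Sp p" "Tm a" "Mo j b" "Mo k c"] by (simp add: to_blocks)
  next
    case 29
    show ?case using second_bianchi_expanded[OF z, of "Sp l" "Sp p" "Sp i" "Mo j b" "Mo k c"] by (simp add: to_blocks)
  next
    case 30
    show ?case using second_bianchi_expanded[OF z, of "Sp l" "Sp p" "Mo i a" "Mo j b" "Mo k c"] by (simp add: to_blocks)
  qed
qed

end
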